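(* Let $f\colon\mathbf{R}^n\to\overline{\mathbf{R}}$ be a lower-semicontinuous semi-algebraic function that is locally Lipschitz continuous on its domain. Then for any absolutely continuous curve $x\colon[a,b]\to\mathbf{R}^n$ the following are equivalent. 1. $x$ is a curve of near-maximal slope for $f$. 2. $f\circ x$ is nonincreasing and $\dot{x}(t)\in-\partial f(x(t))$ for a.e. $t\in[a,b]$. 3. $f\circ x$ is nonincreasing and, for a.e. $t\in[a,b]$, $\dot{x}(t)\in-\partial f(x(t))$, $\|\dot{x}(t)\|=d(0,\partial f(x(t)))$, and $\|\dot{x}(t)\|=d(0,\partial_c f(x(t)))$.
   Context: $\overline{\mathbf{R}}=\mathbf{R}\cup\{-\infty,+\infty\}$, $r^+=\max\{0,r\}$, $\mathrm{dom}\,f=\{x:f(x)<+\infty\}$, and $d(0,Q)=\inf_{v\in Q}\|v\|$ (equal to $+\infty$ for $Q=\emptyset$). A function $f$ is semi-algebraic if its epigraph $\{(x,r)\in\mathbf{R}^n\times\mathbf{R}: r\ge f(x)\}$ is a semi-algebraic set, i.e. a finite union of sets each defined by finitely many polynomial equalities and strict inequalities. Locally Lipschitz on its domain: $f$ is real-valued on $\mathrm{dom}\,f$ and every point of $\mathrm{dom}\,f$ has a neighborhood $U$ such that $f$ is Lipschitz on $U\cap\mathrm{dom}\,f$. Slope: for $f(\bar{x})$ finite, $|\nabla f|(\bar{x}):=\limsup_{x\to\bar{x},\,x\ne\bar{x}}\frac{(f(\bar{x})-f(x))^+}{\|\bar{x}-x\|}$. Limiting slope: $\overline{|\nabla f|}(\bar{x}):=\liminf|\nabla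 f|(x)$ over $x$ with $(x,f(x))\to(\bar{x},f(\bar{x}))$ ($x=\bar{x}$ allowed). Curve of near-maximal slope for $f$: a curve $\gamma\colon[a,b]\to\mathbf{R}^n$ such that (a) $\gamma$ is absolutely continuous; (b) $\|\dot\gamma(t)\|=\overline{|\nabla f|}(\gamma(t))$ for a.e. $t\in[a,b]$ (in particular $f(\gamma(t))$ is finite for a.e. $t$); (c) $f\circ\gamma$ is nonincreasing and $(f\circ\gamma)'(t)\le-\big(\overline{|\nabla f|}(\gamma(t))\big)^2$ for a.e. $t\in[a,b]$. Subdifferentials at $\bar{x}$ with $f(\bar{x})$ finite (all are empty when $f(\bar{x})$ is not finite): the Fréchet subdifferential $\hat\partial f(\bar{x})$ consists of all $v$ with $f(x)\ge f(\bar{x})+\langle v,x-\bar{x}\rangle+o(\|x-\bar{x}\|)$; the limiting subdifferential $\partial f(\bar{x})$ consists of all $v$ for which there are $x_i$ and $v_i\in\hat\partial f(x_i)$ with $(x_i,f(x_i),v_i)\to(\bar{x},f(\bar{x}),v)$; the horizon subdifferential $\partial^\infty f(\bar{x})$ consists of all $v$ for which there are reals $\tau_i\downarrow0$, points $x_i$, and $v_i\in\hat\partial f(x_i)$ with $(x_i,f(x_i),\tau_iv_i)\to(\bar{x},f(\bar{x}),v)$; the Clarke subdifferential is $\partial_cf(\bar{x}):=\mathrm{cl}\,\mathrm{conv}[\partial f(\bar{x})+\partial^\infty f(\bar{x})]$. *)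

theory Defs
  imports "HOL-Analysis.Analysis" "HOL-Library.Landau_Symbols"
begin

section \<open>Functions with values in the extended reals\<close>

definition effective_domain :: "('a \<Rightarrow> ereal) \<Rightarrow> 'a set" where
  "effective_domain f = {x. f x < \<infinity>}"

definition epigraph :: "('a \<Rightarrow> ereal) \<Rightarrow> ('a \<times> real) set" where
  "epigraph f = {(x, r). ereal r \<ge> f x}"

definition lower_semicontinuous :: "('a::topological_space \<Rightarrow> ereal) \<Rightarrow> bool" where
  "lower_semicontinuous f \<longleftrightarrow> (\<forall>x. f x \<le> Liminf (at x) f)"

definition locally_lipschitz_on_domain :: "('a::metric_space \<Rightarrow> ereal) \<Rightarrow> bool" where
  "locally_lipschitz_on_domain f \<longleftrightarrow>
     (\<forall>x\<in>effective_domain f. \<bar>f x\<bar> \<noteq> \<infinity>) \<and>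
     (\<forall>x\<in>effective_domain f. \<exists>U L. open U \<and> x \<in> U \<and>
        L-lipschitz_on (U \<inter> effective_domain f) (\<lambda>y. real_of_ereal (f y)))"

definition basic_semialgebraic :: "'a::real_normed_vector set \<Rightarrow> bool" where
  "basic_semialgebraic A \<longleftrightarrow>
     (\<exists>P Q. finite P \<and> finite Q \<and>
        (\<forall>p\<in>P \<union> Q. real_polynomial_function p) \<and>
        A = {x. (\<forall>p\<in>P. p x = 0) \<and> (\<forall>q\<in>Q. q x > 0)})"

definition semialgebraic_set :: "'a::real_normed_vector set \<Rightarrow> bool" where
  "semialgebraic_set S \<longleftrightarrow>
     (\<exists>F. finite F \<and> (\<forall>A\<in>F. basic_semialgebraic A) \<and> S = \<Union>F)"

definition semialgebraic_function :: "('a::real_normed_vector \<Rightarrow> ereal) \<Rightarrow> bool" where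
  "semialgebraic_function f \<longleftrightarrow> semialgebraic_set (epigraph f)"

text \<open>Unlike \<^const>\<open>infdist\<close>, this distance from the origin is \<open>\<infinity>\<close> for the empty set.\<close>

definition dist_zero :: "'a::real_normed_vector set \<Rightarrow> ereal" where
  "dist_zero Q = (INF v\<in>Q. ereal (norm v))"


section \<open>Slopes\<close>

text \<open>Both slopes are meaningful only at points where \<open>f\<close> is finite.\<close>

definition slope :: "('a::real_normed_vector \<Rightarrow> ereal) \<Rightarrow> 'a \<Rightarrow> ereal" where
  "slope f xbar = Limsup (at xbar) (\<lambda>x. max 0 (f xbar - f x) / ereal (norm (xbar - x)))"

text \<open>The filter below is that of \<open>(x, f x) \<rightarrow> (xbar, f xbar)\<close>, with \<open>x = xbar\<close> allowed.\<close>

definition limiting_slope :: "('a::real_normed_vector \<Rightarrow> ereal) \<Rightarrow> 'a \<Rightarrow> ereal" where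
  "limiting_slope f xbar =
     Liminf (filtercomap (\<lambda>x. (x, f x)) (nhds (xbar, f xbar))) (slope f)"


section \<open>Subdifferentials\<close>

definition frechet_subdifferential :: "('a::real_inner \<Rightarrow> ereal) \<Rightarrow> 'a \<Rightarrow> 'a set" where
  "frechet_subdifferential f xbar =
     {v. \<bar>f xbar\<bar> \<noteq> \<infinity> \<and>
         (\<exists>r. r \<in> o[at xbar](\<lambda>x. norm (x - xbar)) \<and>
              (\<forall>\<^sub>F x in at xbar. f x \<ge> f xbar + ereal (v \<bullet> (x - xbar)) + ereal (r x)))}"

definition limiting_subdifferential :: "('a::real_inner \<Rightarrow> ereal) \<Rightarrow> 'a \<Rightarrow> 'a set" where
  "limiting_subdifferential f xbar =
     {v. \<bar>f xbar\<bar> \<noteq> \<infinity> \<and>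
         (\<exists>X V. (\<forall>i. V i \<in> frechet_subdifferential f (X i)) \<and>
                (\<lambda>i::nat. (X i, f (X i), V i)) \<longlonglongrightarrow> (xbar, f xbar, v))}"

definition horizon_subdifferential :: "('a::real_inner \<Rightarrow> ereal) \<Rightarrow> 'a \<Rightarrow> 'a set" where
  "horizon_subdifferential f xbar =
     {v. \<bar>f xbar\<bar> \<noteq> \<infinity> \<and>
         (\<exists>\<tau> X V. (\<forall>i. \<tau> i > 0) \<and> decseq \<tau> \<and> \<tau> \<longlonglongrightarrow> 0 \<and>
                (\<forall>i. V i \<in> frechet_subdifferential f (X i)) \<and>
                (\<lambda>i::nat. (X i, f (X i), \<tau> i *\<^sub>R V i)) \<longlonglongrightarrow> (xbar, f xbar, v))}"

definition clarke_subdifferential :: "('a::real_inner \<Rightarrow> ereal) \<Rightarrow> 'a \<Rightarrow> 'a set" where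
  "clarke_subdifferential f xbar =
     closure (convex hull {u + w | u w. u \<in> limiting_subdifferential f xbar \<and>
                                        w \<in> horizon_subdifferential f xbar})"


section \<open>Curves\<close>

definition absolutely_continuous_curve ::
    "real \<Rightarrow> real \<Rightarrow> (real \<Rightarrow> 'a::real_normed_vector) \<Rightarrow> bool" where
  "absolutely_continuous_curve a b \<gamma> \<longleftrightarrow>
     (\<forall>\<epsilon>>0. \<exists>\<delta>>0. \<forall>D.
        finite D \<and> (\<forall>(u, v)\<in>D. a \<le> u \<and> u < v \<and> v \<le> b) \<and>
        disjoint_family_on (\<lambda>(u, v). {u<..<v}) D \<and>
        (\<Sum>(u, v)\<in>D. v - u) < \<delta>
        \<longrightarrow> (\<Sum>(u, v)\<in>D. norm (\<gamma> v - \<gamma> u)) < \<epsilon>)"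

text \<open>Ordinary differentiability of an extended-real function at a point near which it is finite.\<close>

definition has_ereal_derivative ::
    "(real \<Rightarrow> ereal) \<Rightarrow> real \<Rightarrow> real \<Rightarrow> real set \<Rightarrow> bool" where
  "has_ereal_derivative \<phi> D t S \<longleftrightarrow>
     \<bar>\<phi> t\<bar> \<noteq> \<infinity> \<and> (\<forall>\<^sub>F s in at t within S. \<bar>\<phi> s\<bar> \<noteq> \<infinity>) \<and>
     ((\<lambda>s. real_of_ereal (\<phi> s)) has_real_derivative D) (at t within S)"

definition near_maximal_slope_curve ::
    "('a::real_normed_vector \<Rightarrow> ereal) \<Rightarrow> real \<Rightarrow> real \<Rightarrow> (real \<Rightarrow> 'a) \<Rightarrow> bool" where
  "near_maximal_slope_curve f a b \<gamma> \<longleftrightarrow>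
     absolutely_continuous_curve a b \<gamma> \<and>
     (AE t\<in>{a..b} in lebesgue. \<bar>f (\<gamma> t)\<bar> \<noteq> \<infinity> \<and>
        (\<exists>v. (\<gamma> has_vector_derivative v) (at t within {a..b}) \<and>
             ereal (norm v) = limiting_slope f (\<gamma> t))) \<and>
     antimono_on {a..b} (f \<circ> \<gamma>) \<and>
     (AE t\<in>{a..b} in lebesgue.
        (\<exists>D. has_ereal_derivative (f \<circ> \<gamma>) D t {a..b} \<and>
             ereal D \<le> - ((limiting_slope f (\<gamma> t))\<^sup>2)))"

end

theory Submission
  imports Defs
begin

text \<open>
  Everything rests on a chain rule: for almost every \<open>t\<close>, the derivative of \<open>f \<circ> x\<close> at \<open>t\<close> is
  \<open>p \<bullet> x'(t)\<close> for every limiting subgradient \<open>p\<close> at \<open>x t\<close>, and every horizon subgradient is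
  orthogonal to \<open>x'(t)\<close>. Given this, a subgradient of least norm (whose norm is the limiting slope)
  equals \<open>- x'(t)\<close> exactly when \<open>f \<circ> x\<close> decreases at the maximal rate, and \<open>x'(t)\<close> has constant
  inner product with the whole Clarke subdifferential.

  In terms of the closed semialgebraic set \<open>E = epigraph f\<close> the chain rule says that the derivative of
  \<open>z t = (x t, f (x t))\<close> is almost everywhere orthogonal to all limits of proximal normals of \<open>E\<close>
  at \<open>z t\<close>. No stratification is needed for this. Among the points of \<open>E\<close> in a ball of radius \<open>r\<close>
  that have a proximal normal within \<open>\<epsilon>\<close> of \<open>u0\<close>, choose the lexicographically least point \<open>y c\<close> on
  each hyperplane \<open>u0 \<bullet> y = c\<close>. By Tarski--Seidenberg the coordinates of \<open>y\<close> cross each level a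
  bounded number of times, so \<open>y\<close> has variation \<open>O(r)\<close>; as the normal at \<open>y c\<close> is almost \<open>u0\<close>,
  \<open>c\<close> grows at most \<open>2 * \<epsilon>\<close> times as fast as \<open>y\<close> moves. Hence the admissible levels form boundedly many
  intervals of length \<open>O(\<epsilon> * r)\<close>. If the orthogonality failed with a normal near \<open>u0\<close> on a set \<open>B\<close>
  of times, then the levels \<open>u0 \<bullet> z t\<close> for \<open>t \<in> B\<close> near \<open>t0 \<in> B\<close> would spread
  linearly in \<open>t\<close>, which forces \<open>B\<close> to be uniformly porous and so negligible.
\<close>


section \<open>Tarski--Seidenberg by adjoining root functions\<close>

text \<open>The obstacle is uniformity. The constant in a proximal normal inequality is unbounded
  along the curve, and the centre, radius and direction of the ball change with the time, so the
  constants of the estimate on levels may depend on none of them. Quantifier elimination supplies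
  this: the number of root functions attached to a formula does not depend on the values of its
  parameters, so one bound serves all of them, and the quadratic term of the proximal inequality is
  absorbed once the levels are subdivided finely enough. Eliminating a variable through named root
  functions is what makes that bound visible. The set of bad times is not known to be measurable, so
  the null-set arguments run through outer measure and Vitali coverings; the same covering argument
  then gives differentiability of the monotone function \<open>f \<circ> x\<close>. Passing to the
  epigraph treats both kinds of subgradient alike: a limiting subgradient \<open>p\<close> becomes
  the normal \<open>(p, -1)\<close> and a horizon subgradient \<open>w\<close> the normal
  \<open>(w, 0)\<close>.\<close>

inductive polynomial_map :: "(('v \<Rightarrow> real) \<Rightarrow> real) \<Rightarrow> bool" where
  const: "polynomial_map (\<lambda>e. c)"
| var: "polynomial_map (\<lambda>e. e v)"
| add: "\<lbrakk>polynomial_map p; polynomial_map q\<rbrakk> \<Longrightarrow> polynomial_map (\<lambda>e. p e + q e)"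
| mult: "\<lbrakk>polynomial_map p; polynomial_map q\<rbrakk> \<Longrightarrow> polynomial_map (\<lambda>e. p e * q e)"

text \<open>Quantifier-free formulas in semantic form: the predicates themselves are generated, from
  strict positivity of polynomials. Equalities and weak inequalities arise through negation.\<close>

inductive semialg :: "(('v \<Rightarrow> real) \<Rightarrow> bool) \<Rightarrow> bool" where
  pos: "polynomial_map p \<Longrightarrow> semialg (\<lambda>e. 0 < p e)"
| neg: "semialg P \<Longrightarrow> semialg (\<lambda>e. \<not> P e)"
| conj: "\<lbrakk>semialg P; semialg Q\<rbrakk> \<Longrightarrow> semialg (\<lambda>e. P e \<and> Q e)"

lemma semialg_const: "semialg (\<lambda>e. b)"
proof -
  have "semialg (\<lambda>e. 0 < (if b then 1 else 0 :: real))"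
    by (intro semialg.pos polynomial_map.const)
  moreover have "(\<lambda>e::'a \<Rightarrow> real. 0 < (if b then 1 else 0 :: real)) = (\<lambda>e. b)"
    by auto
  ultimately show ?thesis by metis
qed

lemma semialg_disj:
  assumes "semialg P" "semialg Q" shows "semialg (\<lambda>e. P e \<or> Q e)"
proof -
  have "semialg (\<lambda>e. \<not> (\<not> P e \<and> \<not> Q e))"
    by (intro semialg.neg semialg.conj assms)
  then show ?thesis by (simp only: de_Morgan_conj not_not)
qed

lemma semialg_imp:
  assumes "semialg P" "semialg Q" shows "semialg (\<lambda>e. P e \<longrightarrow> Q e)"
  unfolding imp_conv_disj by (intro semialg_disj semialg.neg assms)

lemma semialg_finite_Ex: "\<lbrakk>finite I; \<And>i. i \<in> I \<Longrightarrow> semialg (P i)\<rbrakk> \<Longrightarrow> semialg (\<lambda>e. \<exists>i\<in>I. P i e)"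
  by (induction I rule: finite_induct) (auto intro: semialg_const semialg_disj)

lemma semialg_finite_All: "\<lbrakk>finite I; \<And>i. i \<in> I \<Longrightarrow> semialg (P i)\<rbrakk> \<Longrightarrow> semialg (\<lambda>e. \<forall>i\<in>I. P i e)"
  by (induction I rule: finite_induct) (auto intro: semialg_const semialg.conj)

text \<open>Quantifiers are eliminated by enlarging such a ring until it contains functions that between them
  pass through all roots of a given family of univariate polynomials over it.\<close>

definition sign_ring :: "(('v \<Rightarrow> real) \<Rightarrow> real) set \<Rightarrow> bool" where
  "sign_ring F \<longleftrightarrow> (\<forall>c. (\<lambda>e. c) \<in> F) \<and>
     (\<forall>f\<in>F. \<forall>g\<in>F. (\<lambda>e. f e + g e) \<in> F \<and> (\<lambda>e. f e * g e) \<in> F) \<and>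
     (\<forall>f\<in>F. semialg (\<lambda>e. 0 < f e))"

lemma sign_ringD:
  assumes "sign_ring F"
  shows sign_ring_const: "(\<lambda>e. c) \<in> F"
    and sign_ring_add: "f \<in> F \<Longrightarrow> g \<in> F \<Longrightarrow> (\<lambda>e. f e + g e) \<in> F"
    and sign_ring_mult: "f \<in> F \<Longrightarrow> g \<in> F \<Longrightarrow> (\<lambda>e. f e * g e) \<in> F"
    and sign_ring_sa: "f \<in> F \<Longrightarrow> semialg (\<lambda>e. 0 < f e)"
  using assms by (auto simp: sign_ring_def)

lemma sign_ring_diff:
  assumes "sign_ring F" "f \<in> F" "g \<in> F" shows "(\<lambda>e. f e - g e) \<in> F"
  using sign_ring_add[OF assms(1,2) sign_ring_mult[OF assms(1) sign_ring_const[OF assms(1), of "-1"] assms(3)]]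
  by simp

lemma sign_ring_less:
  assumes "sign_ring F" "f \<in> F" "g \<in> F" shows "semialg (\<lambda>e. f e < g e)"
  using sign_ring_sa[OF assms(1) sign_ring_diff[OF assms(1,3,2)]] by simp

lemma sign_ring_eq:
  assumes "sign_ring F" "f \<in> F" "g \<in> F" shows "semialg (\<lambda>e. f e = g e)"
proof -
  have "semialg (\<lambda>e. \<not> f e < g e \<and> \<not> g e < f e)"
    by (intro semialg.conj semialg.neg sign_ring_less[OF assms(1)] assms)
  then show ?thesis by (simp only: linorder_neq_iff[symmetric] de_Morgan_disj[symmetric] not_not)
qed

lemma sign_ring_power:
  assumes "sign_ring F" "f \<in> F" shows "(\<lambda>e. f e ^ n) \<in> F"
  by (induction n) (use assms in \<open>auto intro: sign_ringD\<close>)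

lemma sign_ring_sum:
  assumes "sign_ring F" "\<And>i. i \<in> I \<Longrightarrow> f i \<in> F" shows "(\<lambda>e. \<Sum>i\<in>I. f i e) \<in> F"
  using assms(2) by (induction I rule: infinite_finite_induct) (auto intro: sign_ringD[OF assms(1)])

lemma polynomial_maps_sign_ring: "sign_ring {p. polynomial_map p}"
  by (auto simp: sign_ring_def intro: polynomial_map.intros semialg.pos)

section \<open>Univariate polynomials with coefficients in a sign ring\<close>

definition poly_eval :: "(nat \<Rightarrow> 'e \<Rightarrow> real) \<Rightarrow> nat \<Rightarrow> 'e \<Rightarrow> real \<Rightarrow> real" where
  "poly_eval a n e x = (\<Sum>i<n. a i e * x ^ i)"

text \<open>Coefficients are functions of the parameters, so the degree may drop with
  \<open>e\<close>. A bound \<open>n\<close> counts coefficients and says nothing about which of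
  them vanish.\<close>

definition poly_family :: "('e \<Rightarrow> real) set \<Rightarrow> ('e \<Rightarrow> real \<Rightarrow> real) set" where
  "poly_family F = {poly_eval a n |a n. \<forall>i. a i \<in> F}"

lemma poly_familyI: "(\<And>i. a i \<in> F) \<Longrightarrow> poly_eval a n \<in> poly_family F"
  by (auto simp: poly_family_def)

lemma poly_family_mono: "F \<subseteq> G \<Longrightarrow> poly_family F \<subseteq> poly_family G"
  by (force simp: poly_family_def)

lemma poly_family_eval:
  assumes "sign_ring F" "h \<in> poly_family F" "f \<in> F" shows "(\<lambda>e. h e (f e)) \<in> F"
  using assms(2) by (auto simp: poly_family_def poly_eval_def
      intro!: sign_ring_sum sign_ring_mult sign_ring_power assms)

lemma poly_family_const:
  assumes "sign_ring F" "f \<in> F" shows "(\<lambda>e x. f e) \<in> poly_family F"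
proof -
  have "poly_eval (\<lambda>i. f) 1 \<in> poly_family F" using assms by (intro poly_familyI)
  also have "poly_eval (\<lambda>i. f) 1 = (\<lambda>e x. f e)" by (auto simp: poly_eval_def fun_eq_iff)
  finally show ?thesis .
qed

lemma poly_eval_pad: "n \<le> m \<Longrightarrow> poly_eval a n = poly_eval (\<lambda>i. if i < n then a i else (\<lambda>e. 0)) m"
  unfolding poly_eval_def fun_eq_iff
  by (intro allI sum.mono_neutral_cong_left) auto

lemma poly_family_pad:
  assumes "sign_ring F" "\<And>i. a i \<in> F" "n \<le> m"
  obtains b where "\<And>i. b i \<in> F" "poly_eval a n = poly_eval b m"
proof (rule that)
  show "(if i < n then a i else (\<lambda>e. 0)) \<in> F" for i
    using assms(2) sign_ring_const[OF assms(1)] by simp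
qed (rule poly_eval_pad[OF assms(3)])

lemma poly_family_add:
  assumes "sign_ring F" "h \<in> poly_family F" "k \<in> poly_family F" shows "(\<lambda>e x. h e x + k e x) \<in> poly_family F"
proof -
  from assms(2,3) obtain a n b m where h: "h = poly_eval a n" "\<And>i. a i \<in> F" and k: "k = poly_eval b m" "\<And>i. b i \<in> F"
    by (auto simp: poly_family_def)
  obtain a' where a': "\<And>i. a' i \<in> F" "h = poly_eval a' (max n m)"
    using poly_family_pad[OF assms(1), of a n "max n m"] h by auto
  obtain b' where b': "\<And>i. b' i \<in> F" "k = poly_eval b' (max n m)"
    using poly_family_pad[OF assms(1), of b m "max n m"] k by auto
  have "poly_eval (\<lambda>i e. a' i e + b' i e) (max n m) \<in> poly_family F"
    using a' b' assms(1) by (intro poly_familyI sign_ring_add)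
  also have "poly_eval (\<lambda>i e. a' i e + b' i e) (max n m) = (\<lambda>e x. h e x + k e x)"
    by (auto simp: a' b' poly_eval_def fun_eq_iff sum.distrib algebra_simps)
  finally show ?thesis .
qed

lemma poly_family_scale:
  assumes "sign_ring F" "h \<in> poly_family F" "f \<in> F" shows "(\<lambda>e x. f e * h e x) \<in> poly_family F"
proof -
  from assms(2) obtain a n where h: "h = poly_eval a n" "\<And>i. a i \<in> F"
    by (auto simp: poly_family_def)
  have "poly_eval (\<lambda>i e. f e * a i e) n \<in> poly_family F"
    using h assms by (intro poly_familyI sign_ring_mult)
  also have "poly_eval (\<lambda>i e. f e * a i e) n = (\<lambda>e x. f e * h e x)"
    by (auto simp: h poly_eval_def fun_eq_iff sum_distrib_left algebra_simps)
  finally show ?thesis .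
qed

lemma poly_family_shift:
  assumes "sign_ring F" "h \<in> poly_family F" shows "(\<lambda>e x. x * h e x) \<in> poly_family F"
proof -
  from assms(2) obtain a n where h: "h = poly_eval a n" "\<And>i. a i \<in> F"
    by (auto simp: poly_family_def)
  have "poly_eval (\<lambda>i. case i of 0 \<Rightarrow> (\<lambda>e. 0) | Suc j \<Rightarrow> a j) (Suc n) \<in> poly_family F"
    using h assms by (intro poly_familyI) (auto split: nat.splits intro: sign_ring_const)
  also have "poly_eval (\<lambda>i. case i of 0 \<Rightarrow> (\<lambda>e. 0) | Suc j \<Rightarrow> a j) (Suc n) = (\<lambda>e x. x * h e x)"
    by (auto simp: h poly_eval_def fun_eq_iff sum.lessThan_Suc_shift sum_distrib_left algebra_simps
        simp del: sum.lessThan_Suc)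
  finally show ?thesis .
qed

lemma poly_family_mult:
  assumes "sign_ring F" "h \<in> poly_family F" "k \<in> poly_family F" shows "(\<lambda>e x. h e x * k e x) \<in> poly_family F"
proof -
  have pw: "(\<lambda>e x. x ^ i * k e x) \<in> poly_family F" for i
    by (induction i) (use poly_family_shift[OF assms(1)] assms(3) in \<open>auto simp: mult.assoc\<close>)
  from assms(2) obtain a n where h: "h = poly_eval a n" "\<And>i. a i \<in> F"
    by (auto simp: poly_family_def)
  have "(\<lambda>e x. poly_eval a n e x * k e x) \<in> poly_family F"
  proof (induction n)
    case 0
    then show ?case using poly_family_const[OF assms(1) sign_ring_const[OF assms(1), of 0]]
      by (simp add: poly_eval_def)
  next
    case (Suc n)
    have "(\<lambda>e x. poly_eval a n e x * k e x + a n e * (x ^ n * k e x)) \<in> poly_family F"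
      by (intro poly_family_add poly_family_scale pw assms(1) Suc h)
    then show ?case by (simp add: poly_eval_def algebra_simps)
  qed
  then show ?thesis by (simp add: h)
qed

text \<open>The new ring is \<open>F[\<xi>]\<close>, all functions \<open>h e (\<xi> e)\<close> with
  \<open>h\<close> a polynomial over \<open>F\<close>. It is closed under the ring operations by
  construction; the assumption asks for the one thing that is not automatic, that the signs of these
  values are semialgebraic.\<close>

lemma sign_ring_adjoin:
  assumes F: "sign_ring F" and \<xi>: "\<And>h. h \<in> poly_family F \<Longrightarrow> semialg (\<lambda>e. 0 < h e (\<xi> e))"
  obtains F' where "sign_ring F'" "F \<subseteq> F'" "\<xi> \<in> F'"
proof
  let ?F = "{\<lambda>e. h e (\<xi> e) |h. h \<in> poly_family F}"
  have c: "f \<in> ?F" if "f \<in> F" for f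
    using poly_family_const[OF F that] by force
  then show "F \<subseteq> ?F" by blast
  show "sign_ring ?F"
    unfolding sign_ring_def
  proof (intro conjI allI ballI)
    fix b show "(\<lambda>e. b) \<in> ?F" by (intro c sign_ring_const F)
  next
    fix f g assume "f \<in> ?F" "g \<in> ?F"
    then obtain h k where *: "f = (\<lambda>e. h e (\<xi> e))" "g = (\<lambda>e. k e (\<xi> e))" "h \<in> poly_family F" "k \<in> poly_family F" by auto
    show "(\<lambda>e. f e + g e) \<in> ?F"
      unfolding * by (rule CollectI, rule exI, rule conjI[OF refl poly_family_add[OF F *(3,4)]])
    show "(\<lambda>e. f e * g e) \<in> ?F"
      unfolding * by (rule CollectI, rule exI, rule conjI[OF refl poly_family_mult[OF F *(3,4)]])
  next
    fix f assume "f \<in> ?F"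
    then show "semialg (\<lambda>e. 0 < f e)" using \<xi> by auto
  qed
  have "(\<lambda>e x. x) \<in> poly_family F"
    using poly_family_shift[OF F poly_family_const[OF F sign_ring_const[OF F, of 1]]] by simp
  then show "\<xi> \<in> ?F" by force
qed

section \<open>Root functions and the cells between them\<close>

definition covers_roots where
  "covers_roots R h \<longleftrightarrow> (\<forall>e x. h e x = 0 \<and> (\<exists>y. h e y \<noteq> 0) \<longrightarrow> (\<exists>\<rho>\<in>R. x = \<rho> e))"

text \<open>Both points have to lie strictly off every root function, so the relation is not
  reflexive: \<open>same_cell R e s s\<close> says that \<open>s\<close> is no value of a root
  function at \<open>e\<close>, and it is used as a test for this.\<close>

definition same_cell :: "('e \<Rightarrow> real) set \<Rightarrow> 'e \<Rightarrow> real \<Rightarrow> real \<Rightarrow> bool" where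
  "same_cell R e s t \<longleftrightarrow> (\<forall>\<rho>\<in>R. \<rho> e < s \<and> \<rho> e < t \<or> s < \<rho> e \<and> t < \<rho> e)"

text \<open>A point in every cell, whatever order the root functions take at \<open>e\<close>: 0
  serves when there are none, the shifts by 1 reach the two unbounded cells, and the midpoints of
  pairs reach the bounded ones.\<close>

definition samples :: "('e \<Rightarrow> real) set \<Rightarrow> ('e \<Rightarrow> real) set" where
  "samples R = {\<lambda>e. 0} \<union> (\<lambda>\<rho> e. \<rho> e + 1) ` R \<union> (\<lambda>\<rho> e. \<rho> e - 1) ` R \<union>
     (\<lambda>(\<rho>, \<sigma>) e. 1/2 * (\<rho> e + \<sigma> e)) ` (R \<times> R)"

lemma finite_samples: "finite R \<Longrightarrow> finite (samples R)"
  by (auto simp: samples_def)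

lemma samples_subset:
  assumes "sign_ring F" "R \<subseteq> F" shows "samples R \<subseteq> F"
proof -
  have "(\<lambda>e. 1/2 * (\<rho> e + \<sigma> e)) \<in> F" if "\<rho> \<in> R" "\<sigma> \<in> R" for \<rho> \<sigma>
    using that assms(2) by (intro sign_ring_mult[OF assms(1)] sign_ring_add[OF assms(1)]
        sign_ring_const[OF assms(1)]) auto
  moreover have "(\<lambda>e. \<rho> e + 1) \<in> F" "(\<lambda>e. \<rho> e - 1) \<in> F" if "\<rho> \<in> R" for \<rho>
    using that assms(2) by (auto intro!: sign_ring_diff[OF assms(1)] sign_ring_add[OF assms(1)]
        sign_ring_const[OF assms(1)])
  ultimately show ?thesis
    using sign_ring_const[OF assms(1)] unfolding samples_def by auto
qed

lemma sample_in_cell: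
  assumes "finite R" "\<And>\<rho>. \<rho> \<in> R \<Longrightarrow> \<rho> e \<noteq> x"
  shows "\<exists>s\<in>samples R. same_cell R e (s e) x"
proof -
  let ?L = "{\<rho> \<in> R. \<rho> e < x}" and ?U = "{\<rho> \<in> R. x < \<rho> e}"
  have fin: "finite ?L" "finite ?U" using assms(1) by auto
  have LU: "\<rho> e < x \<or> x < \<rho> e" if "\<rho> \<in> R" for \<rho>
    using assms(2)[OF that] by linarith
  have L: "\<exists>l\<in>?L. \<forall>\<rho>\<in>?L. \<rho> e \<le> l e" if "?L \<noteq> {}"
    using ex_is_arg_min_if_finite[OF fin(1) that, of "\<lambda>\<rho>. - \<rho> e"]
    by (auto simp: is_arg_min_linorder)
  have U: "\<exists>u\<in>?U. \<forall>\<rho>\<in>?U. u e \<le> \<rho> e" if "?U \<noteq> {}"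
    using ex_is_arg_min_if_finite[OF fin(2) that, of "\<lambda>\<rho>. \<rho> e"]
    by (auto simp: is_arg_min_linorder)
  consider "?L = {}" "?U = {}" | "?L = {}" "?U \<noteq> {}" | "?L \<noteq> {}" "?U = {}" | "?L \<noteq> {}" "?U \<noteq> {}" by blast
  then show ?thesis
  proof cases
    case 1
    then have "R = {}" using LU by blast
    then show ?thesis by (auto simp: samples_def same_cell_def)
  next
    case 2
    then obtain u where u: "u \<in> ?U" "\<forall>\<rho>\<in>?U. u e \<le> \<rho> e" using U by blast
    have "u e - 1 < \<rho> e \<and> x < \<rho> e" if "\<rho> \<in> R" for \<rho>
      using LU[OF that] u that 2 by force
    moreover have "(\<lambda>e. u e - 1) \<in> samples R" using u by (auto simp: samples_def)
    ultimately show ?thesis by (intro bexI[of _ "\<lambda>e. u e - 1"]) (auto simp: same_cell_def)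
  next
    case 3
    then obtain u where u: "u \<in> ?L" "\<forall>\<rho>\<in>?L. \<rho> e \<le> u e" using L by blast
    have "\<rho> e < u e + 1 \<and> \<rho> e < x" if "\<rho> \<in> R" for \<rho>
      using LU[OF that] u that 3 by force
    moreover have "(\<lambda>e. u e + 1) \<in> samples R" using u by (auto simp: samples_def)
    ultimately show ?thesis by (intro bexI[of _ "\<lambda>e. u e + 1"]) (auto simp: same_cell_def)
  next
    case 4
    then obtain u l where u: "u \<in> ?U" "\<forall>\<rho>\<in>?U. u e \<le> \<rho> e" and l: "l \<in> ?L" "\<forall>\<rho>\<in>?L. \<rho> e \<le> l e"
      using L U by blast
    let ?s = "\<lambda>e. 1/2 * (l e + u e)"
    have "?s \<in> samples R"
      unfolding samples_def using u l by (intro UnI2 image_eqI[where x="(l,u)"]) auto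
    moreover have "\<rho> e < ?s e \<and> \<rho> e < x \<or> ?s e < \<rho> e \<and> x < \<rho> e" if "\<rho> \<in> R" for \<rho>
    proof -
      have "l e < x" "x < u e" using u l by auto
      moreover have "\<rho> e \<le> l e \<or> u e \<le> \<rho> e" using LU[OF that] u l that by blast
      ultimately show ?thesis using LU[OF that] by (auto simp: field_simps)
    qed
    ultimately show ?thesis by (intro bexI[of _ ?s]) (auto simp: same_cell_def)
  qed
qed

lemma semialg_same_cell:
  assumes "sign_ring F" "finite R" "R \<subseteq> F" "s \<in> F" "t \<in> F"
  shows "semialg (\<lambda>e. same_cell R e (s e) (t e))"
  unfolding same_cell_def
proof (rule semialg_finite_All[OF assms(2)])
  fix \<rho> assume "\<rho> \<in> R"
  then have "\<rho> \<in> F" using assms(3) by blast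
  then show "semialg (\<lambda>e. \<rho> e < s e \<and> \<rho> e < t e \<or> s e < \<rho> e \<and> t e < \<rho> e)"
    by (intro semialg_disj semialg.conj sign_ring_less[OF assms(1)] assms(4,5))
qed

lemma poly_eval_nonzero:
  assumes "a k e \<noteq> 0" shows "\<exists>y. poly_eval a (Suc k) e y \<noteq> 0"
proof (rule ccontr)
  assume "\<not> ?thesis"
  then have "\<forall>y. (\<Sum>i\<le>k. a i e * y ^ i) = 0" by (simp add: poly_eval_def lessThan_Suc_atMost)
  then show False using polyfun_eq_0[of "\<lambda>i. a i e" k] assms by auto
qed

lemma poly_eval_at_infinity:
  assumes "a k e \<noteq> 0" "k \<noteq> 0"
  shows "eventually (\<lambda>x. B \<le> \<bar>poly_eval a (Suc k) e x\<bar>) at_infinity"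
  using Limits.polyfun_extremal[of "\<lambda>i. a i e" k k B] assms
  by (auto simp: poly_eval_def lessThan_Suc_atMost eventually_at_infinity)

lemma poly_eval_derivative:
  "(poly_eval a (Suc k) e has_real_derivative poly_eval (\<lambda>i e. real (Suc i) * a (Suc i) e) k e x) (at x)"
proof -
  have "((\<lambda>x. \<Sum>i<Suc k. a i e * x ^ i) has_real_derivative
          (\<Sum>i<Suc k. a i e * (real i * x ^ (i - 1)))) (at x)"
    by (auto intro!: derivative_eq_intros sum.cong)
  also have "(\<Sum>i<Suc k. a i e * (real i * x ^ (i - 1))) = poly_eval (\<lambda>i e. real (Suc i) * a (Suc i) e) k e x"
    unfolding poly_eval_def sum.lessThan_Suc_shift by (auto intro!: sum.cong)
  finally show ?thesis by (simp add: poly_eval_def[abs_def])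
qed

lemma continuous_poly_eval: "continuous_on S (poly_eval a k e)"
  unfolding poly_eval_def[abs_def] by (intro continuous_intros)

definition cell :: "real set \<Rightarrow> real \<Rightarrow> real \<Rightarrow> bool" where
  "cell Z s t \<longleftrightarrow> (\<forall>r\<in>Z. r < s \<and> r < t \<or> s < r \<and> t < r)"

lemma same_cell_eq_cell: "same_cell R e = cell ((\<lambda>\<rho>. \<rho> e) ` R)"
  by (auto simp: same_cell_def cell_def fun_eq_iff)

lemma cell_between: "cell Z s t \<Longrightarrow> min s t \<le> z \<Longrightarrow> z \<le> max s t \<Longrightarrow> cell Z z t"
  unfolding cell_def by (smt (verit))

lemma cell_sym: "cell Z s t \<Longrightarrow> cell Z t s"
  unfolding cell_def by blast

lemma cell_trans: "cell Z s t \<Longrightarrow> cell Z t u \<Longrightarrow> cell Z s u"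
  unfolding cell_def by (meson order_less_asym)

lemma no_zero_same_sign:
  fixes f :: "real \<Rightarrow> real"
  assumes c: "continuous_on UNIV f" and nz: "\<And>z. min s t \<le> z \<Longrightarrow> z \<le> max s t \<Longrightarrow> f z \<noteq> 0"
  shows "0 < f s * f t"
proof (rule ccontr)
  assume "\<not> ?thesis"
  then have *: "(f s \<le> 0 \<and> 0 \<le> f t) \<or> (f t \<le> 0 \<and> 0 \<le> f s)"
    by (metis linorder_le_cases mult_pos_pos mult_neg_neg not_le)
  have ivt: "\<exists>z. a \<le> z \<and> z \<le> b \<and> f z = 0" if "a \<le> b" "(f a \<le> 0 \<and> 0 \<le> f b) \<or> (f b \<le> 0 \<and> 0 \<le> f a)" for a b
    using that IVT'[of f a 0 b] IVT2'[of f b 0 a] continuous_on_subset[OF c subset_UNIV] by metis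
  show False
    using ivt[of s t] ivt[of t s] * nz by (smt (verit))
qed

text \<open>\<open>Z\<close> contains all critical points of \<open>P\<close>, so \<open>P'\<close>
  keeps the sign of \<open>P' m\<close> on the whole cell and \<open>P' m * P\<close> is strictly
  increasing there. Its sign at \<open>s\<close> therefore tells on which side of the root
  \<open>s\<close> lies, without evaluating anything at the root.\<close>

lemma root_position:
  fixes P P' :: "real \<Rightarrow> real"
  assumes der: "\<And>x. (P has_real_derivative P' x) (at x)" and c: "continuous_on UNIV P'"
    and Z: "\<And>x. P' x = 0 \<Longrightarrow> x \<in> Z"
    and x: "P x = 0" "cell Z x m" and s: "cell Z s m"
  shows "s < x \<longleftrightarrow> P' m * P s < 0" and "x < s \<longleftrightarrow> 0 < P' m * P s" and "P s = 0 \<longleftrightarrow> s = x"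
proof -
  have sg: "0 < P' z * P' m" if "cell Z z m" for z
  proof (rule no_zero_same_sign[OF c])
    fix w assume "min z m \<le> w" "w \<le> max z m"
    then have "cell Z w m" using that cell_between by blast
    then have "w \<notin> Z" unfolding cell_def by blast
    then show "P' w \<noteq> 0" using Z by blast
  qed
  have *: "0 < P' m * (P v - P u)" if uv: "u < v" "cell Z u m" "cell Z v m" for u v
  proof -
    obtain z where z: "u < z" "z < v" "P v - P u = (v - u) * P' z"
      using MVT2[OF uv(1), of P P'] der by auto
    have "cell Z z v" using cell_between[of Z u v z] cell_trans[OF uv(2) cell_sym[OF uv(3)]] z by auto
    then have "cell Z z m" using uv(3) cell_trans by blast
    then have "0 < P' z * P' m" by (rule sg)
    then have "0 < (v - u) * (P' z * P' m)" using uv(1) by simp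
    then show ?thesis unfolding z(3) by (simp only: mult_ac)
  qed
  have 1: "P' m * P s < 0" if "s < x" using *[OF that s x(2)] x(1) by simp
  have 2: "0 < P' m * P s" if "x < s" using *[OF that x(2) s] x(1) by simp
  show "s < x \<longleftrightarrow> P' m * P s < 0" "x < s \<longleftrightarrow> 0 < P' m * P s" "P s = 0 \<longleftrightarrow> s = x"
    using 1 2 x(1) by (cases s x rule: linorder_cases; force)+
qed

text \<open>\<open>P' m * P\<close> increases from \<open>m\<close> up to the next point of
  \<open>Z\<close>, so a root in between shows as a sign change between these two ends. When no
  point of \<open>Z\<close> follows, unboundedness of \<open>P\<close> replaces the second end. The
  right-hand side mentions only signs and comparisons of values at points of the ring.\<close>

lemma root_right_iff:
  fixes P P' :: "real \<Rightarrow> real"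
  assumes der: "\<And>x. (P has_real_derivative P' x) (at x)" and c: "continuous_on UNIV P'"
    and Z: "\<And>x. P' x = 0 \<Longrightarrow> x \<in> Z" and fin: "finite Z" and m: "cell Z m m"
    and inf: "\<And>B. eventually (\<lambda>x. B \<le> \<bar>P x\<bar>) at_infinity"
  shows "(\<exists>x>m. P x = 0 \<and> cell Z x m) \<longleftrightarrow>
    P' m * P m < 0 \<and> ((\<forall>r\<in>Z. \<not> m < r) \<or>
      (\<exists>r\<in>Z. m < r \<and> (\<forall>q\<in>Z. \<not> (m < q \<and> q < r)) \<and> 0 < P' m * P r))"
    (is "?L \<longleftrightarrow> ?R")
proof -
  have sg: "0 < P' m * P' z" if "m \<le> z" "\<forall>q\<in>Z. \<not> (m < q \<and> q \<le> z)" for z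
  proof (rule no_zero_same_sign[OF c])
    fix w assume "min m z \<le> w" "w \<le> max m z"
    then have "w \<notin> Z" using that m unfolding cell_def by fastforce
    then show "P' w \<noteq> 0" using Z by blast
  qed
  have inc: "0 < P' m * (P v - P u)" if uv: "m \<le> u" "u < v" "\<forall>q\<in>Z. \<not> (m < q \<and> q < v)" for u v
  proof -
    obtain z where z: "u < z" "z < v" "P v - P u = (v - u) * P' z"
      using MVT2[OF uv(2), of P P'] der by auto
    have "0 < P' m * P' z" using uv z by (intro sg) force+
    then have "0 < (v - u) * (P' m * P' z)" using uv(2) by simp
    then show ?thesis unfolding z(3) by (simp only: mult_ac)
  qed
  have contP: "continuous_on S P" for S
    by (intro continuous_at_imp_continuous_on ballI DERIV_isCont[OF der])
  have ivt: "\<exists>x. m < x \<and> x < v \<and> P x = 0" if v: "m < v" "P' m * P m < 0" "0 < P' m * P v" for v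
  proof -
    have "continuous_on {m..v} (\<lambda>x. P' m * P x)" by (intro continuous_intros contP)
    then obtain x where x: "m \<le> x" "x \<le> v" "P' m * P x = 0"
      using IVT'[of "\<lambda>x. P' m * P x" m 0 v] v(1) less_imp_le[OF v(2)] less_imp_le[OF v(3)] by force
    moreover have "P' m \<noteq> 0" "x \<noteq> m" "x \<noteq> v" using x v by auto
    ultimately show ?thesis by (intro exI[of _ x]) auto
  qed
  show ?thesis
  proof
    assume ?L
    then obtain x where x: "m < x" "P x = 0" "cell Z x m" by blast
    have no: "\<forall>q\<in>Z. \<not> (m < q \<and> q \<le> x)" using x(3) unfolding cell_def by force
    have "0 < P' m * (P x - P m)" using no x by (intro inc) auto
    then have neg: "P' m * P m < 0" using x(2) by simp
    show ?R
    proof (cases "\<forall>r\<in>Z. \<not> m < r")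
      case True
      then show ?thesis using neg by blast
    next
      case False
      let ?U = "{r\<in>Z. m < r}"
      have r: "Min ?U \<in> Z" "m < Min ?U" "\<forall>q\<in>Z. m < q \<longrightarrow> Min ?U \<le> q"
      proof -
        have "Min ?U \<in> ?U" using False fin by (intro Min_in) auto
        then show "Min ?U \<in> Z" "m < Min ?U" by blast+
      qed (use fin in auto)
      have "0 < P' m * (P (Min ?U) - P x)" using no x r by (intro inc) force+
      then show ?thesis using r neg x(2) by force
    qed
  next
    assume R: ?R
    have neg: "P' m * P m < 0" using R by blast
    have fin: ?L if v: "m < v" "\<forall>q\<in>Z. \<not> (m < q \<and> q < v)" "0 < P' m * P v" for v
    proof -
      obtain x where "m < x" "x < v" "P x = 0" using ivt[OF v(1) neg v(3)] by blast
      moreover have "cell Z x m" using m v(2) \<open>m < x\<close> \<open>x < v\<close> unfolding cell_def by force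
      ultimately show ?thesis by blast
    qed
    show ?L
    proof (cases "\<forall>r\<in>Z. \<not> m < r")
      case True
      obtain b where b: "\<And>x. b \<le> \<bar>x\<bar> \<Longrightarrow> \<bar>P m\<bar> + 1 \<le> \<bar>P x\<bar>"
        using inf[of "\<bar>P m\<bar> + 1"] by (auto simp: eventually_at_infinity)
      \<comment> \<open>Far enough out for the absolute value of \<open>P v\<close> to exceed that
        of \<open>P m\<close>. As \<open>P' m * P\<close> increases from \<open>m\<close> to
        \<open>v\<close>, this forces \<open>P v\<close> to have the sign of
        \<open>P' m\<close>.\<close>
      define v where "v = max (m + 1) \<bar>b\<bar>"
      have v: "m < v" "\<bar>P m\<bar> + 1 \<le> \<bar>P v\<bar>" using b[of v] by (auto simp: v_def)
      have i: "0 < P' m * (P v - P m)" using True v by (intro inc) auto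
      have "0 < P' m * P v"
      proof (cases "0 < P' m")
        case True
        then have "P m < P v" using i by (simp add: zero_less_mult_iff)
        then have "0 < P v" using v(2) by linarith
        then show ?thesis using True by simp
      next
        case False
        then have "P' m < 0" "P v < P m" using i by (auto simp: zero_less_mult_iff)
        then have "P v < 0" using v(2) by linarith
        then show ?thesis using \<open>P' m < 0\<close> by (simp add: mult_neg_neg)
      qed
      then show ?thesis using fin[of v] True v by auto
    next
      case False
      then show ?thesis using R fin by blast
    qed
  qed
qed

text \<open>The case of a root to the right, applied to the reflected function
  \<open>\<lambda>x. P (- x)\<close> and the reflected set.\<close>

lemma root_left_iff:
  fixes P P' :: "real \<Rightarrow> real"
  assumes der: "\<And>x. (P has_real_derivative P' x) (at x)" and c: "continuous_on UNIV P'"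
    and Z: "\<And>x. P' x = 0 \<Longrightarrow> x \<in> Z" and fin: "finite Z" and m: "cell Z m m"
    and inf: "\<And>B. eventually (\<lambda>x. B \<le> \<bar>P x\<bar>) at_infinity"
  shows "(\<exists>x<m. P x = 0 \<and> cell Z x m) \<longleftrightarrow>
    0 < P' m * P m \<and> ((\<forall>r\<in>Z. \<not> r < m) \<or>
      (\<exists>r\<in>Z. r < m \<and> (\<forall>q\<in>Z. \<not> (q < m \<and> r < q)) \<and> P' m * P r < 0))"
proof -
  have cm: "cell (uminus ` Z) x y \<longleftrightarrow> cell Z (- x) (- y)" for x y
    unfolding cell_def by (auto simp: less_minus_iff minus_less_iff)
  have "(\<exists>x>-m. P (- x) = 0 \<and> cell (uminus ` Z) x (-m)) \<longleftrightarrow>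
    - P' (- (- m)) * P (- (- m)) < 0 \<and> ((\<forall>r\<in>uminus ` Z. \<not> -m < r) \<or>
      (\<exists>r\<in>uminus ` Z. -m < r \<and> (\<forall>q\<in>uminus ` Z. \<not> (-m < q \<and> q < r)) \<and> 0 < - P' (- (- m)) * P (- r)))"
  proof (rule root_right_iff)
    fix x show "((\<lambda>x. P (- x)) has_real_derivative - P' (- x)) (at x)"
      using DERIV_chain'[OF DERIV_minus[OF DERIV_ident] der[of "- x"]] by simp
    show "continuous_on UNIV (\<lambda>x. - P' (- x))"
      by (intro continuous_intros continuous_on_compose2[OF c]) auto
    show "\<And>x. - P' (- x) = 0 \<Longrightarrow> x \<in> uminus ` Z"
      using Z by (force simp: image_iff)
    show "finite (uminus ` Z)" using fin by simp
    show "cell (uminus ` Z) (- m) (- m)" using m by (simp add: cm)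
    fix B show "eventually (\<lambda>x. B \<le> \<bar>P (- x)\<bar>) at_infinity"
      using inf[of B] unfolding eventually_at_infinity by (metis norm_minus_cancel)
  qed
  moreover have "(\<exists>x>-m. P (- x) = 0 \<and> cell (uminus ` Z) x (-m)) \<longleftrightarrow> (\<exists>x<m. P x = 0 \<and> cell Z x m)"
    unfolding cm by (metis minus_less_iff minus_minus neg_less_iff_less)
  ultimately show ?thesis by simp
qed

lemma covers_derivative_roots:
  assumes "k \<noteq> 0" "a k e \<noteq> 0" "covers_roots R (poly_eval (\<lambda>i e. real (Suc i) * a (Suc i) e) k)"
    and "poly_eval (\<lambda>i e. real (Suc i) * a (Suc i) e) k e x = 0"
  shows "x \<in> (\<lambda>\<rho>. \<rho> e) ` R"
proof -
  obtain j where j: "k = Suc j" using assms(1) by (cases k) auto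
  have "\<exists>y. poly_eval (\<lambda>i e. real (Suc i) * a (Suc i) e) (Suc j) e y \<noteq> 0"
    using assms(2) by (intro poly_eval_nonzero) (simp add: j)
  then show ?thesis using assms(3,4) unfolding covers_roots_def j by blast
qed

text \<open>The root is not an element of the ring, but its existence is decided by signs at
  \<open>m\<close> and at the root functions adjacent to it, once the cases of a root at
  \<open>m\<close>, to its right and to its left are separated.\<close>

lemma semialg_root_in_cell:
  assumes F: "sign_ring F" and a: "\<And>i. a i \<in> F" and k: "k \<noteq> 0"
    and R: "finite R" "R \<subseteq> F" "covers_roots R (poly_eval (\<lambda>i e. real (Suc i) * a (Suc i) e) k)"
    and m: "m \<in> F"
  shows "semialg (\<lambda>e. a k e \<noteq> 0 \<and> (\<exists>x. poly_eval a (Suc k) e x = 0 \<and> same_cell R e x (m e)))"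
proof -
  define P where "P = poly_eval a (Suc k)"
  define P' where "P' = poly_eval (\<lambda>i e. real (Suc i) * a (Suc i) e) k"
  have PF: "P \<in> poly_family F" "P' \<in> poly_family F"
    unfolding P_def P'_def by (intro poly_familyI a sign_ring_mult sign_ring_const F)+
  have eq: "a k e \<noteq> 0 \<and> (\<exists>x. P e x = 0 \<and> same_cell R e x (m e)) \<longleftrightarrow>
    \<not> a k e = 0 \<and> same_cell R e (m e) (m e) \<and> (P e (m e) = 0 \<or>
      (P' e (m e) * P e (m e) < 0 \<and> ((\<forall>r\<in>R. \<not> m e < r e) \<or>
      (\<exists>r\<in>R. m e < r e \<and> (\<forall>q\<in>R. \<not> (m e < q e \<and> q e < r e)) \<and> 0 < P' e (m e) * P e (r e)))) \<or>
      (0 < P' e (m e) * P e (m e) \<and> ((\<forall>r\<in>R. \<not> r e < m e) \<or>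
      (\<exists>r\<in>R. r e < m e \<and> (\<forall>q\<in>R. \<not> (q e < m e \<and> r e < q e)) \<and> P' e (m e) * P e (r e) < 0))))"
    for e
  proof (cases "a k e \<noteq> 0 \<and> same_cell R e (m e) (m e)")
    case False
    moreover have "same_cell R e x (m e) \<Longrightarrow> same_cell R e (m e) (m e)" for x
      by (auto simp: same_cell_def)
    ultimately show ?thesis by blast
  next
    case True
    let ?Z = "(\<lambda>\<rho>. \<rho> e) ` R"
    have 1: "(P e has_real_derivative P' e x) (at x)" for x
      unfolding P_def P'_def by (rule poly_eval_derivative)
    have 2: "continuous_on UNIV (P' e)" unfolding P'_def by (rule continuous_poly_eval)
    have 3: "P' e x = 0 \<Longrightarrow> x \<in> ?Z" for x
      unfolding P'_def using covers_derivative_roots[where e=e, OF k _ R(3)] True by blast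
    have 4: "finite ?Z" using R by simp
    have 5: "cell ?Z (m e) (m e)" using True by (simp add: same_cell_eq_cell)
    have 6: "eventually (\<lambda>x. B \<le> \<bar>P e x\<bar>) at_infinity" for B
      unfolding P_def using True k by (intro poly_eval_at_infinity) auto
    have "(\<exists>x. P e x = 0 \<and> same_cell R e x (m e)) \<longleftrightarrow> P e (m e) = 0 \<or>
       (\<exists>x>m e. P e x = 0 \<and> cell ?Z x (m e)) \<or> (\<exists>x<m e. P e x = 0 \<and> cell ?Z x (m e))"
      using 5 unfolding same_cell_eq_cell by (metis linorder_neqE)
    then show ?thesis
      using root_right_iff[of "P e" "P' e" ?Z "m e", OF 1 2 3 4 5 6]
        root_left_iff[of "P e" "P' e" ?Z "m e", OF 1 2 3 4 5 6] True
      by (simp only: ball_simps bex_simps simp_thms)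
  qed
  have ev: "(\<lambda>e. P e (s e)) \<in> F" "(\<lambda>e. P' e (s e)) \<in> F" "(\<lambda>e. 0) \<in> F" if "s \<in> F" for s
    using PF that by (auto intro: poly_family_eval[OF F] sign_ring_const[OF F])
  show ?thesis unfolding P_def[symmetric] eq
    using R(1,2) m a
    by (intro semialg.conj semialg.neg semialg_disj semialg_finite_All[OF R(1)] semialg_finite_Ex[OF R(1)]
        semialg_same_cell[OF F R(1,2)] sign_ring_less[OF F] sign_ring_eq[OF F]
        sign_ring_mult[OF F] ev) blast+
qed

text \<open>The choice is between equal candidates: a cell avoiding the critical points holds at
  most one root. The default 0 keeps the function total, and there the sign of \<open>h e 0\<close>
  is already decided in the ring.\<close>

definition cell_root where
  "cell_root a k R m e = (if a k e \<noteq> 0 \<and> (\<exists>x. poly_eval a (Suc k) e x = 0 \<and> same_cell R e x (m e))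
     then SOME x. poly_eval a (Suc k) e x = 0 \<and> same_cell R e x (m e) else 0)"

lemma cell_root_unique:
  assumes k: "k \<noteq> 0" and R: "covers_roots R (poly_eval (\<lambda>i e. real (Suc i) * a (Suc i) e) k)"
    and x: "a k e \<noteq> 0" "poly_eval a (Suc k) e x = 0" "same_cell R e x (m e)"
  shows "cell_root a k R m e = x"
proof -
  let ?c = "cell_root a k R m e"
  have "poly_eval a (Suc k) e ?c = 0 \<and> same_cell R e ?c (m e)"
    using someI[of "\<lambda>x. poly_eval a (Suc k) e x = 0 \<and> same_cell R e x (m e)" x] x
    unfolding cell_root_def by auto
  then show ?thesis
    using root_position(3)[of "poly_eval a (Suc k) e", OF poly_eval_derivative continuous_poly_eval
        covers_derivative_roots[where e=e, OF k x(1) R] x(2), of "m e" ?c] x(3)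
    by (simp add: same_cell_eq_cell)
qed

text \<open>One step of pseudo-division: multiplying by \<open>a k\<close> avoids a division, and
  the coefficients of \<open>x ^ n\<close> cancel, so \<open>n\<close> coefficients remain. At a
  root of the divisor the subtracted term vanishes, and the remainder equals \<open>a k e\<close>
  times the dividend.\<close>

lemma reduce_top_coefficient:
  assumes F: "sign_ring F" and a: "\<And>i. a i \<in> F" and b: "\<And>i. b i \<in> F" and kn: "k \<le> n"
  obtains c where "\<And>i. c i \<in> F"
    "\<And>e x. poly_eval c n e x = a k e * poly_eval b (Suc n) e x - b n e * x ^ (n - k) * poly_eval a (Suc k) e x"
proof -
  define c where "c i = (\<lambda>e. a k e * b i e - (if n - k \<le> i then b n e * a (i - (n - k)) e else 0))" for i
  show thesis
  proof
    show "c i \<in> F" for i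
      unfolding c_def using F a b
      by (cases "n - k \<le> i") (auto intro!: sign_ring_diff sign_ring_mult sign_ring_const)
    fix e x
    have "(\<Sum>i<Suc n. (if n - k \<le> i then b n e * a (i - (n - k)) e else 0) * x ^ i)
        = (\<Sum>i\<in>{n-k..<Suc n}. b n e * a (i - (n - k)) e * x ^ i)"
      by (intro sum.mono_neutral_cong_right) auto
    also have "\<dots> = (\<Sum>i<Suc k. b n e * a i e * x ^ (i + (n - k)))"
      by (rule sum.reindex_bij_witness[of _ "\<lambda>i. i + (n - k)" "\<lambda>i. i - (n - k)"]) (use kn in auto)
    also have "\<dots> = b n e * x ^ (n - k) * poly_eval a (Suc k) e x"
      unfolding poly_eval_def sum_distrib_left by (simp add: power_add mult_ac)
    finally have "a k e * poly_eval b (Suc n) e x - b n e * x ^ (n - k) * poly_eval a (Suc k) e x = poly_eval c (Suc n) e x"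
      by (simp only: poly_eval_def c_def sum_distrib_left left_diff_distrib sum_subtractf mult.assoc)
    moreover have "c n e = 0" using kn by (simp add: c_def)
    ultimately show "poly_eval c n e x = a k e * poly_eval b (Suc n) e x - b n e * x ^ (n - k) * poly_eval a (Suc k) e x"
      by (simp add: poly_eval_def)
  qed
qed

lemma cell_root_props:
  assumes "a k e \<noteq> 0 \<and> (\<exists>x. poly_eval a (Suc k) e x = 0 \<and> same_cell R e x (m e))"
  shows "poly_eval a (Suc k) e (cell_root a k R m e) = 0" "same_cell R e (cell_root a k R m e) (m e)"
  using someI_ex[of "\<lambda>x. poly_eval a (Suc k) e x = 0 \<and> same_cell R e x (m e)"] assms
  unfolding cell_root_def by auto

text \<open>Inside the cell of \<open>m e\<close>, monotonicity decides. If \<open>s\<close> is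
  outside it, some root function has \<open>m e\<close> and the root strictly on one side and
  \<open>s\<close> not on that side, so comparing \<open>s\<close> with the root is the same as
  comparing it with \<open>m e\<close>.\<close>

lemma cell_root_compare:
  assumes k: "k \<noteq> 0" and R: "covers_roots R (poly_eval (\<lambda>i e. real (Suc i) * a (Suc i) e) k)"
    and V: "a k e \<noteq> 0 \<and> (\<exists>x. poly_eval a (Suc k) e x = 0 \<and> same_cell R e x (m e))"
  defines "D \<equiv> poly_eval (\<lambda>i e. real (Suc i) * a (Suc i) e) k e (m e)"
  shows "s < cell_root a k R m e \<longleftrightarrow>
      same_cell R e s (m e) \<and> D * poly_eval a (Suc k) e s < 0 \<or> \<not> same_cell R e s (m e) \<and> s < m e" (is ?t1)
    and "cell_root a k R m e < s \<longleftrightarrow>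
      same_cell R e s (m e) \<and> 0 < D * poly_eval a (Suc k) e s \<or> \<not> same_cell R e s (m e) \<and> m e < s" (is ?t2)
proof -
  let ?x = "cell_root a k R m e"
  have x: "same_cell R e ?x (m e)" "poly_eval a (Suc k) e ?x = 0" using cell_root_props[of a k e R m, OF V] by auto
  have "?t1 \<and> ?t2"
  proof (cases "same_cell R e s (m e)")
    case True
    then show ?thesis
      using root_position(1,2)[of "poly_eval a (Suc k) e", OF poly_eval_derivative continuous_poly_eval
          covers_derivative_roots[where e=e, OF k conjunct1[OF V] R] x(2), of "m e" s] x(1)
      by (simp add: same_cell_eq_cell D_def)
  next
    case False
    then obtain r where r: "r \<in> R" "\<not> (r e < s \<and> r e < m e \<or> s < r e \<and> m e < r e)"
      unfolding same_cell_def by blast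
    moreover have "r e < ?x \<and> r e < m e \<or> ?x < r e \<and> m e < r e"
      using x(1) r(1) unfolding same_cell_def by blast
    ultimately show ?thesis using False by auto
  qed
  then show ?t1 ?t2 by auto
qed

text \<open>Division by the polynomial reduces to degree below \<open>k\<close>. The roots of the remainder are then available
  from the induction hypothesis, and the sign of the polynomial itself tells on which side of its root they lie.\<close>

lemma semialg_sign_at_cell_root:
  assumes G: "sign_ring G" and a: "\<And>i. a i \<in> G" and k: "k \<noteq> 0"
    and R: "finite R" "R \<subseteq> G" "covers_roots R (poly_eval (\<lambda>i e. real (Suc i) * a (Suc i) e) k)"
    and m: "m \<in> G"
    and IH: "\<And>n c. n \<le> k \<Longrightarrow> (\<And>i. c i \<in> G) \<Longrightarrow>
      \<exists>G' R'. sign_ring G' \<and> G \<subseteq> G' \<and> finite R' \<and> R' \<subseteq> G' \<and> covers_roots R' (poly_eval c n)"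
    and b: "\<And>i. b i \<in> G"
  shows "semialg (\<lambda>e. (a k e \<noteq> 0 \<and> (\<exists>x. poly_eval a (Suc k) e x = 0 \<and> same_cell R e x (m e))) \<and>
               0 < poly_eval b n e (cell_root a k R m e))"
proof -
  define V where "V e \<longleftrightarrow> a k e \<noteq> 0 \<and> (\<exists>x. poly_eval a (Suc k) e x = 0 \<and> same_cell R e x (m e))" for e
  define \<xi> where "\<xi> = cell_root a k R m"
  define P where "P = poly_eval a (Suc k)"
  define P' where "P' = poly_eval (\<lambda>i e. real (Suc i) * a (Suc i) e) k"
  \<comment> \<open>\<open>lt\<close> and \<open>gt\<close> are semialgebraic forms of
    \<open>\<rho> e < \<xi> e\<close> and \<open>\<xi> e < \<rho> e\<close>. They are required
    because only elements of the ring can be compared directly, and \<open>\<xi>\<close> is not yet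
    one.\<close>
  define lt where "lt \<rho> e \<longleftrightarrow> same_cell R e (\<rho> e) (m e) \<and> P' e (m e) * P e (\<rho> e) < 0 \<or>
      \<not> same_cell R e (\<rho> e) (m e) \<and> \<rho> e < m e" for \<rho> e
  define gt where "gt \<rho> e \<longleftrightarrow> same_cell R e (\<rho> e) (m e) \<and> 0 < P' e (m e) * P e (\<rho> e) \<or>
      \<not> same_cell R e (\<rho> e) (m e) \<and> m e < \<rho> e" for \<rho> e
  have PF: "P \<in> poly_family G" "P' \<in> poly_family G"
    unfolding P_def P'_def by (intro poly_familyI a sign_ring_mult sign_ring_const G)+
  have saV: "semialg V"
    unfolding V_def by (rule semialg_root_in_cell[OF G a k R m])
  have cmp: "\<rho> e < \<xi> e \<longleftrightarrow> lt \<rho> e" "\<xi> e < \<rho> e \<longleftrightarrow> gt \<rho> e" if "V e" for \<rho> e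
    using cell_root_compare[where e=e and a=a and k=k and m=m and R=R and s="\<rho> e", OF k R(3) that[unfolded V_def]]
    unfolding \<xi>_def lt_def gt_def P_def P'_def by auto
  have "semialg (\<lambda>e. V e \<and> 0 < poly_eval b n e (\<xi> e))" using b
  proof (induction n arbitrary: b rule: less_induct)
    case (less n b)
    show ?case
    proof (cases "n \<le> k")
      case True
      define h where "h = poly_eval b n"
      obtain G' R' where G': "sign_ring G'" "G \<subseteq> G'" and R': "finite R'" "R' \<subseteq> G'"
        and cov: "covers_roots R' h"
        using IH[of n b, OF True less.prems] unfolding h_def by blast
      have PF': "P \<in> poly_family G'" "P' \<in> poly_family G'" "h \<in> poly_family G'"
        using PF G'(2) poly_family_mono poly_familyI[of b G n, OF less.prems] unfolding h_def by blast+
      have RG': "R \<subseteq> G'" "m \<in> G'" using R m G' by auto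
      have zero: "(\<lambda>e. 0) \<in> G'" using sign_ring_const[OF G'(1)] .
      have ev: "(\<lambda>e. P e (s e)) \<in> G'" "(\<lambda>e. P' e (s e)) \<in> G'" "(\<lambda>e. h e (s e)) \<in> G'" if "s \<in> G'" for s
        using poly_family_eval[OF G'(1)] PF' that by blast+
      have salt: "semialg (lt \<rho>)" "semialg (gt \<rho>)" if "\<rho> \<in> G'" for \<rho>
        unfolding lt_def gt_def
        by (intro semialg.conj semialg.neg semialg_disj semialg_same_cell[OF G'(1) R(1) RG'(1)] sign_ring_less[OF G'(1)]
            sign_ring_mult[OF G'(1)] ev that RG' zero)+
      \<comment> \<open>The sign of \<open>h\<close> at \<open>\<xi> e\<close> is read off at an
        element of the enlarged ring: at a root function that equals \<open>\<xi> e\<close>, or else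
        at a sample in the cell of \<open>\<xi> e\<close>.\<close>
      have eq: "V e \<and> 0 < h e (\<xi> e) \<longleftrightarrow> V e \<and>
         ((\<exists>\<rho>\<in>R'. (\<not> lt \<rho> e \<and> \<not> gt \<rho> e) \<and> 0 < h e (\<rho> e)) \<or>
          (\<exists>s\<in>samples R'. 0 < h e (s e) \<and> (\<forall>\<rho>\<in>R'. \<rho> e < s e \<and> lt \<rho> e \<or> s e < \<rho> e \<and> gt \<rho> e)))" for e
      proof (cases "V e")
        case True
        have same: "(\<forall>\<rho>\<in>R'. \<rho> e < s \<and> lt \<rho> e \<or> s < \<rho> e \<and> gt \<rho> e) \<longleftrightarrow> same_cell R' e s (\<xi> e)" for s
          unfolding same_cell_def cmp[OF True, symmetric] by blast
        have sgn: "0 < h e (\<xi> e) \<longleftrightarrow> 0 < h e s" if "same_cell R' e s (\<xi> e)" for s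
        \<comment> \<open>Where \<open>h e\<close> is identically zero, \<open>covers_roots\<close>
          promises nothing, but then its sign is the same everywhere.\<close>
        proof (cases "\<exists>y. h e y \<noteq> 0")
          case True
          have "0 < h e s * h e (\<xi> e)"
          proof (rule no_zero_same_sign[of "h e" s "\<xi> e"])
            show "continuous_on UNIV (h e)" unfolding h_def by (rule continuous_poly_eval)
            fix z assume z: "min s (\<xi> e) \<le> z" "z \<le> max s (\<xi> e)"
            have "\<forall>\<rho>\<in>R'. z \<noteq> \<rho> e"
              using that z unfolding same_cell_def by (fastforce simp: min_def max_def split: if_splits)
            then show "h e z \<noteq> 0" using cov True unfolding covers_roots_def by blast
          qed
          then show ?thesis by (auto simp: zero_less_mult_iff)
        qed auto
        have eql: "\<not> lt \<rho> e \<and> \<not> gt \<rho> e \<longleftrightarrow> \<rho> e = \<xi> e" for \<rho>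
          unfolding cmp[OF True, symmetric] by auto
        have "0 < h e (\<xi> e) \<longleftrightarrow> (\<exists>\<rho>\<in>R'. \<rho> e = \<xi> e \<and> 0 < h e (\<rho> e)) \<or>
          (\<exists>s\<in>samples R'. 0 < h e (s e) \<and> same_cell R' e (s e) (\<xi> e))"
        proof (cases "\<exists>\<rho>\<in>R'. \<rho> e = \<xi> e")
          case T: True
          then show ?thesis using sgn by metis
        next
          case F: False
          then obtain s where "s \<in> samples R'" "same_cell R' e (s e) (\<xi> e)"
            using sample_in_cell[OF R'(1), of e "\<xi> e"] by blast
          then show ?thesis using sgn F by metis
        qed
        then show ?thesis unfolding same eql using True by blast
      qed simp
      have "samples R' \<subseteq> G'" using samples_subset[OF G'(1) R'(2)] .
      then show ?thesis
        unfolding h_def[symmetric] eq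
        using R' by (intro semialg.conj semialg.neg semialg_disj saV salt sign_ring_less[OF G'(1)] ev zero
            semialg_finite_Ex[OF finite_samples[OF R'(1)]] semialg_finite_Ex[OF R'(1)] semialg_finite_All[OF R'(1)]) blast+
    next
      case False
      then obtain n' where n': "n = Suc n'" "k \<le> n'" by (cases n) auto
      have "\<exists>c. (\<forall>i. c i \<in> G) \<and>
        (\<forall>e x. poly_eval c n' e x = a k e * poly_eval b (Suc n') e x - b n' e * x ^ (n' - k) * poly_eval a (Suc k) e x)"
        by (rule reduce_top_coefficient[of G a b k n', OF G a less.prems n'(2)]) blast
      then obtain c where c: "\<And>i. c i \<in> G"
        "\<And>e x. poly_eval c n' e x = a k e * poly_eval b (Suc n') e x - b n' e * x ^ (n' - k) * poly_eval a (Suc k) e x"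
        by blast
      have c': "(\<lambda>e. - c i e) \<in> G" for i
        using sign_ring_diff[OF G sign_ring_const[OF G, of 0] c(1)] by simp
      have r: "poly_eval c n' e (\<xi> e) = a k e * poly_eval b n e (\<xi> e)" if "V e" for e
        using cell_root_props(1)[of a k e R m, OF that[unfolded V_def]] unfolding c(2) n' \<xi>_def by simp
      have neg: "poly_eval (\<lambda>i e. - c i e) n' e x = - poly_eval c n' e x" for e x
        by (simp add: poly_eval_def sum_negf)
      \<comment> \<open>The remainder carries the factor \<open>a k e\<close>, which may have either
        sign; the negative case is served by the negated remainder, to which the induction applies
        as well.\<close>
      have eq: "V e \<and> 0 < poly_eval b n e (\<xi> e) \<longleftrightarrow>
         (0 < a k e \<and> (V e \<and> 0 < poly_eval c n' e (\<xi> e))) \<or>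
         (a k e < 0 \<and> (V e \<and> 0 < poly_eval (\<lambda>i e. - c i e) n' e (\<xi> e)))" for e
      proof (cases "V e")
        case True
        then have "a k e \<noteq> 0" by (simp add: V_def)
        then show ?thesis using True unfolding neg by (auto simp: r zero_less_mult_iff mult_less_0_iff)
      qed auto
      show ?thesis unfolding eq
        by (intro semialg_disj semialg.conj sign_ring_less[OF G] sign_ring_const[OF G] a
            less.IH[of n' c] less.IH[of n' "\<lambda>i e. - c i e"] c(1) c') (simp_all add: n')
    qed
  qed
  then show ?thesis by (simp add: V_def \<xi>_def)
qed

text \<open>The sign condition is assumed over every larger ring \<open>G\<close>, because each
  function is adjoined to a ring that the previous ones have already enlarged.\<close>

lemma sign_ring_adjoin_finite:
  assumes "finite X" "sign_ring F"
    and "\<And>\<xi> G h. \<lbrakk>\<xi> \<in> X; sign_ring G; F \<subseteq> G; h \<in> poly_family G\<rbrakk> \<Longrightarrow> semialg (\<lambda>e. 0 < h e (\<xi> e))"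
  shows "\<exists>F'. sign_ring F' \<and> F \<subseteq> F' \<and> X \<subseteq> F'"
  using assms(1,3)
proof (induction X rule: finite_induct)
  case empty
  then show ?case using assms(2) by blast
next
  case (insert \<xi> X)
  obtain F' where F': "sign_ring F'" "F \<subseteq> F'" "X \<subseteq> F'"
    using insert.IH insert.prems by blast
  obtain F'' where "sign_ring F''" "F' \<subseteq> F''" "\<xi> \<in> F''"
    using sign_ring_adjoin[OF F'(1), of \<xi>] insert.prems[of \<xi> F'] F' by blast
  then show ?case using F' by blast
qed

text \<open>Where the leading coefficient vanishes, the truncated polynomial supplies the roots.
  Elsewhere the root functions of the derivative cut the line into cells with at most one root each,
  and this root is adjoined once for every sample. A root outside all cells is a value of one of the
  derivative's root functions already. The induction ranges over all rings because it is applied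
  again in the enlarged ones.\<close>

theorem root_functions:
  assumes "sign_ring F" "\<And>i. a i \<in> F"
  shows "\<exists>F' R. sign_ring F' \<and> F \<subseteq> F' \<and> finite R \<and> R \<subseteq> F' \<and> covers_roots R (poly_eval a n)"
  using assms
proof (induction n arbitrary: F a rule: less_induct)
  case (less n F a)
  note F = less.prems(1) and a = less.prems(2)
  show ?case
  proof (cases "n \<le> 1")
    case True
    then have "covers_roots {} (poly_eval a n)"
      by (cases n) (auto simp: covers_roots_def poly_eval_def)
    then show ?thesis using F by blast
  next
    case False
    then obtain k where n: "n = Suc k" and k: "k \<noteq> 0" by (cases n) auto
    have kn: "k < n" using n by simp
    define b where "b i = (\<lambda>e. real (Suc i) * a (Suc i) e)" for i
    obtain F1 R1 where 1: "sign_ring F1" "F \<subseteq> F1" "finite R1" "R1 \<subseteq> F1" "covers_roots R1 (poly_eval a k)"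
      using less.IH[of k F a, OF kn F a] by blast
    have b: "b i \<in> F1" for i
      unfolding b_def using a 1(2) by (intro sign_ring_mult[OF 1(1)] sign_ring_const[OF 1(1)]) auto
    obtain F2 R2 where 2: "sign_ring F2" "F1 \<subseteq> F2" "finite R2" "R2 \<subseteq> F2" "covers_roots R2 (poly_eval b k)"
      using less.IH[of k F1 b, OF kn 1(1) b] by blast
    define X where "X = cell_root a k R2 ` samples R2"
    have S: "samples R2 \<subseteq> F2" by (rule samples_subset[OF 2(1,4)])
    have "\<exists>F3. sign_ring F3 \<and> F2 \<subseteq> F3 \<and> X \<subseteq> F3"
    proof (rule sign_ring_adjoin_finite[OF _ 2(1)])
      show "finite X" unfolding X_def using finite_samples[OF 2(3)] by simp
      fix \<xi> G h assume A: "\<xi> \<in> X" "sign_ring G" "F2 \<subseteq> G" "h \<in> poly_family G"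
      then obtain m where m: "m \<in> samples R2" "\<xi> = cell_root a k R2 m" by (auto simp: X_def)
      obtain c l where c: "h = poly_eval c l" "\<And>i. c i \<in> G" using A(4) by (auto simp: poly_family_def)
      define V where "V e \<longleftrightarrow> a k e \<noteq> 0 \<and> (\<exists>x. poly_eval a (Suc k) e x = 0 \<and> same_cell R2 e x (m e))" for e
      have aG: "a i \<in> G" for i using a A(3) 1(2) 2(2) by blast
      have RG: "R2 \<subseteq> G" "m \<in> G" using 2(4) S A(3) m by auto
      have *: "semialg (\<lambda>e. V e \<and> 0 < h e (\<xi> e))"
        unfolding V_def c(1) m(2)
        using less.IH[OF _ A(2)] n
        by (intro semialg_sign_at_cell_root[OF A(2) aG k 2(3) RG(1) 2(5)[unfolded b_def] RG(2) _ c(2)]) auto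
      have saV: "semialg V" unfolding V_def
        by (rule semialg_root_in_cell[OF A(2) aG k 2(3) RG(1) 2(5)[unfolded b_def] RG(2)])
      have "\<xi> e = 0" if "\<not> V e" for e
        using that unfolding m(2) cell_root_def V_def by auto
      then have eq: "0 < h e (\<xi> e) \<longleftrightarrow> (V e \<and> 0 < h e (\<xi> e)) \<or> (\<not> V e \<and> 0 < h e 0)" for e
        by (cases "V e") auto
      show "semialg (\<lambda>e. 0 < h e (\<xi> e))"
        by (subst eq) (intro semialg_disj semialg.conj * semialg.neg saV sign_ring_sa[OF A(2)]
            poly_family_eval[OF A(2,4)] sign_ring_const[OF A(2)])
    qed
    then obtain F3 where 3: "sign_ring F3" "F2 \<subseteq> F3" "X \<subseteq> F3" by blast
    have "covers_roots (R1 \<union> R2 \<union> X) (poly_eval a n)"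
      unfolding covers_roots_def
    proof (intro allI impI)
      fix e x assume x: "poly_eval a n e x = 0 \<and> (\<exists>y. poly_eval a n e y \<noteq> 0)"
      show "\<exists>\<rho>\<in>R1 \<union> R2 \<union> X. x = \<rho> e"
      proof (cases "a k e = 0")
        case True
        then have "poly_eval a n e = poly_eval a k e" unfolding n poly_eval_def by auto
        then show ?thesis using x 1(5) unfolding covers_roots_def by auto
      next
        case top: False
        show ?thesis
        proof (cases "\<exists>\<rho>\<in>R2. \<rho> e = x")
          case True
          then show ?thesis by blast
        next
          case False
          then obtain m where m: "m \<in> samples R2" "same_cell R2 e (m e) x"
            using sample_in_cell[OF 2(3), of e x] by blast
          then have "same_cell R2 e x (m e)" unfolding same_cell_def by blast
          then have "cell_root a k R2 m e = x"
            using x by (intro cell_root_unique[where e=e and a=a and k=k and m=m and R=R2, OF k 2(5)[unfolded b_def] top]) (auto simp: n)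
          then show ?thesis using m(1) unfolding X_def by blast
        qed
      qed
    qed
    moreover have "finite (R1 \<union> R2 \<union> X)"
      using 1(3) 2(3) finite_samples[OF 2(3)] by (simp add: X_def)
    moreover have "R1 \<union> R2 \<union> X \<subseteq> F3" "F \<subseteq> F3"
      using 1(2,4) 2(2,4) 3(2,3) by blast+
    ultimately show ?thesis using 3(1)
      by (intro exI[of _ F3] exI[of _ "R1 \<union> R2 \<union> X"] conjI)
  qed
qed

section \<open>Elimination of a quantifier, with bounds uniform in the parameters\<close>

lemma polynomial_map_univariate:
  assumes "polynomial_map p"
  shows "\<exists>h\<in>poly_family {p. polynomial_map p}. \<forall>e x. p (e(v := x)) = h e x"
  using assms
proof induction
  note ring = polynomial_maps_sign_ring
  case (const c)
  show ?case
    by (rule bexI[OF _ poly_family_const[OF ring sign_ring_const[OF ring]]]) auto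
next
  note ring = polynomial_maps_sign_ring
  case (var w)
  show ?case
  proof (cases "w = v")
    case True
    show ?thesis
      by (rule bexI[OF _ poly_family_shift[OF ring poly_family_const[OF ring sign_ring_const[OF ring, of 1]]]])
        (simp add: True)
  next
    case False
    have "(\<lambda>e. e w) \<in> {p. polynomial_map p}" by (simp add: polynomial_map.var)
    then show ?thesis
      by (intro bexI[OF _ poly_family_const[OF ring]]) (auto simp: False)
  qed
next
  case (add p q)
  then obtain h k where "h \<in> poly_family {p. polynomial_map p}" "k \<in> poly_family {p. polynomial_map p}"
    "\<forall>e x. p (e(v := x)) = h e x" "\<forall>e x. q (e(v := x)) = k e x" by blast
  then show ?case
    by (intro bexI[OF _ poly_family_add[OF polynomial_maps_sign_ring, of h k]]) (simp_all only: simp_thms)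
next
  case (mult p q)
  then obtain h k where "h \<in> poly_family {p. polynomial_map p}" "k \<in> poly_family {p. polynomial_map p}"
    "\<forall>e x. p (e(v := x)) = h e x" "\<forall>e x. q (e(v := x)) = k e x" by blast
  then show ?case
    by (intro bexI[OF _ poly_family_mult[OF polynomial_maps_sign_ring, of h k]]) (simp_all only: simp_thms)
qed

text \<open>On a cell of its root functions a polynomial keeps its sign, by the intermediate value
  theorem. For a conjunction the root functions of the second formula are found over the ring of the
  first, and the two sets are united.\<close>

lemma semialg_cells:
  assumes "semialg P" "sign_ring F" "{p. polynomial_map p} \<subseteq> F"
  shows "\<exists>F' R. sign_ring F' \<and> F \<subseteq> F' \<and> finite R \<and> R \<subseteq> F' \<and>
    (\<forall>e x y. same_cell R e x y \<longrightarrow> P (e(v := x)) = P (e(v := y)))"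
  using assms
proof (induction arbitrary: F)
  case (pos p F)
  obtain h where h: "h \<in> poly_family {p. polynomial_map p}" "\<forall>e x. p (e(v := x)) = h e x"
    using polynomial_map_univariate[OF pos(1)] by blast
  then obtain a n where a: "h = poly_eval a n" "\<And>i. a i \<in> F"
    using poly_family_mono[OF pos(3)] unfolding poly_family_def by blast
  obtain F' R where R: "sign_ring F'" "F \<subseteq> F'" "finite R" "R \<subseteq> F'" "covers_roots R h"
    using root_functions[of F a n, OF pos(2) a(2)] a(1) by blast
  have "0 < h e x \<longleftrightarrow> 0 < h e y" if xy: "same_cell R e x y" for e x y
  proof (cases "\<exists>z. h e z \<noteq> 0")
    case True
    have "0 < h e x * h e y"
    proof (rule no_zero_same_sign[of "h e" x y])
      show "continuous_on UNIV (h e)" unfolding a by (rule continuous_poly_eval)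
      fix z assume z: "min x y \<le> z" "z \<le> max x y"
      have "\<forall>\<rho>\<in>R. z \<noteq> \<rho> e"
        using xy z unfolding same_cell_def by (fastforce simp: min_def max_def split: if_splits)
      then show "h e z \<noteq> 0" using R(5) True unfolding covers_roots_def by blast
    qed
    then show ?thesis by (auto simp: zero_less_mult_iff)
  qed auto
  then have "\<forall>e x y. same_cell R e x y \<longrightarrow> (0 < p (e(v := x))) = (0 < p (e(v := y)))"
    unfolding h(2)[rule_format] by blast
  then show ?case using R(1-4) by blast
next
  case (neg P F)
  obtain F' R where *: "sign_ring F' \<and> F \<subseteq> F' \<and> finite R \<and> R \<subseteq> F' \<and>
    (\<forall>e x y. same_cell R e x y \<longrightarrow> P (e(v := x)) = P (e(v := y)))"
    using neg.IH[OF neg.prems] by (elim exE)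
  show ?case by (rule exI[of _ F'], rule exI[of _ R]) (use * in blast)
next
  case (conj P Q F)
  then obtain F' R where 1: "sign_ring F'" "F \<subseteq> F'" "finite R" "R \<subseteq> F'"
    "\<forall>e x y. same_cell R e x y \<longrightarrow> P (e(v := x)) = P (e(v := y))"
    using conj.IH(1)[OF conj.prems] by (elim exE conjE)
  then obtain F'' R' where 2: "sign_ring F''" "F' \<subseteq> F''" "finite R'" "R' \<subseteq> F''"
    "\<forall>e x y. same_cell R' e x y \<longrightarrow> Q (e(v := x)) = Q (e(v := y))"
    using conj.IH(2)[of F', OF 1(1) order_trans[OF conj.prems(2) 1(2)]] by (elim exE conjE)
  have "same_cell (R \<union> R') e x y \<Longrightarrow> same_cell R e x y \<and> same_cell R' e x y" for e x y
    by (auto simp: same_cell_def)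
  moreover have "F \<subseteq> F''" "finite (R \<union> R')" "R \<union> R' \<subseteq> F''" using 1(2-4) 2(2-4) by auto
  ultimately have *: "sign_ring F'' \<and> F \<subseteq> F'' \<and> finite (R \<union> R') \<and> R \<union> R' \<subseteq> F'' \<and>
    (\<forall>e x y. same_cell (R \<union> R') e x y \<longrightarrow>
      (P (e(v := x)) \<and> Q (e(v := x))) = (P (e(v := y)) \<and> Q (e(v := y))))"
    using 2(1) 1(5) 2(5) by blast
  show ?case by (rule exI[of _ F''], rule exI[of _ "R \<union> R'"], rule *)
qed

lemma semialg_subst:
  assumes "semialg P" "sign_ring F" "{p. polynomial_map p} \<subseteq> F" "s \<in> F"
  shows "semialg (\<lambda>e. P (e(v := s e)))"
  using assms(1)
proof induction
  case (pos p)
  obtain h where h: "h \<in> poly_family {p. polynomial_map p}" "\<forall>e x. p (e(v := x)) = h e x"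
    using polynomial_map_univariate[OF pos(1)] by blast
  have "h \<in> poly_family F" using h(1) poly_family_mono[OF assms(3)] by blast
  then show ?case
    using sign_ring_sa[OF assms(2) poly_family_eval[OF assms(2) _ assms(4)], of h]
    by (simp only: h(2))
qed (auto intro: semialg.neg semialg.conj)

text \<open>The truth value of \<open>P\<close> is constant on cells, so a witness can be moved to a
  root function or to a sample, and the quantifier becomes a finite disjunction of
  substitutions.\<close>

theorem semialg_Ex:
  assumes "semialg P" shows "semialg (\<lambda>e. \<exists>x. P (e(v := x)))"
proof -
  obtain F R where F: "sign_ring F" "{p. polynomial_map p} \<subseteq> F" "finite R" "R \<subseteq> F"
    and R: "\<And>e x y. same_cell R e x y \<Longrightarrow> P (e(v := x)) = P (e(v := y))"
    using semialg_cells[OF assms polynomial_maps_sign_ring order_refl] by metis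
  have S: "samples R \<subseteq> F" by (rule samples_subset[OF F(1,4)])
  have eq: "(\<exists>x. P (e(v := x))) \<longleftrightarrow> (\<exists>s\<in>R \<union> samples R. P (e(v := s e)))" for e
  proof
    assume "\<exists>x. P (e(v := x))"
    then obtain x where x: "P (e(v := x))" by blast
    show "\<exists>s\<in>R \<union> samples R. P (e(v := s e))"
    proof (cases "\<exists>\<rho>\<in>R. \<rho> e = x")
      case False
      then show ?thesis using sample_in_cell[OF F(3), of e x] R x by blast
    qed (use x in blast)
  qed blast
  show ?thesis unfolding eq
    using F(3,4) S by (intro semialg_finite_Ex semialg_subst[OF assms F(1,2)]) (auto simp: finite_samples)
qed

text \<open>Changes of membership are counted rather than intervals, and whether the points of
  \<open>Z\<close> themselves belong to \<open>S\<close> is left open; hence no distinction between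
  open and closed intervals arises.\<close>

definition few_changes :: "nat \<Rightarrow> real set \<Rightarrow> bool" where
  "few_changes M S \<longleftrightarrow> (\<exists>Z. finite Z \<and> card Z \<le> M \<and>
     (\<forall>p q. p \<le> q \<and> {p..q} \<inter> Z = {} \<longrightarrow> (p \<in> S \<longleftrightarrow> q \<in> S)))"

lemma few_changesE:
  assumes "few_changes M S"
  obtains Z where "finite Z" "card Z \<le> M" "\<And>p q. p \<le> q \<Longrightarrow> {p..q} \<inter> Z = {} \<Longrightarrow> p \<in> S \<longleftrightarrow> q \<in> S"
  using assms unfolding few_changes_def by (elim exE conjE) simp

text \<open>The set of root functions is fixed before the parameters are chosen, and only the values
  move with \<open>e\<close>. All uniform bounds on crossings and critical intervals come from
  here.\<close>

theorem semialg_few_changes: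
  assumes "semialg P" shows "\<exists>M. \<forall>e. few_changes M {x. P (e(v := x))}"
proof -
  obtain F R where F: "finite R"
    and R: "\<And>e x y. same_cell R e x y \<Longrightarrow> P (e(v := x)) = P (e(v := y))"
    using semialg_cells[OF assms polynomial_maps_sign_ring order_refl] by metis
  have "few_changes (card R) {x. P (e(v := x))}" for e
    unfolding few_changes_def
  proof (intro exI[of _ "(\<lambda>\<rho>. \<rho> e) ` R"] conjI allI impI)
    fix p q :: real assume pq: "p \<le> q \<and> {p..q} \<inter> (\<lambda>\<rho>. \<rho> e) ` R = {}"
    have "same_cell R e p q"
      unfolding same_cell_def
    proof
      fix \<rho> assume "\<rho> \<in> R"
      then have "\<not> (p \<le> \<rho> e \<and> \<rho> e \<le> q)" using pq by auto
      then show "\<rho> e < p \<and> \<rho> e < q \<or> p < \<rho> e \<and> q < \<rho> e" using pq by linarith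
    qed
    then show "p \<in> {x. P (e(v := x))} \<longleftrightarrow> q \<in> {x. P (e(v := x))}" using R by simp
  qed (use F in \<open>auto intro: card_image_le\<close>)
  then show ?thesis by blast
qed

text \<open>Coordinate \<open>b \<in> Basis\<close> of vector variable \<open>j\<close> is stored at \<open>(j, b)\<close> and scalar variable \<open>j\<close> at
  \<open>(j, 0)\<close>; they do not clash since \<open>0 \<notin> Basis\<close>.\<close>

type_synonym 'a env = "nat \<times> 'a \<Rightarrow> real"

definition env_vec :: "'a::euclidean_space env \<Rightarrow> nat \<Rightarrow> 'a" where
  "env_vec e j = (\<Sum>b\<in>Basis. e (j, b) *\<^sub>R b)"

definition env_scal :: "'a::euclidean_space env \<Rightarrow> nat \<Rightarrow> real" where
  "env_scal e j = e (j, 0)"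

definition env_set_vec :: "'a::euclidean_space env \<Rightarrow> nat \<Rightarrow> 'a \<Rightarrow> 'a env" where
  "env_set_vec e j y = (\<lambda>(i, b). if i = j \<and> b \<in> Basis then y \<bullet> b else e (i, b))"

definition env_set_scal :: "'a::euclidean_space env \<Rightarrow> nat \<Rightarrow> real \<Rightarrow> 'a::euclidean_space env" where
  "env_set_scal e j c = e((j, 0) := c)"

lemma env_simps [simp]:
  "env_vec (env_set_vec e j y) i = (if i = j then y else env_vec e i)"
  "env_vec (env_set_scal e j c) i = env_vec e i"
  "env_scal (env_set_vec e j y) i = env_scal e i"
  "env_scal (env_set_scal e j c) i = (if i = j then c else env_scal e i)"
  by (auto simp: env_vec_def env_scal_def env_set_vec_def env_set_scal_def euclidean_representation intro!: sum.cong)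

lemma semialg_few_changes_scal: "semialg P \<Longrightarrow> \<exists>M. \<forall>e. few_changes M {c. P (env_set_scal e j c)}"
  unfolding env_set_scal_def by (rule semialg_few_changes)

text \<open>A vector quantifier is a block of scalar quantifiers, one for each basis coordinate.
  \<open>upd B\<close> overwrites only the coordinates in \<open>B\<close>, which allows the block
  to be eliminated by induction on \<open>B\<close>.\<close>

lemma semialg_Ex_vec:
  fixes P :: "'a::euclidean_space env \<Rightarrow> bool"
  assumes P: "semialg P" shows "semialg (\<lambda>e. \<exists>y. P (env_set_vec e j y))"
proof -
  define upd where "upd B e y = (\<lambda>(i, b). if i = j \<and> b \<in> B then y \<bullet> b else e (i, b) :: real)"
    for B :: "'a set" and e y
  have "semialg (\<lambda>e. \<exists>y. P (upd B e y))" if "finite B" "B \<subseteq> Basis" for B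
    using that
  proof (induction B rule: finite_induct)
    case empty
    then show ?case using P by (simp add: upd_def)
  next
    case (insert b B)
    have "(\<exists>x y. P (upd B (e((j, b) := x)) y)) \<longleftrightarrow> (\<exists>y. P (upd (insert b B) e y))" for e
    proof safe
      fix x y assume A: "P (upd B (e((j, b) := x)) y)"
      let ?y = "y + (x - y \<bullet> b) *\<^sub>R b"
      have b: "b \<in> Basis" "\<And>c. c \<in> B \<Longrightarrow> c \<in> Basis \<and> c \<noteq> b" using insert by auto
      have "?y \<bullet> b = x" using b(1) by (simp add: inner_add_left)
      moreover have "?y \<bullet> c = y \<bullet> c" if "c \<in> B" for c
        using b(2)[OF that] b(1) by (auto simp: inner_add_left inner_Basis)
      ultimately have "upd B (e((j, b) := x)) y = upd (insert b B) e ?y"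
        using b(2) by (auto simp: upd_def fun_eq_iff)
      then show "\<exists>y. P (upd (insert b B) e y)" using A by metis
    next
      fix y assume A: "P (upd (insert b B) e y)"
      have "upd (insert b B) e y = upd B (e((j, b) := y \<bullet> b)) y"
        by (auto simp: upd_def fun_eq_iff)
      then show "\<exists>x y. P (upd B (e((j, b) := x)) y)" using A by metis
    qed
    then show ?case
      using semialg_Ex[of "\<lambda>e. \<exists>y. P (upd B e y)" "(j, b)"] insert by simp
  qed
  then have "semialg (\<lambda>e. \<exists>y. P (upd Basis e y))" by simp
  then show ?thesis by (simp add: upd_def env_set_vec_def)
qed

lemma semialg_All_vec:
  assumes "semialg P" shows "semialg (\<lambda>e. \<forall>y. P (env_set_vec e j y))"
  using semialg.neg[OF semialg_Ex_vec[OF semialg.neg[OF assms], of j]] by simp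

section \<open>Polynomial terms and atomic formulas in vector variables\<close>

definition vector_polynomial_map :: "('a::euclidean_space env \<Rightarrow> 'a) \<Rightarrow> bool" where
  "vector_polynomial_map f \<longleftrightarrow> (\<forall>b\<in>Basis. polynomial_map (\<lambda>e. f e \<bullet> b))"

lemma polynomial_map_diff:
  assumes "polynomial_map p" "polynomial_map q" shows "polynomial_map (\<lambda>e. p e - q e)"
  using polynomial_map.add[OF assms(1) polynomial_map.mult[OF polynomial_map.const[of "-1"] assms(2)]] by simp

lemma polynomial_map_sum:
  "(\<And>i. i \<in> I \<Longrightarrow> polynomial_map (p i)) \<Longrightarrow> polynomial_map (\<lambda>e. \<Sum>i\<in>I. p i e)"
  by (induction I rule: infinite_finite_induct) (auto intro: polynomial_map.intros)

lemma polynomial_map_scal: "polynomial_map (\<lambda>e. env_scal e j)"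
  unfolding env_scal_def by (rule polynomial_map.var)

lemma vector_polynomial_map_vec: "vector_polynomial_map (\<lambda>e. env_vec e j)"
  unfolding vector_polynomial_map_def env_vec_def by (simp add: polynomial_map.var)

lemma vector_polynomial_map_const: "vector_polynomial_map (\<lambda>e. c)"
  unfolding vector_polynomial_map_def by (simp add: polynomial_map.const)

lemma vector_polynomial_map_diff:
  "\<lbrakk>vector_polynomial_map f; vector_polynomial_map g\<rbrakk> \<Longrightarrow> vector_polynomial_map (\<lambda>e. f e - g e)"
  unfolding vector_polynomial_map_def by (simp add: inner_diff_left polynomial_map_diff)

lemma polynomial_map_inner:
  "\<lbrakk>vector_polynomial_map f; vector_polynomial_map g\<rbrakk> \<Longrightarrow> polynomial_map (\<lambda>e. f e \<bullet> g e)"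
  unfolding vector_polynomial_map_def
  by (subst euclidean_inner) (intro polynomial_map_sum polynomial_map.mult; blast)

lemma polynomial_map_power2: "polynomial_map p \<Longrightarrow> polynomial_map (\<lambda>e. (p e)\<^sup>2)"
  unfolding power2_eq_square by (rule polynomial_map.mult)

lemma polynomial_map_norm2: "vector_polynomial_map f \<Longrightarrow> polynomial_map (\<lambda>e. (norm (f e))\<^sup>2)"
  unfolding power2_norm_eq_inner by (rule polynomial_map_inner)

lemma real_polynomial_function_polynomial_map:
  assumes "real_polynomial_function p" "vector_polynomial_map f"
  shows "polynomial_map (\<lambda>e. p (f e))"
  using assms(1)
proof induction
  case (linear p)
  then have p: "p x = (\<Sum>b\<in>Basis. (x \<bullet> b) * p b)" for x
  proof -
    have "p x = p (\<Sum>b\<in>Basis. (x \<bullet> b) *\<^sub>R b)" by (simp only: euclidean_representation)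
    then show ?thesis
      using linear by (simp add: linear_sum[OF bounded_linear.linear] linear_scale[OF bounded_linear.linear])
  qed
  show ?case
    by (subst p) (intro polynomial_map_sum polynomial_map.mult polynomial_map.const;
        use assms(2) in \<open>simp add: vector_polynomial_map_def\<close>)
qed (auto intro: polynomial_map.intros)

lemma semialg_less: "\<lbrakk>polynomial_map p; polynomial_map q\<rbrakk> \<Longrightarrow> semialg (\<lambda>e. p e < q e)"
  using sign_ring_less[OF polynomial_maps_sign_ring, of p q] by simp

lemma semialg_le: "\<lbrakk>polynomial_map p; polynomial_map q\<rbrakk> \<Longrightarrow> semialg (\<lambda>e. p e \<le> q e)"
  unfolding not_less[symmetric] by (intro semialg.neg semialg_less)

lemma semialg_eq: "\<lbrakk>polynomial_map p; polynomial_map q\<rbrakk> \<Longrightarrow> semialg (\<lambda>e. p e = q e)"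
  using sign_ring_eq[OF polynomial_maps_sign_ring, of p q] by simp

lemma semialg_semialgebraic_set:
  assumes "semialgebraic_set S" "vector_polynomial_map f" shows "semialg (\<lambda>e. f e \<in> S)"
proof -
  have "semialg (\<lambda>e. f e \<in> A)" if "basic_semialgebraic A" for A
  proof -
    from that obtain P Q where PQ: "finite P" "finite Q" "\<And>p. p \<in> P \<union> Q \<Longrightarrow> real_polynomial_function p"
      "A = {x. (\<forall>p\<in>P. p x = 0) \<and> (\<forall>q\<in>Q. q x > 0)}"
      unfolding basic_semialgebraic_def by blast
    have "semialg (\<lambda>e. (\<forall>p\<in>P. p (f e) = 0) \<and> (\<forall>q\<in>Q. 0 < q (f e)))"
      using PQ by (intro semialg.conj semialg_finite_All semialg_eq semialg.pos polynomial_map.const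
          real_polynomial_function_polynomial_map assms) auto
    then show ?thesis by (simp add: PQ(4))
  qed
  moreover obtain F where "finite F" "\<forall>A\<in>F. basic_semialgebraic A" "S = \<Union>F"
    using assms(1) unfolding semialgebraic_set_def by blast
  ultimately show ?thesis by (auto intro!: semialg_finite_Ex)
qed

section \<open>A quantitative Sard theorem\<close>

text \<open>These are approximate critical points on \<open>E\<close> of the linear function with
  gradient \<open>u0\<close>. The norm bounds are squared to make the condition polynomial in all
  parameters.\<close>

definition near_critical :: "'a::euclidean_space set \<Rightarrow> 'a \<Rightarrow> real \<Rightarrow> 'a \<Rightarrow> real \<Rightarrow> real \<Rightarrow> 'a set" where
  "near_critical E x0 r u0 \<epsilon> \<kappa> = {y \<in> E. (norm (y - x0))\<^sup>2 \<le> r\<^sup>2 \<and>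
     (\<exists>u. (norm (u - u0))\<^sup>2 \<le> \<epsilon>\<^sup>2 \<and> (\<forall>z. z \<in> E \<longrightarrow> u \<bullet> (z - y) \<le> \<kappa> * (norm (z - y))\<^sup>2))}"

text \<open>The normal \<open>u\<close> ranges over a closed ball, so the set is the projection of a
  compact set of pairs \<open>(y, u)\<close>.\<close>

lemma compact_near_critical:
  assumes "closed E" shows "compact (near_critical E x0 r u0 \<epsilon> \<kappa>)"
proof (cases "near_critical E x0 r u0 \<epsilon> \<kappa> = {}")
  case False
  have nn: "(norm v)\<^sup>2 \<le> s\<^sup>2 \<longleftrightarrow> norm v \<le> \<bar>s\<bar>" for v :: 'a and s
    by (metis abs_le_square_iff abs_norm_cancel)
  let ?K = "(cball x0 \<bar>r\<bar> \<inter> E) \<times> cball u0 \<bar>\<epsilon>\<bar>"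
  let ?S = "?K \<inter> (\<Inter>z\<in>E. {p. snd p \<bullet> (z - fst p) \<le> \<kappa> * (norm (z - fst p))\<^sup>2})"
  have "compact ?K"
    by (intro compact_Times compact_Int_closed compact_cball assms)
  moreover have "closed (\<Inter>z\<in>E. {p. snd p \<bullet> (z - fst p) \<le> \<kappa> * (norm (z - fst p))\<^sup>2})"
    by (intro closed_INT ballI closed_Collect_le continuous_intros)
  ultimately have "compact ?S" by (rule compact_Int_closed)
  then have "compact (fst ` ?S)"
    by (intro compact_continuous_image continuous_intros)
  also have "fst ` ?S = near_critical E x0 r u0 \<epsilon> \<kappa>"
  proof -
    have "y \<in> fst ` ?S \<longleftrightarrow> y \<in> near_critical E x0 r u0 \<epsilon> \<kappa>" for y
      unfolding near_critical_def nn
      by (force simp: dist_norm norm_minus_commute image_iff Bex_def)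
    then show ?thesis by blast
  qed
  finally show ?thesis .
qed simp

text \<open>The lexicographic order serves to select one point of each compact slice by a formula:
  the oscillation of a selection can be bounded only if the selection is semialgebraic.\<close>

fun lex_le :: "'a::real_inner list \<Rightarrow> 'a \<Rightarrow> 'a \<Rightarrow> bool" where
  "lex_le [] y y' \<longleftrightarrow> True"
| "lex_le (b # bs) y y' \<longleftrightarrow> y \<bullet> b < y' \<bullet> b \<or> y \<bullet> b = y' \<bullet> b \<and> lex_le bs y y'"

lemma lex_le_antisym:
  "lex_le bs y y' \<Longrightarrow> lex_le bs y' y \<Longrightarrow> b \<in> set bs \<Longrightarrow> y \<bullet> b = y' \<bullet> b"
  by (induction bs) auto

lemma lex_least_exists:
  fixes A :: "'a::euclidean_space set"
  assumes "compact A" "A \<noteq> {}" shows "\<exists>y\<in>A. \<forall>y'\<in>A. lex_le bs y y'"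
  using assms
proof (induction bs arbitrary: A)
  case (Cons b bs A)
  obtain m where m: "m \<in> A" "\<And>y. y \<in> A \<Longrightarrow> m \<bullet> b \<le> y \<bullet> b"
    using continuous_attains_inf[OF Cons.prems, of "\<lambda>y. y \<bullet> b"] continuous_on_inner[OF continuous_on_id continuous_on_const]
    by blast
  let ?B = "A \<inter> {y. y \<bullet> b = m \<bullet> b}"
  have "compact ?B"
    by (intro compact_Int_closed Cons.prems closed_Collect_eq continuous_intros)
  moreover have "?B \<noteq> {}" using m by blast
  ultimately obtain y where y: "y \<in> ?B" "\<forall>y'\<in>?B. lex_le bs y y'" using Cons.IH by blast
  have "lex_le (b # bs) y y'" if "y' \<in> A" for y'
    using m(2)[OF that] y that by (cases "y' \<bullet> b = m \<bullet> b") auto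
  then show ?case using y by blast
qed auto

definition lex_least :: "'a::real_inner list \<Rightarrow> 'a set \<Rightarrow> 'a \<Rightarrow> bool" where
  "lex_least bs A y \<longleftrightarrow> y \<in> A \<and> (\<forall>y'. y' \<in> A \<longrightarrow> lex_le bs y y')"

lemma lex_least_unique:
  fixes y :: "'a::euclidean_space"
  assumes "set bs = Basis" "lex_least bs A y" "lex_least bs A y'" shows "y = y'"
proof (rule euclidean_eqI)
  fix b :: 'a assume "b \<in> Basis"
  moreover have "lex_le bs y y'" "lex_le bs y' y" using assms(2,3) unfolding lex_least_def by blast+
  ultimately show "y \<bullet> b = y' \<bullet> b" using lex_le_antisym assms(1) by blast
qed

lemma semialg_lex_le:
  assumes "vector_polynomial_map f" "vector_polynomial_map g"
  shows "semialg (\<lambda>e. lex_le bs (f e) (g e))"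
proof (induction bs)
  case Nil
  then show ?case by (simp add: semialg_const)
next
  case (Cons b bs)
  then show ?case unfolding lex_le.simps
    by (intro semialg_disj semialg.conj semialg_less semialg_eq polynomial_map_inner vector_polynomial_map_const assms)
qed

text \<open>In the environments below, vector variables 0, 1 hold \<open>u0\<close>, \<open>x0\<close> and scalar variables
  0, 1, 2, 3 hold the level \<open>c\<close> and \<open>\<kappa>\<close>, \<open>\<epsilon>\<close>, \<open>r\<close>.\<close>

lemma semialg_near_critical:
  fixes E :: "'a::euclidean_space set"
  assumes E: "semialgebraic_set E" and j: "j \<noteq> 3" "j \<noteq> 4"
  shows "semialg (\<lambda>e. env_vec e j \<in> near_critical E (env_vec e 1) (env_scal e 3) (env_vec e 0) (env_scal e 2) (env_scal e 1))"
proof -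
  define Q :: "'a env \<Rightarrow> bool" where
    "Q e \<longleftrightarrow> (env_vec e 4 \<in> E \<longrightarrow> env_vec e 3 \<bullet> (env_vec e 4 - env_vec e j) \<le> env_scal e 1 * (norm (env_vec e 4 - env_vec e j))\<^sup>2)" for e
  define Q' :: "'a env \<Rightarrow> bool" where
    "Q' e \<longleftrightarrow> (norm (env_vec e 3 - env_vec e 0))\<^sup>2 \<le> (env_scal e 2)\<^sup>2 \<and> (\<forall>z. Q (env_set_vec e 4 z))" for e
  note intros = semialg_semialgebraic_set[OF E] semialg_le polynomial_map_inner polynomial_map.mult
    polynomial_map_norm2 polynomial_map_power2 polynomial_map_scal vector_polynomial_map_diff
    vector_polynomial_map_vec
  have "semialg Q" unfolding Q_def by (intro semialg_imp intros)
  then have "semialg Q'" unfolding Q'_def by (intro semialg.conj intros semialg_All_vec)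
  then have "semialg (\<lambda>e. env_vec e j \<in> E \<and> (norm (env_vec e j - env_vec e 1))\<^sup>2 \<le> (env_scal e 3)\<^sup>2 \<and> (\<exists>u. Q' (env_set_vec e 3 u)))"
    by (intro semialg.conj intros semialg_Ex_vec)
  then show ?thesis
    using j by (simp add: Q'_def Q_def near_critical_def)
qed

definition critical_slice :: "'a::euclidean_space set \<Rightarrow> 'a \<Rightarrow> real \<Rightarrow> 'a \<Rightarrow> real \<Rightarrow> real \<Rightarrow> real \<Rightarrow> 'a set" where
  "critical_slice E x0 r u0 \<epsilon> \<kappa> c = {y \<in> near_critical E x0 r u0 \<epsilon> \<kappa>. u0 \<bullet> y = c}"

lemma semialg_critical_slice:
  fixes E :: "'a::euclidean_space set"
  assumes E: "semialgebraic_set E" and j: "j \<noteq> 3" "j \<noteq> 4"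
  shows "semialg (\<lambda>e. env_vec e j \<in> critical_slice E (env_vec e 1) (env_scal e 3) (env_vec e 0) (env_scal e 2) (env_scal e 1) (env_scal e 0))"
  unfolding critical_slice_def mem_Collect_eq
  by (intro semialg.conj semialg_near_critical assms semialg_eq polynomial_map_inner vector_polynomial_map_vec polynomial_map_scal)

definition param_env :: "'a::euclidean_space set \<Rightarrow> 'a \<Rightarrow> real \<Rightarrow> 'a \<Rightarrow> real \<Rightarrow> real \<Rightarrow> 'a env" where
  "param_env E x0 r u0 \<epsilon> \<kappa> = env_set_vec (env_set_vec (env_set_scal (env_set_scal (env_set_scal (\<lambda>_. 0) 3 r) 2 \<epsilon>) 1 \<kappa>) 0 u0) 1 x0"

lemma critical_values_few_changes:
  fixes E :: "'a::euclidean_space set"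
  assumes E: "semialgebraic_set E"
  shows "\<exists>M. \<forall>x0 r u0 \<epsilon> \<kappa>. few_changes M {c. critical_slice E x0 r u0 \<epsilon> \<kappa> c \<noteq> {}}"
proof -
  define Q :: "'a env \<Rightarrow> bool" where
    "Q e \<longleftrightarrow> env_vec e 2 \<in> critical_slice E (env_vec e 1) (env_scal e 3) (env_vec e 0) (env_scal e 2) (env_scal e 1) (env_scal e 0)" for e
  have "semialg Q" unfolding Q_def by (rule semialg_critical_slice[OF E]) auto
  then have "semialg (\<lambda>e. \<exists>y. Q (env_set_vec e 2 y))" by (rule semialg_Ex_vec)
  then obtain M where M: "\<And>e. few_changes M {c. \<exists>y. Q (env_set_vec (env_set_scal e 0 c) 2 y)}"
    using semialg_few_changes_scal[of "\<lambda>e. \<exists>y. Q (env_set_vec e 2 y)" 0] by blast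
  have "few_changes M {c. critical_slice E x0 r u0 \<epsilon> \<kappa> c \<noteq> {}}" for x0 r u0 \<epsilon> \<kappa>
    using M[of "param_env E x0 r u0 \<epsilon> \<kappa>"] by (simp add: Q_def param_env_def ex_in_conv)
  then show ?thesis by blast
qed

text \<open>The threshold \<open>\<eta>\<close> and the direction \<open>b\<close> are stored in the
  environment as well, in scalar slot 4 and vector slot 6, so \<open>M\<close> does not depend on
  them. Integrating the number of crossings over \<open>\<eta>\<close> rests on this.\<close>

lemma critical_selection_few_changes:
  fixes E :: "'a::euclidean_space set"
  assumes E: "semialgebraic_set E"
  shows "\<exists>M. \<forall>x0 r u0 \<epsilon> \<kappa> b \<eta>. few_changes M
    {c. \<exists>y. lex_least bs (critical_slice E x0 r u0 \<epsilon> \<kappa> c) y \<and> y \<bullet> b < \<eta>}"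
proof -
  let ?S = "\<lambda>e. critical_slice E (env_vec e 1) (env_scal e 3) (env_vec e 0) (env_scal e 2) (env_scal e 1) (env_scal e 0)"
  define Q :: "'a env \<Rightarrow> bool" where
    "Q e \<longleftrightarrow> (env_vec e 5 \<in> ?S e \<longrightarrow> lex_le bs (env_vec e 2) (env_vec e 5))" for e
  define Q' :: "'a env \<Rightarrow> bool" where
    "Q' e \<longleftrightarrow> (env_vec e 2 \<in> ?S e \<and> (\<forall>y'. Q (env_set_vec e 5 y'))) \<and> env_vec e 2 \<bullet> env_vec e 6 < env_scal e 4" for e
  have "semialg Q" unfolding Q_def
    by (intro semialg_imp semialg_critical_slice[OF E] semialg_lex_le vector_polynomial_map_vec) auto
  then have "semialg Q'" unfolding Q'_def
    by (intro semialg.conj semialg_critical_slice[OF E] semialg_All_vec semialg_less polynomial_map_inner vector_polynomial_map_vec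
        polynomial_map_scal) auto
  then have "semialg (\<lambda>e. \<exists>y. Q' (env_set_vec e 2 y))" by (rule semialg_Ex_vec)
  then obtain M where M: "\<And>e. few_changes M {c. \<exists>y. Q' (env_set_vec (env_set_scal e 0 c) 2 y)}"
    using semialg_few_changes_scal[of "\<lambda>e. \<exists>y. Q' (env_set_vec e 2 y)" 0] by blast
  have "few_changes M {c. \<exists>y. lex_least bs (critical_slice E x0 r u0 \<epsilon> \<kappa> c) y \<and> y \<bullet> b < \<eta>}" for x0 r u0 \<epsilon> \<kappa> b \<eta>
    using M[of "env_set_vec (env_set_scal (param_env E x0 r u0 \<epsilon> \<kappa>) 4 \<eta>) 6 b"]
    by (simp add: Q'_def Q_def param_env_def lex_least_def)
  then show ?thesis by blast
qed

text \<open>Consecutive closed intervals share an endpoint, hence the bound 2 and not 1.\<close>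

lemma card_intervals_containing_le_2:
  fixes c :: "nat \<Rightarrow> real"
  assumes c: "\<And>i j. i < j \<Longrightarrow> c i < c j"
  shows "card {i. i < k \<and> c i \<le> z \<and> z \<le> c (Suc i)} \<le> 2"
proof (cases "{i. i < k \<and> c i \<le> z \<and> z \<le> c (Suc i)} = {}")
  case False
  let ?I = "{i. i < k \<and> c i \<le> z \<and> z \<le> c (Suc i)}"
  have fin: "finite ?I" by simp
  have m: "Min ?I \<in> ?I" using Min_in[OF fin False] .
  have "?I \<subseteq> {Min ?I, Suc (Min ?I)}"
  proof
    fix i assume i: "i \<in> ?I"
    then have "Min ?I \<le> i" using fin by simp
    moreover have "\<not> Suc (Min ?I) < i" using c[of "Suc (Min ?I)" i] i m by force
    ultimately show "i \<in> {Min ?I, Suc (Min ?I)}" by auto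
  qed
  then have "card ?I \<le> card {Min ?I, Suc (Min ?I)}" by (intro card_mono) auto
  then show ?thesis by simp
qed (simp only: card.empty)

text \<open>The Banach indicatrix: the variation is the integral over the levels of the number of crossings.\<close>

lemma variation_le_crossings:
  fixes c G :: "nat \<Rightarrow> real"
  assumes c: "\<And>i j. i < j \<Longrightarrow> c i < c j" and G: "\<And>i. i \<le> k \<Longrightarrow> lo \<le> G i \<and> G i \<le> hi"
    and cross: "\<And>\<eta>. \<exists>Z. finite Z \<and> card Z \<le> M \<and>
       (\<forall>i<k. {c i..c (Suc i)} \<inter> Z = {} \<longrightarrow> (G i < \<eta> \<longleftrightarrow> G (Suc i) < \<eta>))"
  shows "(\<Sum>i<k. \<bar>G (Suc i) - G i\<bar>) \<le> 2 * real M * (hi - lo)"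
proof -
  \<comment> \<open>Half-open, so that \<open>\<eta> \<in> J i\<close> holds exactly when one of
    \<open>G i < \<eta>\<close> and \<open>G (Suc i) < \<eta>\<close> is true and the other
    false.\<close>
  define J where "J i = {min (G i) (G (Suc i))<..max (G i) (G (Suc i))}" for i
  have count: "(\<Sum>i<k. indicator (J i) \<eta>) \<le> (2 * real M) * indicator {lo..hi} \<eta>" for \<eta> :: real
  proof (cases "\<eta> \<in> {lo..hi}")
    case True
    obtain Z where Z: "finite Z" "card Z \<le> M"
      "\<And>i. i < k \<Longrightarrow> {c i..c (Suc i)} \<inter> Z = {} \<Longrightarrow> (G i < \<eta> \<longleftrightarrow> G (Suc i) < \<eta>)"
      using cross[of \<eta>] by blast
    have sub: "{i. i < k \<and> \<eta> \<in> J i} \<subseteq> (\<Union>z\<in>Z. {i. i < k \<and> c i \<le> z \<and> z \<le> c (Suc i)})"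
    proof
      fix i assume "i \<in> {i. i < k \<and> \<eta> \<in> J i}"
      then have i: "i < k" "(G i < \<eta>) \<noteq> (G (Suc i) < \<eta>)" by (auto simp: J_def)
      then have "{c i..c (Suc i)} \<inter> Z \<noteq> {}" using Z(3) by blast
      then show "i \<in> (\<Union>z\<in>Z. {i. i < k \<and> c i \<le> z \<and> z \<le> c (Suc i)})" using i by auto
    qed
    have "(\<Sum>i<k. indicator (J i) \<eta>) = real (card {i. i < k \<and> \<eta> \<in> J i})"
      by (simp add: indicator_def sum.If_cases Int_def)
    also have "card {i. i < k \<and> \<eta> \<in> J i} \<le> card (\<Union>z\<in>Z. {i. i < k \<and> c i \<le> z \<and> z \<le> c (Suc i)})"
      using Z(1) by (intro card_mono[OF _ sub]) auto
    also have "\<dots> \<le> (\<Sum>z\<in>Z. card {i. i < k \<and> c i \<le> z \<and> z \<le> c (Suc i)})"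
      by (rule card_UN_le[OF Z(1)])
    also have "\<dots> \<le> (\<Sum>z\<in>Z. 2)"
      by (intro sum_mono card_intervals_containing_le_2 c)
    also have "\<dots> \<le> 2 * M" using Z(2) by simp
    finally show ?thesis using True by simp
  next
    case False
    have "\<eta> \<notin> J i" if "i < k" for i
      using G[of i] G[of "Suc i"] that False by (auto simp: J_def min_def max_def split: if_splits)
    then show ?thesis using False by simp
  qed
  have "\<bar>G (Suc i) - G i\<bar> = (LINT \<eta>|lborel. indicator (J i) \<eta>)" for i
    by (simp add: J_def min_def max_def)
  then have "(\<Sum>i<k. \<bar>G (Suc i) - G i\<bar>) = (LINT \<eta>|lborel. (\<Sum>i<k. indicator (J i) \<eta>))"
    by (simp add: Bochner_Integration.integral_sum J_def)
  also have "\<dots> \<le> (LINT \<eta>|lborel. (2 * real M) * indicator {lo..hi} \<eta>)"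
    using count by (intro integral_mono) (auto simp: J_def integrable_indicator_iff emeasure_lborel_Icc_eq)
  also have "\<dots> = 2 * real M * (hi - lo)"
    using G[of 0] by simp
  finally show ?thesis .
qed

text \<open>\<open>\<kappa>\<close> influences only how finely the levels are subdivided and is
  absent from the bound. The factor 8 collects a 2 from the growth rate
  \<open>2 * \<epsilon>\<close>, a 2 from a crossing counted in two adjacent intervals, and a 2 from
  the range \<open>2 * r\<close> of each coordinate.\<close>

lemma critical_interval_bound:
  fixes E :: "'a::euclidean_space set"
  assumes E: "closed E" and bs: "set bs = Basis" and r: "0 \<le> r" and \<epsilon>: "0 < \<epsilon>" and \<kappa>: "0 < \<kappa>"
    and M: "\<And>b \<eta>. few_changes M {c. \<exists>y. lex_least bs (critical_slice E x0 r u0 \<epsilon> \<kappa> c) y \<and> y \<bullet> b < \<eta>}"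
    and pq: "p \<le> q" "\<And>c. p \<le> c \<Longrightarrow> c \<le> q \<Longrightarrow> critical_slice E x0 r u0 \<epsilon> \<kappa> c \<noteq> {}"
  shows "q - p \<le> 8 * real DIM('a) * real M * \<epsilon> * r"
proof (cases "p < q")
  case False
  then show ?thesis using pq r \<epsilon> by simp
next
  case True
  let ?S = "critical_slice E x0 r u0 \<epsilon> \<kappa>"
  have "\<exists>y. lex_least bs (?S c) y" if "p \<le> c" "c \<le> q" for c
  proof -
    have "?S c = near_critical E x0 r u0 \<epsilon> \<kappa> \<inter> {y. u0 \<bullet> y = c}" by (auto simp: critical_slice_def)
    moreover have "compact (near_critical E x0 r u0 \<epsilon> \<kappa> \<inter> {y. u0 \<bullet> y = c})"
      by (intro compact_Int_closed compact_near_critical E closed_hyperplane)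
    ultimately show ?thesis
      using lex_least_exists[of "?S c" bs] pq(2)[OF that] unfolding lex_least_def by auto
  qed
  then obtain Y where Y: "\<And>c. p \<le> c \<Longrightarrow> c \<le> q \<Longrightarrow> lex_least bs (?S c) (Y c)" by metis
  then have YS: "Y c \<in> ?S c" if "p \<le> c" "c \<le> q" for c using that unfolding lex_least_def by blast
  \<comment> \<open>Chosen for the case that the quadratic term dominates: then
    \<open>norm ?d\<close> exceeds \<open>\<epsilon> / \<kappa>\<close>, and
    \<open>2 * \<epsilon> * norm ?d\<close> is at least \<open>\<delta>\<close>, hence at least the
    mesh \<open>h\<close>. In the other case the quadratic term is at most
    \<open>\<epsilon> * norm ?d\<close>.\<close>
  define \<delta> where "\<delta> = 2 * \<epsilon>\<^sup>2 / \<kappa>"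
  have "0 < \<delta>" using \<epsilon> \<kappa> by (simp add: \<delta>_def)
  obtain k where k: "(q - p) / \<delta> < real k" using reals_Archimedean2 by blast
  then have k0: "0 < real k" using True \<open>0 < \<delta>\<close> by (smt (verit) divide_pos_pos)
  define h where "h = (q - p) / real k"
  have h: "0 < h" "h \<le> \<delta>"
    using k k0 \<open>0 < \<delta>\<close> True by (auto simp: h_def field_simps)
  define c where "c i = p + real i * h" for i
  have cmono: "c i < c j" if "i < j" for i j using that h by (simp add: c_def)
  have cq: "p \<le> c i" "c i \<le> q" if "i \<le> k" for i
  proof -
    show "p \<le> c i" using h by (simp add: c_def)
    have "real i * h \<le> real k * h" using that h by (intro mult_right_mono) auto
    also have "\<dots> = q - p" using k0 by (simp add: h_def)
    finally show "c i \<le> q" by (simp add: c_def)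
  qed
  have near: "norm (Y (c i) - x0) \<le> r" if "i \<le> k" for i
    using YS[OF cq[OF that]] r unfolding critical_slice_def near_critical_def
    by (auto intro: power2_le_imp_le)
  have step: "h \<le> 2 * \<epsilon> * norm (Y (c (Suc i)) - Y (c i))" if i: "i < k" for i
  proof -
    let ?d = "Y (c (Suc i)) - Y (c i)"
    have 1: "Y (c i) \<in> ?S (c i)" "Y (c (Suc i)) \<in> ?S (c (Suc i))"
      using YS cq i by simp_all
    then obtain u where u: "(norm (u - u0))\<^sup>2 \<le> \<epsilon>\<^sup>2" "u \<bullet> ?d \<le> \<kappa> * (norm ?d)\<^sup>2"
      unfolding critical_slice_def near_critical_def by blast
    have "norm (u - u0) \<le> \<epsilon>" using power2_le_imp_le[OF u(1)] \<epsilon> by simp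
    then have "(u0 - u) \<bullet> ?d \<le> \<epsilon> * norm ?d"
      using norm_cauchy_schwarz[of "u0 - u" ?d] mult_right_mono[of "norm (u0 - u)" \<epsilon> "norm ?d"]
      by (auto simp: norm_minus_commute)
    moreover have "h = u0 \<bullet> ?d"
      using 1 by (simp add: critical_slice_def inner_diff_right c_def algebra_simps)
    ultimately have *: "h \<le> \<kappa> * (norm ?d)\<^sup>2 + \<epsilon> * norm ?d"
      using u(2) by (simp add: inner_diff_left)
    show ?thesis
    proof (cases "\<kappa> * norm ?d \<le> \<epsilon>")
      case True
      then have "\<kappa> * norm ?d * norm ?d \<le> \<epsilon> * norm ?d" by (intro mult_right_mono) auto
      then show ?thesis using * by (simp add: power2_eq_square)
    next
      case False
      have "\<delta> = 2 * \<epsilon> * (\<epsilon> / \<kappa>)" by (simp add: \<delta>_def power2_eq_square)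
      also have "\<dots> \<le> 2 * \<epsilon> * norm ?d"
        using False \<epsilon> \<kappa> by (intro mult_left_mono) (auto simp: field_simps)
      finally show ?thesis using h by linarith
    qed
  qed
  have var: "(\<Sum>i<k. \<bar>Y (c (Suc i)) \<bullet> b - Y (c i) \<bullet> b\<bar>) \<le> 2 * real M * (2 * r)" if b: "b \<in> Basis" for b
  proof -
    have "(\<Sum>i<k. \<bar>Y (c (Suc i)) \<bullet> b - Y (c i) \<bullet> b\<bar>) \<le> 2 * real M * ((x0 \<bullet> b + r) - (x0 \<bullet> b - r))"
    proof (rule variation_le_crossings[of c k _ "\<lambda>i. Y (c i) \<bullet> b", OF cmono])
      fix i assume "i \<le> k"
      then have "\<bar>(Y (c i) - x0) \<bullet> b\<bar> \<le> r" using Basis_le_norm[OF b] near by (meson order_trans)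
      then show "x0 \<bullet> b - r \<le> Y (c i) \<bullet> b \<and> Y (c i) \<bullet> b \<le> x0 \<bullet> b + r"
        by (auto simp: inner_diff_left abs_le_iff)
    next
      fix \<eta>
      have mem: "t \<in> {c. \<exists>y. lex_least bs (?S c) y \<and> y \<bullet> b < \<eta>} \<longleftrightarrow> Y t \<bullet> b < \<eta>" if "p \<le> t" "t \<le> q" for t
        using Y[OF that] lex_least_unique[OF bs] by blast
      obtain Z where Z: "finite Z" "card Z \<le> M" "\<And>s t. s \<le> t \<Longrightarrow> {s..t} \<inter> Z = {} \<Longrightarrow>
         s \<in> {c. \<exists>y. lex_least bs (?S c) y \<and> y \<bullet> b < \<eta>} \<longleftrightarrow> t \<in> {c. \<exists>y. lex_least bs (?S c) y \<and> y \<bullet> b < \<eta>}"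
        by (rule few_changesE[OF M[of b \<eta>]]) (rule that)
      have "Y (c i) \<bullet> b < \<eta> \<longleftrightarrow> Y (c (Suc i)) \<bullet> b < \<eta>" if "i < k" "{c i..c (Suc i)} \<inter> Z = {}" for i
        using Z(3)[OF less_imp_le[OF cmono] that(2)] mem[of "c i"] mem[of "c (Suc i)"] cq that(1) by simp
      then show "\<exists>Z. finite Z \<and> card Z \<le> M \<and>
          (\<forall>i<k. {c i..c (Suc i)} \<inter> Z = {} \<longrightarrow> (Y (c i) \<bullet> b < \<eta> \<longleftrightarrow> Y (c (Suc i)) \<bullet> b < \<eta>))"
        using Z(1,2) by blast
    qed
    then show ?thesis by (simp add: algebra_simps)
  qed
  have "q - p = (\<Sum>i<k. h)" using k0 by (simp add: h_def)
  also have "\<dots> \<le> (\<Sum>i<k. 2 * \<epsilon> * norm (Y (c (Suc i)) - Y (c i)))"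
    by (intro sum_mono step) auto
  also have "\<dots> \<le> (\<Sum>i<k. 2 * \<epsilon> * (\<Sum>b\<in>Basis. \<bar>(Y (c (Suc i)) - Y (c i)) \<bullet> b\<bar>))"
    using \<epsilon> by (intro sum_mono mult_left_mono norm_le_l1) auto
  also have "\<dots> = 2 * \<epsilon> * (\<Sum>b\<in>Basis. \<Sum>i<k. \<bar>Y (c (Suc i)) \<bullet> b - Y (c i) \<bullet> b\<bar>)"
    unfolding sum_distrib_left[symmetric] by (subst sum.swap) (simp add: inner_diff_left)
  also have "\<dots> \<le> 2 * \<epsilon> * (\<Sum>b\<in>(Basis :: 'a set). 2 * real M * (2 * r))"
    using \<epsilon> by (intro mult_left_mono sum_mono var) auto
  finally show ?thesis by (simp add: algebra_simps)
qed

text \<open>The finite form in which the estimate is applied: \<open>n\<close> critical levels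
  cannot all be more than \<open>C * \<epsilon> * r\<close> apart. The constants \<open>n\<close>
  and \<open>C\<close> are fixed before the centre, the radius, the direction and
  \<open>\<kappa>\<close>.\<close>

definition sard_bound :: "'a::euclidean_space set \<Rightarrow> nat \<Rightarrow> real \<Rightarrow> bool" where
  "sard_bound E n C \<longleftrightarrow> (\<forall>x0 r u0 \<epsilon> \<kappa> \<sigma> T. 0 \<le> r \<longrightarrow> 0 < \<epsilon> \<longrightarrow> 0 < \<kappa> \<longrightarrow>
    T \<subseteq> (\<lambda>y. u0 \<bullet> y) ` near_critical E x0 r u0 \<epsilon> \<kappa> \<longrightarrow> finite T \<longrightarrow> n \<le> card T \<longrightarrow>
    (\<forall>s\<in>T. \<forall>t\<in>T. s \<noteq> t \<longrightarrow> \<sigma> \<le> \<bar>s - t\<bar>) \<longrightarrow> \<sigma> \<le> C * \<epsilon> * r)"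

theorem quantitative_Sard:
  fixes E :: "'a::euclidean_space set"
  assumes E: "closed E" "semialgebraic_set E"
  shows "\<exists>n C. 0 < n \<and> 0 < C \<and> sard_bound E n C"
proof -
  obtain bs where bs: "set bs = (Basis :: 'a set)" using finite_list[OF finite_Basis] by blast
  obtain M where M: "\<forall>x0 r u0 \<epsilon> \<kappa> b \<eta>. few_changes M
      {c. \<exists>y. lex_least bs (critical_slice E x0 r u0 \<epsilon> \<kappa> c) y \<and> y \<bullet> b < \<eta>}"
    using critical_selection_few_changes[OF E(2), of bs] ..
  obtain N where N: "\<forall>x0 r u0 \<epsilon> \<kappa>. few_changes N {c. critical_slice E x0 r u0 \<epsilon> \<kappa> c \<noteq> {}}"
    using critical_values_few_changes[OF E(2)] ..
  define C where "C = 8 * real DIM('a) * real M + 1"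
  have "0 < C" by (simp add: C_def add_nonneg_pos)
  \<comment> \<open>The sorted levels contain \<open>N + 1\<close> consecutive pairs spanning
    disjoint intervals. At most \<open>N\<close> change points cannot meet all of these, so in one
    interval every level is critical and the interval bound applies.\<close>
  moreover have "sard_bound E (2 * N + 2) C"
    unfolding sard_bound_def
  proof (intro allI impI)
    fix x0 r u0 \<epsilon> \<kappa> \<sigma> T
    assume r: "0 \<le> r" and \<epsilon>: "0 < \<epsilon>" and \<kappa>: "0 < \<kappa>"
      and T: "T \<subseteq> (\<lambda>y. u0 \<bullet> y) ` near_critical E x0 r u0 \<epsilon> \<kappa>" "finite T" "2 * N + 2 \<le> card T"
      and sep: "\<forall>s\<in>T. \<forall>t\<in>T. s \<noteq> t \<longrightarrow> \<sigma> \<le> \<bar>s - t\<bar>"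
    let ?V = "{c. critical_slice E x0 r u0 \<epsilon> \<kappa> c \<noteq> {}}"
    define xs where "xs = sorted_list_of_set T"
    have xs: "sorted_wrt (<) xs" "set xs = T" "length xs = card T"
      using T(2) by (simp_all add: xs_def)
    have less: "xs ! i < xs ! j" if "i < j" "j < 2 * N + 2" for i j
      using sorted_wrt_nth_less[OF xs(1) that(1)] that xs(3) T(3) by simp
    have inT: "xs ! i \<in> T" if "i < 2 * N + 2" for i
      using that xs T(3) nth_mem[of i xs] by simp
    obtain Z where Z: "finite Z" "card Z \<le> N"
      "\<And>s t. s \<le> t \<Longrightarrow> {s..t} \<inter> Z = {} \<Longrightarrow> s \<in> ?V \<longleftrightarrow> t \<in> ?V"
      by (rule few_changesE[OF N[rule_format, of x0 r u0 \<epsilon> \<kappa>]]) (rule that)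
    have "\<exists>i\<le>N. {xs ! (2 * i)..xs ! (2 * i + 1)} \<inter> Z = {}"
    proof (rule ccontr)
      assume "\<not> ?thesis"
      then have "\<forall>i\<in>{..N}. \<exists>z. z \<in> Z \<and> xs ! (2 * i) \<le> z \<and> z \<le> xs ! (2 * i + 1)" by fastforce
      then obtain z where z: "\<And>i. i \<le> N \<Longrightarrow> z i \<in> Z \<and> xs ! (2 * i) \<le> z i \<and> z i \<le> xs ! (2 * i + 1)"
        by (metis atMost_iff)
      have lt: "z i < z j" if "i < j" "j \<le> N" for i j
      proof -
        have "z i \<le> xs ! (2 * i + 1)" using z[of i] that by simp
        also have "\<dots> < xs ! (2 * j)" using that by (intro less) auto
        also have "\<dots> \<le> z j" using z[of j] that by simp
        finally show ?thesis .
      qed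
      then have "inj_on z {..N}" by (metis (no_types, lifting) atMost_iff inj_onI linorder_neqE_nat order_less_irrefl)
      then have "card {..N} \<le> card Z" using z by (intro card_inj_on_le[OF _ _ Z(1)]) auto
      then show False using Z(2) by simp
    qed
    then obtain i where i: "i \<le> N" "{xs ! (2 * i)..xs ! (2 * i + 1)} \<inter> Z = {}" by blast
    let ?p = "xs ! (2 * i)" and ?q = "xs ! (2 * i + 1)"
    have pq: "?p < ?q" using i by (intro less) auto
    have "?p \<in> T" using i(1) by (intro inT) simp
    then have "?p \<in> (\<lambda>y. u0 \<bullet> y) ` near_critical E x0 r u0 \<epsilon> \<kappa>" using T(1) by (rule subsetD[rotated])
    then obtain y where "y \<in> near_critical E x0 r u0 \<epsilon> \<kappa>" "?p = u0 \<bullet> y" by (rule imageE)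
    then have "y \<in> critical_slice E x0 r u0 \<epsilon> \<kappa> ?p" by (simp add: critical_slice_def)
    then have "?p \<in> ?V" by (intro CollectI) (metis empty_iff)
    have "critical_slice E x0 r u0 \<epsilon> \<kappa> c \<noteq> {}" if "?p \<le> c" "c \<le> ?q" for c
    proof -
      have "{?p..c} \<inter> Z = {}" using i(2) that by force
      then show ?thesis using Z(3)[OF that(1)] \<open>?p \<in> ?V\<close> by blast
    qed
    then have "?q - ?p \<le> 8 * real DIM('a) * real M * \<epsilon> * r"
      using pq by (intro critical_interval_bound[OF E(1) bs r \<epsilon> \<kappa> M[rule_format]]) auto
    also have "\<dots> \<le> C * \<epsilon> * r"
      using r \<epsilon> by (intro mult_right_mono) (auto simp: C_def)
    finally have "?q - ?p \<le> C * \<epsilon> * r" .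
    moreover have "?q \<in> T" using i(1) by (intro inT) simp
    then have "\<sigma> \<le> \<bar>?p - ?q\<bar>" using bspec[OF bspec[OF sep \<open>?p \<in> T\<close>], of ?q] pq by simp
    ultimately show "\<sigma> \<le> C * \<epsilon> * r" using pq by linarith
  qed
  ultimately show ?thesis by (intro exI[of _ "2 * N + 2"] exI[of _ C]) simp
qed

section \<open>Limits of proximal normals along a curve\<close>

definition outer_measure_le :: "real set \<Rightarrow> real \<Rightarrow> bool" where
  "outer_measure_le S m \<longleftrightarrow> (\<exists>T. S \<subseteq> T \<and> T \<in> lmeasurable \<and> measure lebesgue T \<le> m)"

lemma outer_measure_le_mono:
  "\<lbrakk>outer_measure_le S m; S' \<subseteq> S; m \<le> m'\<rbrakk> \<Longrightarrow> outer_measure_le S' m'"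
  unfolding outer_measure_le_def by (meson order_trans)

lemma outer_measure_le_Un_negligible:
  assumes "outer_measure_le S m" "negligible N" shows "outer_measure_le (S \<union> N) m"
proof -
  obtain T where T: "S \<subseteq> T" "T \<in> lmeasurable" "measure lebesgue T \<le> m"
    using assms(1) unfolding outer_measure_le_def by blast
  have N: "N \<in> lmeasurable" "measure lebesgue N = 0"
    using assms(2) by (rule negligible_imp_measurable, rule negligible_imp_measure0)
  have "measure lebesgue (T \<union> N) \<le> measure lebesgue T + measure lebesgue N"
    by (rule measure_Un_le[OF fmeasurableD[OF T(2)] fmeasurableD[OF N(1)]])
  moreover have "T \<union> N \<in> lmeasurable" using T(2) N(1) by (rule fmeasurable.Un)
  moreover have "S \<union> N \<subseteq> T \<union> N" using T(1) by blast
  ultimately show ?thesis unfolding outer_measure_le_def using T(3) N(2)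
    by (intro exI[of _ "T \<union> N"] conjI) (assumption, assumption, linarith)
qed

lemma outer_measure_le_UN:
  assumes C: "countable C" and S: "\<And>i. i \<in> C \<Longrightarrow> outer_measure_le (S i) (m i)"
    and B: "\<And>F. finite F \<Longrightarrow> F \<subseteq> C \<Longrightarrow> (\<Sum>i\<in>F. m i) \<le> B"
  shows "outer_measure_le (\<Union>i\<in>C. S i) B"
proof -
  obtain T where T: "\<And>i. i \<in> C \<Longrightarrow> S i \<subseteq> T i \<and> T i \<in> lmeasurable \<and> measure lebesgue (T i) \<le> m i"
    using S unfolding outer_measure_le_def by metis
  have "measure lebesgue (\<Union>i\<in>F. T i) \<le> B" if F: "F \<subseteq> C" "finite F" for F
  proof -
    have "measure lebesgue (\<Union>i\<in>F. T i) \<le> (\<Sum>i\<in>F. measure lebesgue (T i))"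
      using T F by (intro measure_UNION_le) (auto dest: fmeasurableD)
    also have "\<dots> \<le> (\<Sum>i\<in>F. m i)" using T F by (intro sum_mono) auto
    also have "\<dots> \<le> B" by (rule B[OF F(2,1)])
    finally show ?thesis .
  qed
  then have "(\<Union>i\<in>C. T i) \<in> lmeasurable" "measure lebesgue (\<Union>i\<in>C. T i) \<le> B"
    using fmeasurable_UN_bound[OF C, of T lebesgue] measure_UN_bound[OF C, of T lebesgue] T by blast+
  moreover have "(\<Union>i\<in>C. S i) \<subseteq> (\<Union>i\<in>C. T i)" using T by blast
  ultimately show ?thesis unfolding outer_measure_le_def by blast
qed

lemma Vitali_intervals:
  fixes S :: "real set"
  assumes vit: "\<And>t \<delta>. t \<in> S \<Longrightarrow> 0 < \<delta> \<Longrightarrow> \<exists>c d. P c d \<and> c < d \<and> t \<in> {c..d} \<and> d - c < \<delta>"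
  shows "\<exists>C. countable C \<and> (\<forall>(c, d)\<in>C. P c d \<and> c < d) \<and>
    pairwise (\<lambda>i j. disjnt {fst i..snd i} {fst j..snd j}) C \<and>
    negligible (S - (\<Union>i\<in>C. {fst i..snd i}))"
proof -
  define K where "K = {i. P (fst i) (snd i) \<and> fst i < snd i}"
  define m where "m i = (fst i + snd i) / 2" for i :: "real \<times> real"
  define r where "r i = (snd i - fst i) / 2" for i :: "real \<times> real"
  have cb: "cball (m i) (r i) = {fst i..snd i}" for i
    by (simp add: cball_eq_atLeastAtMost m_def r_def field_simps)
  have 1: "0 < r i" if "i \<in> K" for i using that by (simp add: K_def r_def)
  have 2: "\<exists>i. i \<in> K \<and> t \<in> cball (m i) (r i) \<and> r i < \<delta>" if t: "t \<in> S" "0 < \<delta>" for t \<delta>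
  proof -
    obtain c d where "P c d" "c < d" "t \<in> {c..d}" "d - c < \<delta>" using vit[OF t] by blast
    then show ?thesis unfolding cb by (intro exI[of _ "(c, d)"]) (auto simp: K_def r_def)
  qed
  have "\<exists>C. countable C \<and> C \<subseteq> K \<and>
     pairwise (\<lambda>i j. disjnt (cball (m i) (r i)) (cball (m j) (r j))) C \<and>
     negligible (S - (\<Union>i \<in> C. cball (m i) (r i)))"
    by (rule Vitali_covering_theorem_cballs[of K r S m, OF 1 2]) blast+
  then obtain C where "countable C" "C \<subseteq> K"
     "pairwise (\<lambda>i j. disjnt {fst i..snd i} {fst j..snd j}) C"
     "negligible (S - (\<Union>i \<in> C. {fst i..snd i}))"
    unfolding cb by (elim exE conjE)
  then show ?thesis by (intro exI[of _ C]) (auto simp: K_def)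
qed

text \<open>A Vitali cover taken inside an open set barely larger than \<open>S\<close> bounds the
  outer measure of \<open>S\<close> by nearly \<open>\<theta>\<close> times itself, which forces it
  to be 0. Measurability of \<open>S\<close> is nowhere assumed.\<close>

lemma negligible_if_relative_covers:
  fixes S :: "real set"
  assumes \<theta>: "0 \<le> \<theta>" "\<theta> < 1"
    and cov: "\<And>x \<delta>. x \<in> S \<Longrightarrow> 0 < \<delta> \<Longrightarrow>
      \<exists>p q. outer_measure_le (S \<inter> {p..q}) (\<theta> * (q - p)) \<and> p < q \<and> x \<in> {p..q} \<and> q - p < \<delta>"
  shows "negligible S"
proof -
  \<comment> \<open>For a bounded set the outer measure is finite, so that it can be compared with a
    fraction of itself.\<close>
  have bounded: "negligible S" if S: "S \<subseteq> {a..b}"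
    and cov: "\<And>x \<delta>. x \<in> S \<Longrightarrow> 0 < \<delta> \<Longrightarrow>
      \<exists>p q. outer_measure_le (S \<inter> {p..q}) (\<theta> * (q - p)) \<and> p < q \<and> x \<in> {p..q} \<and> q - p < \<delta>" for S a b
  proof -
    define A where "A = {m. outer_measure_le S m}"
    have bdd: "bdd_below A" unfolding A_def outer_measure_le_def
      by (intro bdd_belowI[of _ 0]) (auto intro: order_trans[OF measure_nonneg])
    have "measure lebesgue {a..b} \<in> A"
      unfolding A_def outer_measure_le_def using S lmeasurable_cbox[of a b]
      by (intro CollectI exI[of _ "{a..b}"]) simp
    then have ne: "A \<noteq> {}" by blast
    define s where "s = Inf A"
    have s0: "0 \<le> s" unfolding s_def
      by (intro cInf_greatest ne) (auto simp: A_def outer_measure_le_def intro: order_trans[OF measure_nonneg])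
    have "s = 0"
    proof (rule ccontr)
      assume "s \<noteq> 0"
      then have "0 < s" using s0 by simp
      \<comment> \<open>Small enough for \<open>\<theta> * (s + 2 * \<eta>) < s\<close>. The
        measurable superset \<open>T\<close> and the open superset \<open>U\<close> each cost one
        \<open>\<eta>\<close>.\<close>
      define \<eta> where "\<eta> = (1 - \<theta>) * s / 4"
      have \<eta>: "0 < \<eta>" using \<open>0 < s\<close> \<theta> by (simp add: \<eta>_def)
      have "Inf A < s + \<eta>" using \<eta> by (simp add: s_def)
      from cInf_lessD[OF ne this]
      obtain m T where T: "S \<subseteq> T" "T \<in> lmeasurable" "measure lebesgue T \<le> m" "m < s + \<eta>"
        by (auto simp: A_def outer_measure_le_def)
      obtain U where U: "open U" "T \<subseteq> U" "U - T \<in> lmeasurable" "emeasure lebesgue (U - T) < ennreal \<eta>"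
        using sets_lebesgue_outer_open[of T \<eta>] T(2) \<eta> by (auto dest: fmeasurableD)
      have "U = T \<union> (U - T)" using U(2) by blast
      then have Um: "U \<in> lmeasurable" using T(2) U(3) by (metis fmeasurable.Un)
      have "measure lebesgue (U - T) < \<eta>"
        using U(3,4) \<eta> by (simp add: emeasure_eq_measure2 ennreal_less_iff)
      moreover have "measure lebesgue U \<le> measure lebesgue T + measure lebesgue (U - T)"
        using measure_Un_le[of T lebesgue "U - T"] T(2) U(3) \<open>U = T \<union> (U - T)\<close> by (metis fmeasurableD)
      ultimately have mU: "measure lebesgue U < s + 2 * \<eta>" using T(3,4) by linarith
      have "\<exists>C. countable C \<and>
        (\<forall>(p, q)\<in>C. ({p..q} \<subseteq> U \<and> outer_measure_le (S \<inter> {p..q}) (\<theta> * (q - p))) \<and> p < q) \<and>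
        pairwise (\<lambda>i j. disjnt {fst i..snd i} {fst j..snd j}) C \<and>
        negligible (S - (\<Union>i\<in>C. {fst i..snd i}))"
      proof (rule Vitali_intervals)
        fix x \<delta> :: real assume x: "x \<in> S" "0 < \<delta>"
        obtain r where r: "0 < r" "ball x r \<subseteq> U" using U(1,2) T(1) x(1) open_contains_ball by blast
        then obtain p q where pq: "outer_measure_le (S \<inter> {p..q}) (\<theta> * (q - p))" "p < q" "x \<in> {p..q}" "q - p < min \<delta> r"
          using cov[OF x(1), of "min \<delta> r"] x(2) by auto
        have "{p..q} \<subseteq> ball x r" using pq(3,4) by (auto simp: dist_real_def)
        then show "\<exists>p q. ({p..q} \<subseteq> U \<and> outer_measure_le (S \<inter> {p..q}) (\<theta> * (q - p))) \<and> p < q \<and> x \<in> {p..q} \<and> q - p < \<delta>"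
          using pq r(2) by (intro exI[of _ p] exI[of _ q]) auto
      qed
      then obtain C where C: "countable C"
        "\<forall>(p, q)\<in>C. ({p..q} \<subseteq> U \<and> outer_measure_le (S \<inter> {p..q}) (\<theta> * (q - p))) \<and> p < q"
        "pairwise (\<lambda>i j. disjnt {fst i..snd i} {fst j..snd j}) C"
        "negligible (S - (\<Union>i\<in>C. {fst i..snd i}))"
        by (elim exE conjE)
      have Ci: "{fst i..snd i} \<subseteq> U" "outer_measure_le (S \<inter> {fst i..snd i}) (\<theta> * (snd i - fst i))" "fst i \<le> snd i"
        if "i \<in> C" for i using C(2) that by (auto simp: split_beta)
      have "outer_measure_le (\<Union>i\<in>C. S \<inter> {fst i..snd i}) (\<theta> * (s + 2 * \<eta>))"
      proof (rule outer_measure_le_UN[OF C(1) Ci(2)])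
        fix F assume F: "finite F" "F \<subseteq> C"
        have lm: "{fst i..snd i} \<in> lmeasurable" for i :: "real \<times> real" by (metis cbox_interval lmeasurable_cbox)
        have "(\<Sum>i\<in>F. snd i - fst i) = (\<Sum>i\<in>F. measure lebesgue {fst i..snd i})"
          using Ci(3) F(2) by (intro sum.cong) auto
        also have "\<dots> = measure lebesgue (\<Union>i\<in>F. {fst i..snd i})"
          using F(1) lm pairwise_subset[OF C(3) F(2)] by (intro measure_UNION'[symmetric])
        also have "\<dots> \<le> measure lebesgue U"
          using F Ci(1) lm by (intro measure_mono_fmeasurable[OF _ _ Um] sets.finite_UN) (auto dest: fmeasurableD)
        finally have "(\<Sum>i\<in>F. snd i - fst i) \<le> s + 2 * \<eta>" using mU by linarith
        then show "(\<Sum>i\<in>F. \<theta> * (snd i - fst i)) \<le> \<theta> * (s + 2 * \<eta>)"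
          unfolding sum_distrib_left[symmetric] using \<theta>(1) by (rule mult_left_mono)
      qed
      from outer_measure_le_Un_negligible[OF this C(4)] have "outer_measure_le S (\<theta> * (s + 2 * \<eta>))"
        by (rule outer_measure_le_mono) auto
      then have "s \<le> \<theta> * (s + 2 * \<eta>)"
        using cInf_lower[OF _ bdd] unfolding s_def A_def by blast
      moreover have "\<theta> * \<eta> \<le> \<eta>" using \<theta> \<eta> by (simp add: mult_left_le_one_le)
      ultimately have "s \<le> \<theta> * s + 2 * \<eta>" by (simp add: algebra_simps)
      moreover have "2 * \<eta> = (s - \<theta> * s) / 2" by (simp add: \<eta>_def left_diff_distrib)
      ultimately have "s - \<theta> * s \<le> (s - \<theta> * s) / 2" by linarith
      then have "(1 - \<theta>) * s \<le> (1 - \<theta>) * s / 2" by (simp add: algebra_simps)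
      then show False using \<open>0 < s\<close> \<theta> by (simp add: zero_less_mult_iff)
    qed
    show ?thesis
      unfolding negligible_outer_le
    proof (intro allI impI)
      fix e :: real assume "0 < e"
      then have "Inf A < e" using \<open>s = 0\<close> by (simp add: s_def)
      from cInf_lessD[OF ne this] obtain m where "outer_measure_le S m" "m < e" by (auto simp: A_def)
      then show "\<exists>T. S \<subseteq> T \<and> T \<in> lmeasurable \<and> measure lebesgue T \<le> e"
        using outer_measure_le_mono[of S m S e] unfolding outer_measure_le_def by auto
    qed
  qed
  have "negligible (S \<inter> {- real n..real n})" for n
  proof (rule bounded)
    fix x \<delta> :: real assume "x \<in> S \<inter> {- real n..real n}" "0 < \<delta>"
    then obtain p q where "outer_measure_le (S \<inter> {p..q}) (\<theta> * (q - p))" "p < q" "x \<in> {p..q}" "q - p < \<delta>"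
      using cov by blast
    then show "\<exists>p q. outer_measure_le (S \<inter> {- real n..real n} \<inter> {p..q}) (\<theta> * (q - p)) \<and>
        p < q \<and> x \<in> {p..q} \<and> q - p < \<delta>"
      by (intro exI[of _ p] exI[of _ q]) (auto elim: outer_measure_le_mono)
  qed blast
  then have "negligible (\<Union>n. S \<inter> {- real n..real n})"
    by (rule negligible_Union_nat)
  moreover have "(\<Union>n. S \<inter> {- real n..real n}) = S"
  proof -
    have "\<exists>n. x \<in> {- real n..real n}" for x
    proof -
      obtain n where "\<bar>x\<bar> \<le> real n" using real_arch_simple by blast
      then show ?thesis by (intro exI[of _ n]) auto
    qed
    then show ?thesis by blast
  qed
  ultimately show ?thesis by simp
qed

text \<open>A hole of length \<open>h\<close> in \<open>{x..q}\<close> leaves at most the fraction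
  \<open>1 - 1 / (2 * n)\<close> of that interval. Only every second one of the \<open>2 * n\<close>
  pieces is tested, so that points taken from different tested pieces are at least \<open>h\<close>
  apart.\<close>

lemma negligible_porous:
  fixes S :: "real set"
  assumes n: "0 < n"
    and hole: "\<And>x. x \<in> S \<Longrightarrow> \<exists>\<delta>>0. \<forall>q h. x < q \<and> q - x < \<delta> \<and> h = (q - x) / (2 * real n) \<longrightarrow>
      (\<exists>j<n. S \<inter> {x + 2 * real j * h<..<x + 2 * real j * h + h} = {})"
  shows "negligible S"
proof (rule negligible_if_relative_covers)
  let ?\<theta> = "1 - 1 / (2 * real n)"
  show "0 \<le> ?\<theta>" "?\<theta> < 1" using n by (auto simp: field_simps)
  fix x \<delta>' :: real assume "x \<in> S" "0 < \<delta>'"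
  from hole[OF this(1)] obtain \<delta> where "\<delta> > 0" and
    \<delta>: "\<forall>q h. x < q \<and> q - x < \<delta> \<and> h = (q - x) / (2 * real n) \<longrightarrow>
      (\<exists>j<n. S \<inter> {x + 2 * real j * h<..<x + 2 * real j * h + h} = {})"
    by (elim exE conjE)
  define q where "q = x + min \<delta> \<delta>' / 2"
  have q: "x < q" "q - x < \<delta>" "q - x < \<delta>'"
    using \<open>\<delta> > 0\<close> \<open>0 < \<delta>'\<close> by (auto simp: q_def min_def)
  define h where "h = (q - x) / (2 * real n)"
  have h: "0 < h" "2 * real n * h = q - x" using q n by (auto simp: h_def)
  obtain j where j: "j < n" "S \<inter> {x + 2 * real j * h<..<x + 2 * real j * h + h} = {}"
    using \<delta>[rule_format, of q h] q h_def by blast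
  let ?c = "x + 2 * real j * h"
  have "2 * real (Suc j) * h \<le> 2 * real n * h" using j(1) h(1) by (intro mult_right_mono) auto
  then have "?c + 2 * h \<le> q" using h(2) by (simp add: algebra_simps)
  then have c: "x \<le> ?c" "?c + h \<le> q" using h(1) by auto
  let ?T = "{x..?c} \<union> {?c + h..q}"
  have "measure lebesgue ?T \<le> measure lebesgue {x..?c} + measure lebesgue {?c + h..q}"
    by (intro measure_Un_le) auto
  also have "\<dots> = q - x - h" using c by simp
  also have "\<dots> = ?\<theta> * (q - x)" using n by (simp add: h_def field_simps)
  finally have "measure lebesgue ?T \<le> ?\<theta> * (q - x)" .
  moreover have "S \<inter> {x..q} \<subseteq> ?T"
  proof
    fix y assume y: "y \<in> S \<inter> {x..q}"
    then have "y \<notin> {?c<..<?c + h}" using j(2) by blast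
    then show "y \<in> ?T" using y by auto
  qed
  moreover have "?T \<in> lmeasurable" by (intro fmeasurable.Un) (metis cbox_interval lmeasurable_cbox)+
  ultimately have "outer_measure_le (S \<inter> {x..q}) (?\<theta> * (q - x))"
    unfolding outer_measure_le_def by blast
  then show "\<exists>p q. outer_measure_le (S \<inter> {p..q}) (?\<theta> * (q - p)) \<and> p < q \<and> x \<in> {p..q} \<and> q - p < \<delta>'"
    using q by (intro exI[of _ x] exI[of _ q]) auto
qed

section \<open>Limiting normals and the velocity of a curve\<close>

definition proximal_limits :: "'a::real_inner set \<Rightarrow> 'a \<Rightarrow> 'a set" where
  "proximal_limits E z = {u. \<forall>e>0. \<exists>y u' \<kappa>. y \<in> E \<and> norm (y - z) < e \<and> norm (u' - u) < e \<and>
     (\<forall>w\<in>E. u' \<bullet> (w - y) \<le> \<kappa> * (norm (w - y))\<^sup>2)}"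

text \<open>At points of a closed set these limits form the limiting normal cone. The proximal
  constant is scaled along with the normal, which is harmless as no bound on it is kept.\<close>

lemma proximal_limits_scaleR:
  assumes "u \<in> proximal_limits E z" "0 < c" shows "c *\<^sub>R u \<in> proximal_limits E z"
  unfolding proximal_limits_def
proof (intro CollectI allI impI)
  fix e :: real assume e: "0 < e"
  define e' where "e' = min e (e / c)"
  have "0 < e'" using e assms(2) by (simp add: e'_def)
  then obtain y u' \<kappa> where y: "y \<in> E" "norm (y - z) < e'" "norm (u' - u) < e'"
    and k: "\<And>w. w \<in> E \<Longrightarrow> u' \<bullet> (w - y) \<le> \<kappa> * (norm (w - y))\<^sup>2"
    using assms(1) unfolding proximal_limits_def by blast
  have "norm (c *\<^sub>R u' - c *\<^sub>R u) = c * norm (u' - u)"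
    using assms(2) by (simp flip: scaleR_diff_right)
  also have "\<dots> < c * (e / c)" using y(3) assms(2) by (intro mult_strict_left_mono) (auto simp: e'_def)
  finally have "norm (c *\<^sub>R u' - c *\<^sub>R u) < e" using assms(2) by simp
  moreover have "(c *\<^sub>R u') \<bullet> (w - y) \<le> (c * \<kappa>) * (norm (w - y))\<^sup>2" if "w \<in> E" for w
    using mult_left_mono[OF k[OF that], of c] assms(2) by (simp add: mult.assoc)
  ultimately show "\<exists>y u' \<kappa>. y \<in> E \<and> norm (y - z) < e \<and> norm (u' - c *\<^sub>R u) < e \<and>
     (\<forall>w\<in>E. u' \<bullet> (w - y) \<le> \<kappa> * (norm (w - y))\<^sup>2)"
    using y(1,2) by (intro exI[of _ y] exI[of _ "c *\<^sub>R u'"] exI[of _ "c * \<kappa>"]) (auto simp: e'_def)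
qed

text \<open>If every tested piece contained a time in \<open>B\<close>, the critical points
  \<open>y j\<close> near the curve would have \<open>n\<close> levels at mutual distance at least
  \<open>h / 4\<close>, because the level moves along the curve at speed at least 1/2. They lie in a
  ball of radius \<open>2 * n * h * (l + 2)\<close>, and \<open>\<epsilon>\<close> is so small that
  the level estimate permits at most \<open>h / 8\<close>.\<close>

lemma sard_hole:
  fixes E :: "'a::euclidean_space set" and z :: "real \<Rightarrow> 'a"
  assumes n: "0 < n" and C: "0 < C"
    and sard: "sard_bound E n C"
    and l: "0 \<le> l" and \<epsilon>: "\<epsilon> = 1 / (16 * real n * (C + 1) * (l + 2))"
    and v: "(z has_vector_derivative v) (at t0)" "norm v \<le> l" "1/2 \<le> \<bar>u0 \<bullet> v\<bar>"
    and B: "\<And>t. t \<in> B \<Longrightarrow> \<exists>u\<in>proximal_limits E (z t). norm (u - u0) < \<epsilon> / 2"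
  shows "\<exists>\<delta>>0. \<forall>q h. t0 < q \<and> q - t0 < \<delta> \<and> h = (q - t0) / (2 * real n) \<longrightarrow>
      (\<exists>j<n. B \<inter> {t0 + 2 * real j * h<..<t0 + 2 * real j * h + h} = {})"
proof -
  have \<epsilon>0: "0 < \<epsilon>" using n C l by (simp add: \<epsilon>)
  define N where "N = norm u0 + 1"
  have N: "1 \<le> N" by (simp add: N_def)
  \<comment> \<open>The linearisation error over the length \<open>2 * n * h\<close> then shifts a
    level by at most \<open>h / 16\<close>. The distance \<open>\<omega>\<close> allowed between
    curve and critical point costs another \<open>h / 16\<close>.\<close>
  define \<theta> where "\<theta> = 1 / (32 * real n * N)"
  have \<theta>: "0 < \<theta>" "\<theta> \<le> 1"
  proof -
    have "1 * 1 \<le> real n * N" using n N by (intro mult_mono) auto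
    then show "0 < \<theta>" "\<theta> \<le> 1" by (auto simp: \<theta>_def field_simps)
  qed
  obtain \<delta> where \<delta>: "0 < \<delta>" "\<And>s. \<bar>s - t0\<bar> < \<delta> \<Longrightarrow> norm (z s - z t0 - (s - t0) *\<^sub>R v) \<le> \<theta> * \<bar>s - t0\<bar>"
    using v(1) \<theta>(1) unfolding has_vector_derivative_def has_derivative_at_alt by (auto simp: real_norm_def)
  show ?thesis
  proof (intro exI[of _ \<delta>] conjI allI impI, fact)
    fix q h assume A: "t0 < q \<and> q - t0 < \<delta> \<and> h = (q - t0) / (2 * real n)"
    show "\<exists>j<n. B \<inter> {t0 + 2 * real j * h<..<t0 + 2 * real j * h + h} = {}"
    proof (rule ccontr)
      assume "\<not> ?thesis"
      then have "\<forall>j\<in>{..<n}. \<exists>t. t \<in> B \<and> t0 + 2 * real j * h < t \<and> t < t0 + 2 * real j * h + h" by fastforce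
      then obtain t where t: "\<And>j. j < n \<Longrightarrow> t j \<in> B \<and> t0 + 2 * real j * h < t j \<and> t j < t0 + 2 * real j * h + h"
        by (metis lessThan_iff)
      define L where "L = q - t0"
      have L: "0 < L" "L < \<delta>" "L = 2 * real n * h" using A n by (auto simp: L_def)
      have h: "0 < h" "h \<le> L"
      proof -
        show "0 < h" using A n by simp
        then have "1 * h \<le> 2 * real n * h" using n by (intro mult_right_mono) auto
        then show "h \<le> L" using L(3) by simp
      qed
      have sep: "h \<le> t j - t i" if "i < j" "j < n" for i j
      proof -
        have "2 * real (Suc i) * h \<le> 2 * real j * h" using that h by (intro mult_right_mono) auto
        then show ?thesis using t[of i] t[of j] that by (simp add: algebra_simps)
      qed
      have tpq: "\<bar>t j - t0\<bar> \<le> L" if "j < n" for j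
      proof -
        have "2 * real (Suc j) * h \<le> 2 * real n * h" using that h by (intro mult_right_mono) auto
        then have "t0 + 2 * real j * h + h \<le> q" using L h by (simp add: L_def algebra_simps)
        moreover have "0 \<le> 2 * real j * h" using h by simp
        moreover have "t0 + 2 * real j * h < t j" "t j < t0 + 2 * real j * h + h"
          using t[OF that] by auto
        ultimately show ?thesis unfolding L_def by linarith
      qed
      have err: "norm (z (t j) - z t0 - (t j - t0) *\<^sub>R v) \<le> \<theta> * L" if "j < n" for j
      proof -
        have "\<theta> * \<bar>t j - t0\<bar> \<le> \<theta> * L" using tpq[OF that] \<theta> by (intro mult_left_mono) auto
        then show ?thesis using \<delta>(2)[of "t j"] tpq[OF that] L by force
      qed
      define \<omega> where "\<omega> = h / (16 * N)"
      have \<omega>: "0 < \<omega>" "\<omega> \<le> L" "N * \<omega> = h / 16"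
      proof -
        show "0 < \<omega>" "N * \<omega> = h / 16" using h N by (auto simp: \<omega>_def)
        have "h * 1 \<le> h * (16 * N)" using h N by (intro mult_left_mono) auto
        then have "\<omega> \<le> h" using N by (simp add: \<omega>_def field_simps)
        then show "\<omega> \<le> L" using h by simp
      qed
      have "\<exists>y u \<kappa>. y \<in> E \<and> norm (y - z (t j)) < \<omega> \<and> norm (u - u0) < \<epsilon> \<and>
         (\<forall>w\<in>E. u \<bullet> (w - y) \<le> \<kappa> * (norm (w - y))\<^sup>2)" if j: "j < n" for j
      proof -
        obtain u where u: "u \<in> proximal_limits E (z (t j))" "norm (u - u0) < \<epsilon> / 2"
          using B t[OF j] by blast
        then obtain y u' \<kappa> where y: "y \<in> E" "norm (y - z (t j)) < min \<omega> (\<epsilon> / 2)" "norm (u' - u) < min \<omega> (\<epsilon> / 2)"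
          "\<forall>w\<in>E. u' \<bullet> (w - y) \<le> \<kappa> * (norm (w - y))\<^sup>2"
          unfolding proximal_limits_def mem_Collect_eq using \<omega>(1) \<epsilon>0 by (metis half_gt_zero min_less_iff_conj)
        have "norm (u' - u0) \<le> norm (u' - u) + norm (u - u0)"
          using norm_triangle_ineq[of "u' - u" "u - u0"] by simp
        then show ?thesis using y u(2) by (intro exI[of _ y] exI[of _ u'] exI[of _ \<kappa>]) auto
      qed
      then obtain y u \<kappa> where y: "\<And>j. j < n \<Longrightarrow> y j \<in> E \<and> norm (y j - z (t j)) < \<omega> \<and> norm (u j - u0) < \<epsilon> \<and>
         (\<forall>w\<in>E. u j \<bullet> (w - y j) \<le> \<kappa> j * (norm (w - y j))\<^sup>2)" by metis
      \<comment> \<open>The proximal constants of the \<open>n\<close> points have no bound known in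
        advance, but the level estimate is uniform in \<open>\<kappa>\<close>, so their maximum
        serves for all.\<close>
      define K where "K = Max (insert 1 (\<kappa> ` {..<n}))"
      have K: "0 < K" "\<And>j. j < n \<Longrightarrow> \<kappa> j \<le> K"
      proof -
        have "1 \<le> K" unfolding K_def by (intro Max_ge) auto
        then show "0 < K" by simp
        show "\<kappa> j \<le> K" if "j < n" for j unfolding K_def using that by (intro Max_ge) auto
      qed
      define r where "r = (l + 2) * L"
      have r: "0 \<le> r" using l L by (simp add: r_def)
      have yr: "y j \<in> near_critical E (z t0) r u0 \<epsilon> K" if j: "j < n" for j
      proof -
        have "norm (y j - z t0) \<le> norm (y j - z (t j)) + norm (z (t j) - z t0 - (t j - t0) *\<^sub>R v) + norm ((t j - t0) *\<^sub>R v)"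
          using norm_triangle_ineq[of "y j - z (t j)" "z (t j) - z t0"]
            norm_triangle_ineq[of "z (t j) - z t0 - (t j - t0) *\<^sub>R v" "(t j - t0) *\<^sub>R v"] by simp
        also have "\<dots> \<le> L + 1 * L + L * l"
        proof (intro add_mono)
          show "norm (y j - z (t j)) \<le> L" using y[OF j] \<omega>(2) by linarith
          show "norm (z (t j) - z t0 - (t j - t0) *\<^sub>R v) \<le> 1 * L"
            using err[OF j] \<theta> L mult_right_mono[of \<theta> 1 L] by linarith
          show "norm ((t j - t0) *\<^sub>R v) \<le> L * l"
            using tpq[OF j] v(2) L by (simp add: mult_mono)
        qed
        also have "\<dots> = r" by (simp add: r_def algebra_simps)
        finally have 1: "(norm (y j - z t0))\<^sup>2 \<le> r\<^sup>2" by (intro power_mono) auto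
        have 2: "(norm (u j - u0))\<^sup>2 \<le> \<epsilon>\<^sup>2" using y[OF j] by (intro power_mono) auto
        have 3: "u j \<bullet> (w - y j) \<le> K * (norm (w - y j))\<^sup>2" if "w \<in> E" for w
          using y[OF j] that K(2)[OF j] mult_right_mono[of "\<kappa> j" K "(norm (w - y j))\<^sup>2"] by fastforce
        show ?thesis unfolding near_critical_def using y[OF j] 1 2 3 by blast
      qed
      have ysep: "h / 4 \<le> \<bar>u0 \<bullet> y j - u0 \<bullet> y i\<bar>" if ij: "i < j" "j < n" for i j
      proof -
        let ?e = "\<lambda>j. (y j - z (t j)) + (z (t j) - z t0 - (t j - t0) *\<^sub>R v)"
        have e: "\<bar>u0 \<bullet> ?e j\<bar> \<le> h / 16 + h / 16" if "j < n" for j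
        proof -
          have "\<bar>u0 \<bullet> ?e j\<bar> \<le> norm u0 * norm (?e j)" by (rule Cauchy_Schwarz_ineq2)
          also have "\<dots> \<le> N * (\<omega> + \<theta> * L)"
            using y[OF that] err[OF that] \<omega> \<theta> L by (intro mult_mono norm_triangle_le add_mono) (auto simp: N_def)
          also have "\<dots> = h / 16 + h / 16"
            using \<omega>(3) N n by (simp add: distrib_left \<theta>_def L(3))
          finally show ?thesis .
        qed
        \<comment> \<open>The motion separates the levels by at least \<open>h / 2\<close>, and the
          errors at the two points take away at most \<open>h / 8\<close> each.\<close>
        have "u0 \<bullet> y j - u0 \<bullet> y i = (t j - t i) * (u0 \<bullet> v) + (u0 \<bullet> ?e j - u0 \<bullet> ?e i)"
          by (simp add: inner_diff_right inner_add_right algebra_simps)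
        moreover have "h * (1/2) \<le> \<bar>(t j - t i) * (u0 \<bullet> v)\<bar>"
          unfolding abs_mult using sep[OF ij] v(3) h by (intro mult_mono) auto
        ultimately show ?thesis using e[of i] e[of j] ij by linarith
      qed
      have inj: "inj_on (\<lambda>j. u0 \<bullet> y j) {..<n}"
      proof (rule linorder_inj_onI)
        fix i j assume "i < j" "i \<in> {..<n}" "j \<in> {..<n}"
        then show "u0 \<bullet> y i \<noteq> u0 \<bullet> y j" using ysep[of i j] h by auto
      qed auto
      have "h / 4 \<le> C * \<epsilon> * r"
      proof (rule sard[unfolded sard_bound_def, rule_format, OF r \<epsilon>0 K(1)])
        show "(\<lambda>j. u0 \<bullet> y j) ` {..<n} \<subseteq> (\<lambda>y. u0 \<bullet> y) ` near_critical E (z t0) r u0 \<epsilon> K"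
          using yr by blast
        show "n \<le> card ((\<lambda>j. u0 \<bullet> y j) ` {..<n})" by (simp add: card_image[OF inj])
        fix a b assume "a \<in> (\<lambda>j. u0 \<bullet> y j) ` {..<n}" "b \<in> (\<lambda>j. u0 \<bullet> y j) ` {..<n}" "a \<noteq> b"
        then obtain i j where ij: "i < n" "j < n" "a = u0 \<bullet> y i" "b = u0 \<bullet> y j" "i \<noteq> j" by auto
        then consider "i < j" | "j < i" by (metis linorder_neqE_nat)
        then show "h / 4 \<le> \<bar>a - b\<bar>"
          using ysep[of i j] ysep[of j i] ij(1,2) unfolding ij(3,4)
          by cases (auto simp: abs_minus_commute)
      qed auto
      also have "\<dots> = (C / (C + 1)) * (h / 8)"
      proof -
        have "C * (1 / (16 * m * c * a)) * (a * (2 * m * h)) = (C / c) * (h / 8)"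
          if "m \<noteq> 0" "c \<noteq> 0" "a \<noteq> 0" for m c a :: real
          using that by (simp add: field_simps)
        from this[of "real n" "C + 1" "l + 2"] show ?thesis
          using n C l by (simp add: \<epsilon> r_def L(3))
      qed
      also have "\<dots> \<le> 1 * (h / 8)" using C h by (intro mult_right_mono) auto
      finally show False using h by simp
    qed
  qed
qed

text \<open>Countably many porous sets suffice: the normal is scaled to have inner product of
  modulus 1 with the velocity, the speed is bounded by an integer \<open>l\<close>, and the normal
  is approximated by a member \<open>d\<close> of a countable dense set. Since
  \<open>\<epsilon> l * l \<le> 1\<close>, the inner product with \<open>d\<close> stays at least
  1/2 in modulus.\<close>

theorem proximal_limits_orthogonal_ae:
  fixes E :: "'a::euclidean_space set" and z :: "real \<Rightarrow> 'a"
  assumes E: "closed E" "semialgebraic_set E"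
  shows "negligible {t. \<exists>v u. (z has_vector_derivative v) (at t) \<and> u \<in> proximal_limits E (z t) \<and> u \<bullet> v \<noteq> 0}"
proof -
  obtain n C where n: "0 < n" and C: "0 < C" and sard: "sard_bound E n C"
    using quantitative_Sard[OF E] by (elim exE conjE)
  define \<epsilon> where "\<epsilon> l = 1 / (16 * real n * (C + 1) * (real l + 2))" for l :: nat
  have \<epsilon>: "0 < \<epsilon> l" "\<epsilon> l * real l \<le> 1" for l
  proof -
    show "0 < \<epsilon> l" using n C by (simp add: \<epsilon>_def)
    have "1 * (real l) \<le> (16 * real n * (C + 1)) * (real l + 2)"
    proof (rule mult_mono)
      have "1 * 1 \<le> (16 * real n) * (C + 1)" using n C by (intro mult_mono) auto
      then show "1 \<le> 16 * real n * (C + 1)" by simp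
      then show "0 \<le> 16 * real n * (C + 1)" by simp
    qed auto
    moreover have "0 < 16 * real n * (C + 1) * (real l + 2)" using n C by simp
    ultimately show "\<epsilon> l * real l \<le> 1" unfolding \<epsilon>_def by (simp add: field_simps)
  qed
  obtain D :: "'a set" where D: "countable D" "\<And>X. open X \<Longrightarrow> X \<noteq> {} \<Longrightarrow> \<exists>d\<in>D. d \<in> X"
    using countable_dense_setE by blast
  define B where "B l d = {t. \<exists>v. (z has_vector_derivative v) (at t) \<and> norm v \<le> real l \<and> 1/2 \<le> \<bar>d \<bullet> v\<bar> \<and>
     (\<exists>u\<in>proximal_limits E (z t). norm (u - d) < \<epsilon> l / 2)}" for l d
  have "negligible (B l d)" for l d
  proof (rule negligible_porous[OF n])
    fix t assume "t \<in> B l d"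
    then obtain v where v: "(z has_vector_derivative v) (at t)" "norm v \<le> real l" "1/2 \<le> \<bar>d \<bullet> v\<bar>"
      unfolding B_def by blast
    show "\<exists>\<delta>>0. \<forall>q h. t < q \<and> q - t < \<delta> \<and> h = (q - t) / (2 * real n) \<longrightarrow>
      (\<exists>j<n. B l d \<inter> {t + 2 * real j * h<..<t + 2 * real j * h + h} = {})"
    proof (rule sard_hole[OF n C sard _ \<epsilon>_def[of l] v])
      show "\<And>t. t \<in> B l d \<Longrightarrow> \<exists>u\<in>proximal_limits E (z t). norm (u - d) < \<epsilon> l / 2"
        unfolding B_def by blast
    qed auto
  qed
  then have "negligible (\<Union>p\<in>UNIV \<times> D. B (fst p) (snd p))"
    using D(1) by (intro negligible_countable_Union) auto
  moreover have "{t. \<exists>v u. (z has_vector_derivative v) (at t) \<and> u \<in> proximal_limits E (z t) \<and> u \<bullet> v \<noteq> 0}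
      \<subseteq> (\<Union>p\<in>UNIV \<times> D. B (fst p) (snd p))"
  proof clarify
    fix t v u assume A: "(z has_vector_derivative v) (at t)" "u \<in> proximal_limits E (z t)" "u \<bullet> v \<noteq> 0"
    define w where "w = (1 / \<bar>u \<bullet> v\<bar>) *\<^sub>R u"
    have w: "w \<in> proximal_limits E (z t)" "\<bar>w \<bullet> v\<bar> = 1"
      using A proximal_limits_scaleR[OF A(2), of "1 / \<bar>u \<bullet> v\<bar>"] by (auto simp: w_def abs_mult)
    obtain l where l: "norm v \<le> real l" using real_arch_simple by blast
    obtain d where d: "d \<in> D" "d \<in> ball w (\<epsilon> l / 2)" using D(2)[of "ball w (\<epsilon> l / 2)"] \<epsilon>(1)[of l] by auto
    then have dw: "norm (w - d) < \<epsilon> l / 2" by (simp add: dist_norm)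
    have "\<bar>(w - d) \<bullet> v\<bar> \<le> norm (w - d) * norm v" by (rule Cauchy_Schwarz_ineq2)
    also have "\<dots> \<le> (\<epsilon> l / 2) * real l" using dw l \<epsilon>(1)[of l] by (intro mult_mono) auto
    also have "\<dots> \<le> 1/2" using \<epsilon>(2)[of l] by simp
    finally have "\<bar>w \<bullet> v - d \<bullet> v\<bar> \<le> 1/2" by (simp add: inner_diff_left)
    then have "1/2 \<le> \<bar>d \<bullet> v\<bar>" using w(2) by linarith
    then have "t \<in> B l d" unfolding B_def using A(1) l w(1) dw by blast
    then show "t \<in> (\<Union>p\<in>UNIV \<times> D. B (fst p) (snd p))" using d(1) by force
  qed
  ultimately show ?thesis by (rule negligible_subset)
qed

section \<open>Differentiability of monotone functions\<close>

text \<open>The interval with the largest left endpoint is removed. By disjointness all others end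
  before it starts, so the induction hypothesis applies to them on \<open>{p..c m}\<close>.\<close>

lemma sum_increments_le:
  fixes g :: "real \<Rightarrow> real" and c d :: "'i \<Rightarrow> real"
  assumes "finite F" "\<And>i. i \<in> F \<Longrightarrow> c i \<le> d i \<and> {c i..d i} \<subseteq> {p..q}"
    and "pairwise (\<lambda>i j. disjnt {c i..d i} {c j..d j}) F" and "mono_on {p..q} g" "p \<le> q"
  shows "(\<Sum>i\<in>F. g (d i) - g (c i)) \<le> g q - g p"
  using assms
proof (induction "card F" arbitrary: F q rule: less_induct)
  case (less F q)
  show ?case
  proof (cases "F = {}")
    case True
    then show ?thesis using less.prems(4,5) by (simp add: mono_onD)
  next
    case False
    obtain m where m: "m \<in> F" "\<And>i. i \<in> F \<Longrightarrow> c i \<le> c m"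
      using ex_is_arg_min_if_finite[OF less.prems(1) False, of "\<lambda>i. - c i"]
      by (auto simp: is_arg_min_linorder)
    have cd: "c m \<le> d m" "p \<le> c m" "d m \<le> q" using less.prems(2)[OF m(1)] by auto
    have "(\<Sum>i\<in>F - {m}. g (d i) - g (c i)) \<le> g (c m) - g p"
    proof (rule less.hyps)
      show "card (F - {m}) < card F" using m(1) less.prems(1) by (simp add: card_gt_0_iff False)
      fix i assume i: "i \<in> F - {m}"
      have "disjnt {c i..d i} {c m..d m}" using less.prems(3) i m(1) unfolding pairwise_def by blast
      then have "c m \<notin> {c i..d i}" using cd(1) unfolding disjnt_def by auto
      then have "d i < c m" using m(2)[of i] i by auto
      then show "c i \<le> d i \<and> {c i..d i} \<subseteq> {p..c m}" using less.prems(2)[of i] i by auto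
    next
      show "pairwise (\<lambda>i j. disjnt {c i..d i} {c j..d j}) (F - {m})"
        using less.prems(3) by (rule pairwise_subset) blast
      show "mono_on {p..c m} g" using less.prems(4) by (rule mono_on_subset) (use cd in auto)
    qed (use less.prems(1) cd in auto)
    moreover have "g (d m) \<le> g q" using less.prems(4) cd by (auto intro: mono_onD)
    ultimately show ?thesis
      using sum.remove[OF less.prems(1) m(1), of "\<lambda>i. g (d i) - g (c i)"] by linarith
  qed
qed

text \<open>Disjoint short intervals of mean slope at least \<open>\<alpha>\<close> cover almost all
  of the set, and the sum of their increments cannot exceed \<open>g q - g p\<close>.\<close>

lemma steep_cover:
  fixes g :: "real \<Rightarrow> real"
  assumes g: "mono_on {p..q} g" "p \<le> q" and \<alpha>: "0 < \<alpha>"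
    and steep: "\<And>t \<delta>. t \<in> S \<Longrightarrow> 0 < \<delta> \<Longrightarrow> \<exists>c d. \<alpha> * (d - c) \<le> g d - g c \<and> c < d \<and> t \<in> {c..d} \<and> d - c < \<delta>"
  shows "outer_measure_le (S \<inter> {p..q}) ((g q - g p) / \<alpha>)"
proof -
  let ?S = "S \<inter> {p<..<q}"
  have vit: "\<exists>c d. (\<alpha> * (d - c) \<le> g d - g c \<and> {c..d} \<subseteq> {p..q}) \<and> c < d \<and> t \<in> {c..d} \<and> d - c < \<delta>"
    if t: "t \<in> ?S" and "0 < \<delta>" for t \<delta>
  proof -
    have "t \<in> S" "0 < min \<delta> (min (t - p) (q - t))" using that by auto
    from steep[OF this]
    obtain c d where "\<alpha> * (d - c) \<le> g d - g c" "c < d" "t \<in> {c..d}" "d - c < min \<delta> (min (t - p) (q - t))"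
      by (elim exE conjE)
    then show ?thesis by (intro exI[of _ c] exI[of _ d]) auto
  qed
  have "\<exists>C. countable C \<and> (\<forall>(c, d)\<in>C. (\<alpha> * (d - c) \<le> g d - g c \<and> {c..d} \<subseteq> {p..q}) \<and> c < d) \<and>
    pairwise (\<lambda>i j. disjnt {fst i..snd i} {fst j..snd j}) C \<and>
    negligible (?S - (\<Union>i\<in>C. {fst i..snd i}))"
    by (rule Vitali_intervals) (rule vit)
  then obtain C where C: "countable C" "\<forall>(c, d)\<in>C. (\<alpha> * (d - c) \<le> g d - g c \<and> {c..d} \<subseteq> {p..q}) \<and> c < d"
    "pairwise (\<lambda>i j. disjnt {fst i..snd i} {fst j..snd j}) C"
    "negligible (?S - (\<Union>i\<in>C. {fst i..snd i}))"
    by (elim exE conjE)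
  have Ci: "\<alpha> * (snd i - fst i) \<le> g (snd i) - g (fst i)" "{fst i..snd i} \<subseteq> {p..q}" "fst i \<le> snd i"
    if "i \<in> C" for i using C(2) that by (auto simp: split_beta)
  have "outer_measure_le (\<Union>i\<in>C. {fst i..snd i}) ((g q - g p) / \<alpha>)"
  proof (rule outer_measure_le_UN[OF C(1)])
    show "outer_measure_le {fst i..snd i} (snd i - fst i)" if "i \<in> C" for i
      unfolding outer_measure_le_def using Ci(3)[OF that] lmeasurable_cbox[of "fst i" "snd i"]
      by (intro exI[of _ "{fst i..snd i}"]) simp
    fix F assume F: "finite F" "F \<subseteq> C"
    have "\<alpha> * (\<Sum>i\<in>F. snd i - fst i) \<le> (\<Sum>i\<in>F. g (snd i) - g (fst i))"
      unfolding sum_distrib_left using Ci(1) F(2) by (intro sum_mono) auto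
    also have "\<dots> \<le> g q - g p"
    proof (rule sum_increments_le[where c=fst and d=snd, OF F(1) _ pairwise_subset[OF C(3) F(2)] g])
      show "fst i \<le> snd i \<and> {fst i..snd i} \<subseteq> {p..q}" if "i \<in> F" for i
        using Ci(2,3)[of i] that F(2) by blast
    qed
    finally show "(\<Sum>i\<in>F. snd i - fst i) \<le> (g q - g p) / \<alpha>" using \<alpha> by (simp add: field_simps)
  qed
  from outer_measure_le_Un_negligible[OF outer_measure_le_Un_negligible[OF this C(4)], of "{p, q}"]
  show ?thesis by (rule outer_measure_le_mono) auto
qed

lemma frequently_slope_interval:
  fixes g :: "real \<Rightarrow> real"
  assumes "\<exists>\<^sub>F s in at t. Q ((g s - g t) / (s - t))" "0 < \<delta>"
  shows "\<exists>c d. Q ((g d - g c) / (d - c)) \<and> c < d \<and> t \<in> {c..d} \<and> d - c < \<delta>"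
proof -
  have "eventually (\<lambda>s. s \<noteq> t \<and> dist s t < \<delta>) (at t)"
    using assms(2) by (auto simp: eventually_at)
  then have "\<exists>\<^sub>F s in at t. Q ((g s - g t) / (s - t)) \<and> (s \<noteq> t \<and> dist s t < \<delta>)"
    by (rule frequently_eventually_frequently[OF assms(1)])
  then obtain s where s: "Q ((g s - g t) / (s - t))" "s \<noteq> t" "dist s t < \<delta>" by (auto dest: frequently_ex)
  show ?thesis
  proof (cases "t < s")
    case True
    then show ?thesis using s by (intro exI[of _ t] exI[of _ s]) (auto simp: dist_real_def)
  next
    case False
    have "(g s - g t) / (s - t) = (g t - g s) / (t - s)" by (metis minus_diff_eq minus_divide_divide)
    then show ?thesis using s False by (intro exI[of _ s] exI[of _ t]) (auto simp: dist_real_def)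
  qed
qed

text \<open>Lebesgue's theorem. In a short interval of mean slope at most \<open>\<beta>\<close>,
  the points with difference quotients frequently at least \<open>\<alpha>\<close> fill at most the
  fraction \<open>\<beta> / \<alpha>\<close>, so the set where both bounds occur is null. Infinite
  slopes are excluded by the same covering estimate.\<close>

theorem mono_on_differentiable_ae:
  fixes g :: "real \<Rightarrow> real"
  assumes g: "mono_on {a<..<b} g"
  shows "negligible {t \<in> {a<..<b}. \<nexists>D. (g has_real_derivative D) (at t)}"
proof -
  define \<phi> where "\<phi> t s = (g s - g t) / (s - t)" for t s
  define E where "E \<alpha> \<beta> = {t \<in> {a<..<b}. (\<exists>\<^sub>F s in at t. \<alpha> \<le> \<phi> t s) \<and> (\<exists>\<^sub>F s in at t. \<phi> t s \<le> \<beta>)}" for \<alpha> \<beta>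
  define I where "I = {t \<in> {a<..<b}. \<forall>n::nat. \<exists>\<^sub>F s in at t. real n \<le> \<phi> t s}"
  have steep: "\<exists>c d. \<alpha> * (d - c) \<le> g d - g c \<and> c < d \<and> t \<in> {c..d} \<and> d - c < \<delta>"
    if sl: "\<exists>\<^sub>F s in at t. \<alpha> \<le> \<phi> t s" "0 < \<delta>" for \<alpha> t \<delta>
  proof -
    obtain c d where "\<alpha> \<le> (g d - g c) / (d - c)" "c < d" "t \<in> {c..d}" "d - c < \<delta>"
      using frequently_slope_interval[where t=t and Q="\<lambda>y. \<alpha> \<le> y" and g=g and \<delta>=\<delta>, OF sl(1)[unfolded \<phi>_def] sl(2)]
      by (elim exE conjE)
    then show ?thesis by (intro exI[of _ c] exI[of _ d]) (simp add: pos_le_divide_eq)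
  qed
  have flat: "\<exists>c d. g d - g c \<le> \<beta> * (d - c) \<and> c < d \<and> t \<in> {c..d} \<and> d - c < \<delta>"
    if sl: "\<exists>\<^sub>F s in at t. \<phi> t s \<le> \<beta>" "0 < \<delta>" for \<beta> t \<delta>
  proof -
    obtain c d where "(g d - g c) / (d - c) \<le> \<beta>" "c < d" "t \<in> {c..d}" "d - c < \<delta>"
      using frequently_slope_interval[where t=t and Q="\<lambda>y. y \<le> \<beta>" and g=g and \<delta>=\<delta>, OF sl(1)[unfolded \<phi>_def] sl(2)]
      by (elim exE conjE)
    then show ?thesis by (intro exI[of _ c] exI[of _ d]) (simp add: pos_divide_le_eq)
  qed
  have inside: "{p..q} \<subseteq> {a<..<b}" if "t \<in> {p..q}" "q - p < min (t - a) (b - t)" for t p q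
    using that by auto
  have negE: "negligible (E \<alpha> \<beta>)" if ab: "0 \<le> \<beta>" "\<beta> < \<alpha>" for \<alpha> \<beta>
  proof (rule negligible_if_relative_covers)
    show "0 \<le> \<beta> / \<alpha>" "\<beta> / \<alpha> < 1" using ab by auto
    fix t \<delta> :: real assume t: "t \<in> E \<alpha> \<beta>" "0 < \<delta>"
    then have "0 < min \<delta> (min (t - a) (b - t))" by (simp add: E_def)
    then obtain c d where cd: "g d - g c \<le> \<beta> * (d - c)" "c < d" "t \<in> {c..d}" "d - c < min \<delta> (min (t - a) (b - t))"
      using flat[of t \<beta>] t(1) unfolding E_def by blast
    have "mono_on {c..d} g" using g inside[OF cd(3)] cd(4) by (intro mono_on_subset[OF g]) auto
    then have "outer_measure_le (E \<alpha> \<beta> \<inter> {c..d}) ((g d - g c) / \<alpha>)"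
      using cd(2) ab steep by (intro steep_cover) (auto simp: E_def)
    moreover have "(g d - g c) / \<alpha> \<le> \<beta> / \<alpha> * (d - c)"
      using divide_right_mono[OF cd(1), of \<alpha>] ab by simp
    ultimately have "outer_measure_le (E \<alpha> \<beta> \<inter> {c..d}) (\<beta> / \<alpha> * (d - c))"
      by (rule outer_measure_le_mono[OF _ order_refl])
    then show "\<exists>p q. outer_measure_le (E \<alpha> \<beta> \<inter> {p..q}) (\<beta> / \<alpha> * (q - p)) \<and> p < q \<and> t \<in> {p..q} \<and> q - p < \<delta>"
      using cd by (intro exI[of _ c] exI[of _ d]) auto
  qed
  have negI: "negligible I"
  proof (rule negligible_if_relative_covers)
    fix t \<delta> :: real assume t: "t \<in> I" "0 < \<delta>"
    define q where "q = t + min \<delta> (min (t - a) (b - t)) / 2"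
    have q: "t < q" "q - t < min \<delta> (min (t - a) (b - t))" using t by (auto simp: q_def I_def min_def)
    have mono: "mono_on {t..q} g" using q inside[of t t q] by (intro mono_on_subset[OF g]) auto
    obtain n :: nat where n: "2 * (g q - g t) / (q - t) < real n" using reals_Archimedean2 by blast
    have "outer_measure_le (I \<inter> {t..q}) ((g q - g t) / real (Suc n))"
      using q(1) steep by (intro steep_cover[OF mono]) (auto simp: I_def simp del: of_nat_Suc)
    moreover have "(g q - g t) / real (Suc n) \<le> 1/2 * (q - t)"
      using n q(1) by (simp add: field_simps)
    ultimately have "outer_measure_le (I \<inter> {t..q}) (1/2 * (q - t))"
      by (rule outer_measure_le_mono[OF _ order_refl])
    then show "\<exists>p q. outer_measure_le (I \<inter> {p..q}) (1/2 * (q - p)) \<and> p < q \<and> t \<in> {p..q} \<and> q - p < \<delta>"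
      using q by (intro exI[of _ t] exI[of _ q]) auto
  qed auto
  have "\<exists>D. (g has_real_derivative D) (at t)"
    if t: "t \<in> {a<..<b}" "t \<notin> I" "\<And>\<alpha> \<beta>. \<alpha> \<in> \<rat> \<Longrightarrow> \<beta> \<in> \<rat> \<Longrightarrow> 0 \<le> \<beta> \<Longrightarrow> \<beta> < \<alpha> \<Longrightarrow> t \<notin> E \<alpha> \<beta>" for t
  proof -
    have ev0: "eventually (\<lambda>s. 0 \<le> \<phi> t s) (at t)"
    proof -
      have "eventually (\<lambda>s. s \<in> {a<..<b}) (at t)"
        using t(1) by (intro eventually_at_in_open') auto
      then show ?thesis
      proof eventually_elim
        case (elim s)
        then show ?case
          using mono_onD[OF g, of s t] mono_onD[OF g, of t s] t(1) unfolding \<phi>_def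
          by (cases s t rule: linorder_cases) (auto intro: divide_nonneg_nonneg divide_nonpos_nonpos)
      qed
    qed
    \<comment> \<open>The supremum of \<open>A\<close> is the upper derivative. If the quotients
      were frequently at most some \<open>y < D\<close>, rationals between \<open>y\<close> and
      \<open>D\<close> would place \<open>t\<close> in one of the sets
      \<open>E \<alpha> \<beta>\<close>.\<close>
    define A where "A = {\<alpha>. \<exists>\<^sub>F s in at t. \<alpha> \<le> \<phi> t s}"
    obtain n :: nat where n: "\<not> (\<exists>\<^sub>F s in at t. real n \<le> \<phi> t s)" using t(1,2) by (auto simp: I_def)
    have bdd: "bdd_above A"
    proof (rule bdd_aboveI[of _ "real n"])
      fix \<alpha> assume "\<alpha> \<in> A"
      then show "\<alpha> \<le> real n"
        using n frequently_elim1[of "\<lambda>s. \<alpha> \<le> \<phi> t s" "at t" "\<lambda>s. real n \<le> \<phi> t s"] unfolding A_def by fastforce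
    qed
    have zA: "0 \<in> A" unfolding A_def using ev0 by (auto intro: eventually_frequently)
    define D where "D = Sup A"
    have "(\<phi> t \<longlongrightarrow> D) (at t)"
    proof (rule order_tendstoI)
      fix y assume "D < y"
      then have "y \<notin> A" using cSup_upper[OF _ bdd] unfolding D_def by (meson leD)
      then show "eventually (\<lambda>s. \<phi> t s < y) (at t)" unfolding A_def not_frequently by (simp add: not_le frequently_def)
    next
      fix y assume y: "y < D"
      show "eventually (\<lambda>s. y < \<phi> t s) (at t)"
      proof (cases "y < 0")
        case True
        then show ?thesis using ev0 by (auto elim: eventually_mono)
      next
        case False
        obtain \<alpha>' where \<alpha>': "\<alpha>' \<in> A" "y < \<alpha>'" using y less_cSup_iff[of A y] zA bdd unfolding D_def by blast
        obtain \<beta> where \<beta>: "\<beta> \<in> \<rat>" "y < \<beta>" "\<beta> < \<alpha>'" using Rats_dense_in_real[OF \<alpha>'(2)] by blast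
        obtain \<alpha> where \<alpha>: "\<alpha> \<in> \<rat>" "\<beta> < \<alpha>" "\<alpha> < \<alpha>'" using Rats_dense_in_real[OF \<beta>(3)] by blast
        have "\<exists>\<^sub>F s in at t. \<alpha> \<le> \<phi> t s"
          using \<alpha>'(1) \<alpha>(3) unfolding A_def by (auto elim!: frequently_elim1)
        then have "\<not> (\<exists>\<^sub>F s in at t. \<phi> t s \<le> \<beta>)"
          using t(3)[OF \<alpha>(1) \<beta>(1)] \<alpha>(2) \<beta>(2) False t(1) by (auto simp: E_def)
        then have "eventually (\<lambda>s. \<beta> < \<phi> t s) (at t)" by (simp add: frequently_def not_le)
        then show ?thesis using \<beta>(2) by (auto elim: eventually_mono)
      qed
    qed
    then have "(g has_real_derivative D) (at t)"
      unfolding has_field_derivative_iff \<phi>_def .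
    then show ?thesis by blast
  qed
  note diff = this
  have "{t \<in> {a<..<b}. \<nexists>D. (g has_real_derivative D) (at t)} \<subseteq>
      I \<union> (\<Union>r\<in>{r \<in> \<rat> \<times> \<rat>. 0 \<le> snd r \<and> snd r < fst r}. E (fst r) (snd r))"
  proof (rule subsetI, rule ccontr)
    fix t assume t: "t \<in> {t \<in> {a<..<b}. \<nexists>D. (g has_real_derivative D) (at t)}"
      "t \<notin> I \<union> (\<Union>r\<in>{r \<in> \<rat> \<times> \<rat>. 0 \<le> snd r \<and> snd r < fst r}. E (fst r) (snd r))"
    have "t \<notin> E \<alpha> \<beta>" if "\<alpha> \<in> \<rat>" "\<beta> \<in> \<rat>" "0 \<le> \<beta>" "\<beta> < \<alpha>" for \<alpha> \<beta>
      using t(2) that by (auto dest!: bspec[of _ _ "(\<alpha>, \<beta>)"])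
    then have "\<exists>D. (g has_real_derivative D) (at t)" using t by (intro diff) auto
    then show False using t(1) by blast
  qed
  moreover have "negligible (I \<union> (\<Union>r\<in>{r \<in> \<rat> \<times> \<rat>. 0 \<le> snd r \<and> snd r < fst r}. E (fst r) (snd r)))"
  proof (intro negligible_Un negI negligible_countable_Union)
    have "countable (\<rat> \<times> \<rat> :: (real \<times> real) set)" by (simp add: countable_rat)
    then show "countable ((\<lambda>r. E (fst r) (snd r)) ` {r \<in> \<rat> \<times> \<rat>. 0 \<le> snd r \<and> snd r < fst r})"
      by (intro countable_image) (auto intro: countable_subset)
  qed (auto intro: negE)
  ultimately show ?thesis using negligible_subset by blast
qed

section \<open>Slopes and subdifferentials\<close>

lemma lower_semicontinuous_eventually:
  assumes "lower_semicontinuous f" "y < f x" shows "eventually (\<lambda>z. y < f z) (nhds x)"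
proof -
  have "eventually (\<lambda>z. y < f z) (at x)"
    using assms unfolding lower_semicontinuous_def le_Liminf_iff by blast
  then show ?thesis using assms(2) by (auto simp: eventually_at_filter elim: eventually_mono)
qed

lemma closed_epigraph:
  fixes f :: "'a::euclidean_space \<Rightarrow> ereal"
  assumes "lower_semicontinuous f" shows "closed (epigraph f)"
  unfolding closed_sequential_limits
proof clarify
  fix S x and r :: real assume S: "\<forall>n. S n \<in> epigraph f" "S \<longlonglongrightarrow> (x, r)"
  show "(x, r) \<in> epigraph f"
  proof (rule ccontr)
    assume "(x, r) \<notin> epigraph f"
    then have "ereal r < f x" by (simp add: epigraph_def not_le)
    then obtain y where y: "ereal r < ereal y" "ereal y < f x" using ereal_dense2 by blast
    have "eventually (\<lambda>n. ereal y < f (fst (S n))) sequentially"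
      using eventually_compose_filterlim[OF lower_semicontinuous_eventually[OF assms y(2)]] tendsto_fst[OF S(2)]
      by simp
    moreover have "eventually (\<lambda>n. snd (S n) < y) sequentially"
      using tendsto_snd[OF S(2)] y(1) by (auto intro: order_tendstoD)
    ultimately have "eventually (\<lambda>n. False) sequentially"
    proof eventually_elim
      case (elim n)
      have "f (fst (S n)) \<le> ereal (snd (S n))" using S(1) by (auto simp: epigraph_def split_beta)
      also have "\<dots> < ereal y" using elim(2) by simp
      finally show ?case using elim(1) by simp
    qed
    then show False by simp
  qed
qed

text \<open>Finiteness of \<open>f y\<close> is a separate conjunct because
  \<open>real_of_ereal\<close> maps infinite values to 0, which could be close to the value at
  \<open>x\<close>.\<close>

definition graph_near :: "('a::real_normed_vector \<Rightarrow> ereal) \<Rightarrow> 'a \<Rightarrow> real \<Rightarrow> 'a \<Rightarrow> bool" where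
  "graph_near f x e y \<longleftrightarrow> norm (y - x) < e \<and> \<bar>f y\<bar> \<noteq> \<infinity> \<and> \<bar>real_of_ereal (f y) - real_of_ereal (f x)\<bar> < e"

lemma graph_near_mono: "graph_near f x e y \<Longrightarrow> e \<le> e' \<Longrightarrow> graph_near f x e' y"
  by (auto simp: graph_near_def)

lemma eventually_graph_filter:
  fixes f :: "'a::real_normed_vector \<Rightarrow> ereal"
  assumes fin: "\<bar>f x\<bar> \<noteq> \<infinity>"
  shows "eventually P (filtercomap (\<lambda>y. (y, f y)) (nhds (x, f x))) \<longleftrightarrow> (\<exists>e>0. \<forall>y. graph_near f x e y \<longrightarrow> P y)"
proof
  assume "eventually P (filtercomap (\<lambda>y. (y, f y)) (nhds (x, f x)))"
  then obtain S where S: "open S" "(x, f x) \<in> S" "\<And>y. (y, f y) \<in> S \<Longrightarrow> P y"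
    unfolding eventually_filtercomap_nhds by blast
  obtain A B where AB: "open A" "open B" "x \<in> A" "f x \<in> B" "A \<times> B \<subseteq> S"
    using open_prod_elim[OF S(1,2)] by (metis mem_Sigma_iff)
  obtain e1 where e1: "0 < e1" "ball x e1 \<subseteq> A" using AB(1,3) open_contains_ball by blast
  obtain F where F: "f x = ereal F" using fin by auto
  have "open (ereal -` B)" "F \<in> ereal -` B" using AB(2,4) F by (auto intro: open_ereal_vimage)
  then obtain e2 where e2: "0 < e2" "ball F e2 \<subseteq> ereal -` B" using open_contains_ball by blast
  show "\<exists>e>0. \<forall>y. graph_near f x e y \<longrightarrow> P y"
  proof (intro exI[of _ "min e1 e2"] conjI allI impI)
    fix y assume y: "graph_near f x (min e1 e2) y"
    then have "y \<in> A" using e1(2) by (auto simp: graph_near_def dist_norm norm_minus_commute)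
    moreover have "f y \<in> B"
    proof -
      obtain G where G: "f y = ereal G" using y by (auto simp: graph_near_def)
      then have "G \<in> ball F e2" using y F by (simp add: graph_near_def dist_real_def abs_minus_commute)
      then show ?thesis using G e2(2) by auto
    qed
    ultimately show "P y" using S(3) AB(5) by blast
  qed (use e1 e2 in auto)
next
  assume "\<exists>e>0. \<forall>y. graph_near f x e y \<longrightarrow> P y"
  then obtain e where e: "0 < e" "\<And>y. graph_near f x e y \<Longrightarrow> P y" by blast
  obtain F where F: "f x = ereal F" using fin by auto
  show "eventually P (filtercomap (\<lambda>y. (y, f y)) (nhds (x, f x)))"
    unfolding eventually_filtercomap_nhds
  proof (intro exI[of _ "ball x e \<times> {ereal (F - e)<..<ereal (F + e)}"] conjI allI impI)
    fix y assume y: "(y, f y) \<in> ball x e \<times> {ereal (F - e)<..<ereal (F + e)}"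
    then obtain G where "f y = ereal G" by (cases "f y") auto
    then show "P y" using y F by (intro e(2)) (auto simp: graph_near_def dist_norm norm_minus_commute abs_less_iff)
  qed (use e F in \<open>auto intro: open_Times\<close>)
qed

lemma graph_tendsto_iff:
  fixes f :: "'a::real_normed_vector \<Rightarrow> ereal" and X :: "nat \<Rightarrow> 'a"
  assumes "\<bar>f x\<bar> \<noteq> \<infinity>"
  shows "(\<lambda>i. (X i, f (X i))) \<longlonglongrightarrow> (x, f x) \<longleftrightarrow> (\<forall>e>0. eventually (\<lambda>i. graph_near f x e (X i)) sequentially)"
proof -
  have "(\<lambda>i. (X i, f (X i))) \<longlonglongrightarrow> (x, f x) \<longleftrightarrow> filterlim X (filtercomap (\<lambda>y. (y, f y)) (nhds (x, f x))) sequentially"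
    by (simp add: filterlim_filtercomap_iff o_def)
  also have "\<dots> \<longleftrightarrow> (\<forall>e>0. eventually (\<lambda>i. graph_near f x e (X i)) sequentially)"
    unfolding filterlim_iff eventually_graph_filter[where f=f, OF assms]
    by (blast intro: eventually_mono)
  finally show ?thesis .
qed

lemma frechet_subdifferential_finite: "w \<in> frechet_subdifferential f y \<Longrightarrow> \<bar>f y\<bar> \<noteq> \<infinity>"
  by (simp add: frechet_subdifferential_def)

lemma triple_tendsto_iff:
  "(\<lambda>i. (X i, g i, V i)) \<longlonglongrightarrow> (x, c, v) \<longleftrightarrow> (\<lambda>i. (X i, g i)) \<longlonglongrightarrow> (x, c) \<and> V \<longlonglongrightarrow> v"
proof
  assume A: "(\<lambda>i. (X i, g i, V i)) \<longlonglongrightarrow> (x, c, v)"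
  have "X \<longlonglongrightarrow> x" "g \<longlonglongrightarrow> c" "V \<longlonglongrightarrow> v"
    using tendsto_fst[OF A] tendsto_fst[OF tendsto_snd[OF A]] tendsto_snd[OF tendsto_snd[OF A]] by simp_all
  then show "(\<lambda>i. (X i, g i)) \<longlonglongrightarrow> (x, c) \<and> V \<longlonglongrightarrow> v" by (auto intro: tendsto_Pair)
next
  assume A: "(\<lambda>i. (X i, g i)) \<longlonglongrightarrow> (x, c) \<and> V \<longlonglongrightarrow> v"
  then show "(\<lambda>i. (X i, g i, V i)) \<longlonglongrightarrow> (x, c, v)"
    using tendsto_fst[OF conjunct1[OF A]] tendsto_snd[OF conjunct1[OF A]] by (auto intro!: tendsto_Pair)
qed

lemma limiting_subdifferential_iff:
  fixes f :: "'a::real_inner \<Rightarrow> ereal"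
  assumes fin: "\<bar>f x\<bar> \<noteq> \<infinity>"
  shows "v \<in> limiting_subdifferential f x \<longleftrightarrow>
    (\<forall>e>0. \<exists>y. graph_near f x e y \<and> (\<exists>w\<in>frechet_subdifferential f y. norm (w - v) < e))"
proof
  assume "v \<in> limiting_subdifferential f x"
  then obtain X V where X: "\<And>i. V i \<in> frechet_subdifferential f (X i)"
    "(\<lambda>i::nat. (X i, f (X i), V i)) \<longlonglongrightarrow> (x, f x, v)"
    unfolding limiting_subdifferential_def by blast
  show "\<forall>e>0. \<exists>y. graph_near f x e y \<and> (\<exists>w\<in>frechet_subdifferential f y. norm (w - v) < e)"
  proof (intro allI impI)
    fix e :: real assume e: "0 < e"
    have "eventually (\<lambda>i. graph_near f x e (X i)) sequentially"
      using X(2) e unfolding triple_tendsto_iff graph_tendsto_iff[where f=f, OF fin] by blast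
    moreover have "eventually (\<lambda>i. norm (V i - v) < e) sequentially"
      using X(2) e unfolding triple_tendsto_iff by (auto dest: tendstoD simp: dist_norm)
    ultimately have "eventually (\<lambda>i. graph_near f x e (X i) \<and> norm (V i - v) < e) sequentially"
      by (rule eventually_conj)
    then obtain i where "graph_near f x e (X i)" "norm (V i - v) < e" by (auto simp: eventually_sequentially)
    then show "\<exists>y. graph_near f x e y \<and> (\<exists>w\<in>frechet_subdifferential f y. norm (w - v) < e)"
      using X(1) by blast
  qed
next
  assume R: "\<forall>e>0. \<exists>y. graph_near f x e y \<and> (\<exists>w\<in>frechet_subdifferential f y. norm (w - v) < e)"
  have "\<exists>y w. graph_near f x (1 / real (Suc i)) y \<and> w \<in> frechet_subdifferential f y \<and> norm (w - v) < 1 / real (Suc i)" for i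
    using R[rule_format, of "1 / real (Suc i)"] by auto
  then obtain X V where X: "\<And>i. graph_near f x (1 / real (Suc i)) (X i)" "\<And>i. V i \<in> frechet_subdifferential f (X i)"
    "\<And>i. norm (V i - v) < 1 / real (Suc i)" by metis
  have ev: "eventually (\<lambda>i. 1 / real (Suc i) < e) sequentially" if "0 < e" for e
    using order_tendstoD(2)[OF LIMSEQ_inverse_real_of_nat that] by (simp add: inverse_eq_divide)
  have "(\<lambda>i. (X i, f (X i))) \<longlonglongrightarrow> (x, f x)"
    unfolding graph_tendsto_iff[where f=f, OF fin]
  proof (intro allI impI)
    fix e :: real assume "0 < e"
    from ev[OF this] show "eventually (\<lambda>i. graph_near f x e (X i)) sequentially"
      by eventually_elim (rule graph_near_mono[OF X(1)], simp)
  qed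
  moreover have "V \<longlonglongrightarrow> v"
  proof (rule tendstoI)
    fix e :: real assume "0 < e"
    from ev[OF this] show "eventually (\<lambda>i. dist (V i) v < e) sequentially"
      by eventually_elim (metis X(3) dist_norm less_trans)
  qed
  ultimately have "(\<lambda>i. (X i, f (X i), V i)) \<longlonglongrightarrow> (x, f x, v)"
    unfolding triple_tendsto_iff by (rule conjI)
  then show "v \<in> limiting_subdifferential f x"
    unfolding limiting_subdifferential_def using fin X(2) by blast
qed

section \<open>Slopes and norms of subgradients\<close>

lemma slope_nonneg:
  fixes f :: "'a::euclidean_space \<Rightarrow> ereal"
  shows "0 \<le> slope f x"
  unfolding slope_def by (intro le_Limsup) (auto intro!: always_eventually zero_le_divide_ereal)

lemma limiting_slope_nonneg:
  fixes f :: "'a::euclidean_space \<Rightarrow> ereal"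
  shows "0 \<le> limiting_slope f x"
  unfolding limiting_slope_def by (intro Liminf_bounded always_eventually allI slope_nonneg)

lemma slope_less_imp_lower_bound:
  fixes f :: "'a::euclidean_space \<Rightarrow> ereal"
  assumes F: "f x = ereal F" and c: "slope f x < ereal c"
  shows "\<exists>\<rho>>0. \<forall>y\<in>ball x \<rho>. ereal (F - c * norm (y - x)) \<le> f y"
proof -
  have "eventually (\<lambda>y. max 0 (f x - f y) / ereal (norm (x - y)) < ereal c) (at x)"
    using Limsup_lessD[OF c[unfolded slope_def]] .
  then obtain \<rho> where \<rho>: "0 < \<rho>" "\<And>y. y \<noteq> x \<Longrightarrow> dist y x < \<rho> \<Longrightarrow> max 0 (f x - f y) / ereal (norm (x - y)) < ereal c"
    by (auto simp: eventually_at)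
  have "ereal (F - c * norm (y - x)) \<le> f y" if y: "y \<in> ball x \<rho>" for y
  proof (cases "y = x")
    case False
    then have n: "0 < norm (x - y)" by simp
    have q: "max 0 (f x - f y) / ereal (norm (x - y)) < ereal c"
      using \<rho>(2)[OF False] y by (simp add: dist_commute)
    show ?thesis
    proof (cases "f y")
      case (real G)
      have "max 0 (F - G) / norm (x - y) < c"
        using q n by (simp add: F real max_def zero_ereal_def split: if_splits)
      then have "max 0 (F - G) < c * norm (x - y)" using n by (simp add: divide_less_eq)
      then show ?thesis by (simp add: real norm_minus_commute)
    next
      case MInf
      then show ?thesis using q n by (simp add: F max_def)
    qed simp
  qed (simp add: F)
  then show ?thesis using \<rho>(1) by blast
qed

lemma slope_le_norm_frechet:
  fixes f :: "'a::euclidean_space \<Rightarrow> ereal"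
  assumes v: "v \<in> frechet_subdifferential f x" shows "slope f x \<le> ereal (norm v)"
proof (rule ereal_le_epsilon2)
  fix e :: real assume e: "0 < e"
  obtain F where F: "f x = ereal F" using frechet_subdifferential_finite[OF v] by auto
  obtain r where r: "r \<in> o[at x](\<lambda>y. norm (y - x))"
    "eventually (\<lambda>y. f y \<ge> f x + ereal (v \<bullet> (y - x)) + ereal (r y)) (at x)"
    using v unfolding frechet_subdifferential_def by blast
  have "eventually (\<lambda>y. norm (r y) \<le> e * norm (norm (y - x))) (at x)"
    using landau_o.smallD[OF r(1) e] .
  moreover have "eventually (\<lambda>y. y \<noteq> x) (at x)" by (simp add: eventually_at_filter)
  ultimately have "eventually (\<lambda>y. max 0 (f x - f y) / ereal (norm (x - y)) \<le> ereal (norm v) + ereal e) (at x)"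
    using r(2)
  proof eventually_elim
    case (elim y)
    have n: "0 < norm (x - y)" using elim(2) by simp
    have "\<bar>v \<bullet> (y - x)\<bar> \<le> norm v * norm (y - x)" by (rule Cauchy_Schwarz_ineq2)
    then have lower: "F - (norm v + e) * norm (x - y) \<le> F + v \<bullet> (y - x) + r y"
      using elim(1) by (simp add: norm_minus_commute algebra_simps abs_le_iff)
    show ?case
    proof (cases "f y")
      case (real G)
      then have "F + v \<bullet> (y - x) + r y \<le> G" using elim(3) by (simp add: F)
      then have "F - G \<le> (norm v + e) * norm (x - y)" using lower by linarith
      moreover have "0 \<le> (norm v + e) * norm (x - y)" using e by simp
      ultimately have "max 0 (F - G) / norm (x - y) \<le> norm v + e"
        using n by (simp add: divide_le_eq)
      then show ?thesis using n by (simp add: F real max_def zero_ereal_def split: if_splits)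
    next
      case PInf
      then show ?thesis using e by (simp add: F max_def)
    next
      case MInf
      then show ?thesis using elim(3) by (simp add: F)
    qed
  qed
  then show "slope f x \<le> ereal (norm v) + ereal e"
    unfolding slope_def by (rule Limsup_bounded)
qed

lemma limiting_slope_le_norm:
  fixes f :: "'a::euclidean_space \<Rightarrow> ereal"
  assumes v: "v \<in> limiting_subdifferential f x" shows "limiting_slope f x \<le> ereal (norm v)"
proof (rule ccontr)
  assume "\<not> ?thesis"
  then have "ereal (norm v) < limiting_slope f x" by simp
  then obtain c where c: "norm v < c" "ereal c < limiting_slope f x"
    using ereal_dense2 by (metis less_ereal.simps(1))
  have fin: "\<bar>f x\<bar> \<noteq> \<infinity>" using v by (simp add: limiting_subdifferential_def)
  obtain e where e: "0 < e" "\<And>y. graph_near f x e y \<Longrightarrow> ereal c < slope f y"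
    using less_LiminfD[OF c(2)[unfolded limiting_slope_def]] unfolding eventually_graph_filter[where f=f, OF fin] by blast
  define e' where "e' = min e (c - norm v)"
  have "0 < e'" using e(1) c(1) by (simp add: e'_def)
  then obtain y w where y: "graph_near f x e' y" "w \<in> frechet_subdifferential f y" "norm (w - v) < e'"
    using v unfolding limiting_subdifferential_iff[where f=f, OF fin] by blast
  have "graph_near f x e y" using y(1) by (rule graph_near_mono) (simp add: e'_def)
  then have "ereal c < slope f y" by (rule e(2))
  also have "\<dots> \<le> ereal (norm w)" by (rule slope_le_norm_frechet[OF y(2)])
  finally have "c < norm w" by simp
  moreover have "norm w \<le> norm v + norm (w - v)" using norm_triangle_ineq[of v "w - v"] by simp
  ultimately show False using y(3) by (simp add: e'_def)
qed

text \<open>Minimising \<open>f + c * sqrt (\<parallel>\<cdot> - x\<parallel>\<^sup>2 + \<delta>\<^sup>2)\<close> near \<open>x\<close>, a smooth perturbation of \<open>f + c * \<parallel>\<cdot> - x\<parallel>\<close>,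
  produces a Frechet subgradient of norm at most \<open>c\<close>.\<close>

lemma frechet_subgradient_near:
  fixes f :: "'a::euclidean_space \<Rightarrow> ereal"
  assumes lsc: "lower_semicontinuous f" and fin: "\<bar>f x\<bar> \<noteq> \<infinity>" and c: "slope f x < ereal c" and e: "0 < e"
  shows "\<exists>y. graph_near f x e y \<and> (\<exists>w\<in>frechet_subdifferential f y. norm w \<le> c)"
proof -
  obtain F where F: "f x = ereal F" using fin by auto
  \<comment> \<open>The margin \<open>c - c0\<close> is what confines the minimiser of the perturbed
    function to a neighbourhood of \<open>x\<close>.\<close>
  obtain c0 where c0: "slope f x < ereal c0" "ereal c0 < ereal c" using ereal_dense2[OF c] by blast
  have "ereal 0 < ereal c0"
    unfolding zero_ereal_def[symmetric] using slope_nonneg[of f x] c0(1) by (rule le_less_trans)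
  then have c0c: "0 < c0" "c0 < c" using c0(2) by auto
  obtain \<rho>0 where \<rho>0: "0 < \<rho>0" "\<And>y. y \<in> ball x \<rho>0 \<Longrightarrow> ereal (F - c0 * norm (y - x)) \<le> f y"
    using slope_less_imp_lower_bound[OF F c0(1)] by blast
  define \<rho> where "\<rho> = \<rho>0 / 2"
  have \<rho>: "0 < \<rho>" "\<And>y. y \<in> cball x \<rho> \<Longrightarrow> ereal (F - c0 * norm (y - x)) \<le> f y"
    using \<rho>0 by (auto simp: \<rho>_def)
  define m where "m = min (\<rho> / 2) (min (e / 2) (e / (2 * c0)))"
  have m: "0 < m" "m < \<rho>" "m < e" "c0 * m < e"
  proof -
    have "m \<le> e / (2 * c0)" "m \<le> e / 2" "m \<le> \<rho> / 2" by (auto simp: m_def)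
    then have "c0 * m \<le> e / 2" using c0c by (simp add: field_simps)
    then show "m < \<rho>" "m < e" "c0 * m < e" using \<open>m \<le> \<rho> / 2\<close> \<open>m \<le> e / 2\<close> \<rho> e by auto
    show "0 < m" using \<rho> e c0c by (simp add: m_def)
  qed
  \<comment> \<open>Comparing the minimum with the value at \<open>x\<close> gives
    \<open>(c - c0) * norm (y - x) \<le> c * \<delta>\<close>, which for this
    \<open>\<delta>\<close> reads \<open>norm (y - x) \<le> m\<close>.\<close>
  define \<delta> where "\<delta> = m * (c - c0) / c"
  have \<delta>: "0 < \<delta>" using m c0c by (simp add: \<delta>_def)
  define h where "h y = c * sqrt ((y - x) \<bullet> (y - x) + \<delta>\<^sup>2)" for y
  have hx: "h x = c * \<delta>" using \<delta> by (simp add: h_def)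
  have h_ge: "c * norm (y - x) \<le> h y" "c * \<delta> \<le> h y" for y
  proof -
    have "norm (y - x) \<le> sqrt ((y - x) \<bullet> (y - x) + \<delta>\<^sup>2)"
      by (intro real_le_rsqrt) (simp add: power2_norm_eq_inner)
    moreover have "\<delta> \<le> sqrt ((y - x) \<bullet> (y - x) + \<delta>\<^sup>2)"
      by (intro real_le_rsqrt) simp
    ultimately show "c * norm (y - x) \<le> h y" "c * \<delta> \<le> h y" using c0c by (auto simp: h_def)
  qed
  define lo where "lo = F - c0 * \<rho>"
  define hi where "hi = F + c * \<delta>"
  have contin_h: "continuous_on S h" for S unfolding h_def by (intro continuous_intros)
  \<comment> \<open>Minimising over a compact piece of the epigraph lets lower semicontinuity enter
    as closedness. The cut at \<open>hi\<close> loses nothing: \<open>hi\<close> is the perturbed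
    value at \<open>x\<close>, and \<open>h\<close> is nonnegative.\<close>
  let ?K = "epigraph f \<inter> (cball x \<rho> \<times> {lo..hi})"
  have "compact ?K"
    by (intro closed_Int_compact closed_epigraph lsc compact_Times compact_cball compact_Icc)
  moreover have xK: "(x, F) \<in> ?K"
    using F \<rho> \<delta> c0c by (auto simp: epigraph_def lo_def hi_def)
  moreover have "continuous_on ?K (\<lambda>p. snd p + h (fst p))"
    by (intro continuous_intros continuous_on_compose2[OF contin_h]) auto
  ultimately obtain p where p: "p \<in> ?K" "\<And>p'. p' \<in> ?K \<Longrightarrow> snd p + h (fst p) \<le> snd p' + h (fst p')"
    using continuous_attains_inf[of ?K "\<lambda>p. snd p + h (fst p)"] by blast
  obtain y s where ys: "p = (y, s)" by (cases p)
  have y: "f y \<le> ereal s" "y \<in> cball x \<rho>" "s \<le> hi" using p(1) by (auto simp: ys epigraph_def)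
  have lower: "ereal (F - c0 * norm (y - x)) \<le> f y" by (rule \<rho>(2)[OF y(2)])
  obtain G where G: "f y = ereal G"
    using lower y(1) by (cases "f y") auto
  have Gs: "G \<le> s" "F - c0 * norm (y - x) \<le> G" using y(1) lower by (simp_all add: G)
  have min1: "s + h y \<le> F + c * \<delta>" using p(2)[OF xK] by (simp add: ys hx)
  have "(c - c0) * norm (y - x) \<le> c * \<delta>"
    using Gs h_ge(1)[of y] min1 by (simp add: algebra_simps)
  also have "\<dots> = (c - c0) * m" using c0c by (simp add: \<delta>_def)
  finally have ym: "norm (y - x) \<le> m" using c0c by simp
  have "c0 * norm (y - x) \<le> c0 * m" using ym c0c by (intro mult_left_mono) auto
  moreover have "G \<le> F" using Gs(1) min1 h_ge(2)[of y] by linarith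
  ultimately have near: "graph_near f x e y"
    using ym m Gs by (auto simp: graph_near_def F G)
  \<comment> \<open>Minus the gradient of \<open>h\<close> at \<open>y\<close>, as Fermat's rule for
    the minimum of \<open>f + h\<close> prescribes.\<close>
  define w where "w = - (c / sqrt ((y - x) \<bullet> (y - x) + \<delta>\<^sup>2)) *\<^sub>R (y - x)"
  have pos: "0 < (y - x) \<bullet> (y - x) + \<delta>\<^sup>2" using \<delta> by (intro add_nonneg_pos) auto
  have wi: "v \<bullet> w = - (c / sqrt ((y - x) \<bullet> (y - x) + \<delta>\<^sup>2)) * (v \<bullet> (y - x))" for v
    unfolding w_def by (simp add: inner_commute)
  have hder: "(h has_derivative (\<lambda>v. - (w \<bullet> v))) (at y)"
    unfolding h_def
    by (rule derivative_eq_intros refl pos)+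
      (use pos in \<open>auto simp: wi fun_eq_iff inner_commute field_simps\<close>)
  define r where "r z = h y - h z - w \<bullet> (z - y)" for z
  have "r \<in> o[at y](\<lambda>z. norm (z - y))"
  proof (rule smalloI_tendsto)
    have "((\<lambda>z. (h z - h y - - (w \<bullet> (z - y))) /\<^sub>R norm (z - y)) \<longlongrightarrow> 0) (at y)"
      using hder unfolding has_derivative_at_within by (simp add: divide_inverse mult.commute)
    from tendsto_minus[OF this] show "((\<lambda>z. r z / norm (z - y)) \<longlongrightarrow> 0) (at y)"
      by (simp add: r_def divide_inverse algebra_simps)
    show "eventually (\<lambda>z. norm (z - y) \<noteq> 0) (at y)" by (simp add: eventually_at_filter)
  qed
  moreover have "eventually (\<lambda>z. f z \<ge> f y + ereal (w \<bullet> (z - y)) + ereal (r z)) (at y)"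
  proof -
    have "y \<in> ball x \<rho>" using ym m by (simp add: dist_norm norm_minus_commute)
    then have "eventually (\<lambda>z. z \<in> ball x \<rho>) (at y)" by (intro eventually_at_in_open') auto
    then show ?thesis
    proof eventually_elim
      case (elim z)
      then have z: "z \<in> cball x \<rho>" by simp
      have "c0 * norm (z - x) \<le> c0 * \<rho>" using z c0c by (intro mult_left_mono) (auto simp: dist_norm norm_minus_commute)
      then have lz: "ereal lo \<le> f z"
        using \<rho>(2)[OF z] by (auto simp: lo_def intro: order_trans[rotated])
      have "ereal (G + h y - h z) \<le> f z"
      proof (cases "f z")
        case (real H)
        show ?thesis
        proof (cases "H \<le> hi")
          case True
          then have "(z, H) \<in> ?K" using z lz real by (simp add: epigraph_def)
          then show ?thesis using p(2)[of "(z, H)"] Gs(1) real by (simp add: ys)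
        next
          case False
          have "0 \<le> h z" using h_ge(2)[of z] c0c \<delta> by (smt (verit) mult_pos_pos)
          then show ?thesis using False min1 Gs(1) real by (simp add: hi_def)
        qed
      next
        case MInf
        then show ?thesis using lz by simp
      qed simp
      then show ?case by (simp add: G r_def algebra_simps)
    qed
  qed
  ultimately have "w \<in> frechet_subdifferential f y"
    unfolding frechet_subdifferential_def using G by (auto intro!: exI[of _ r])
  moreover have "norm w \<le> c"
  proof -
    have "norm w = c * norm (y - x) / sqrt ((y - x) \<bullet> (y - x) + \<delta>\<^sup>2)"
      using pos c0c unfolding w_def norm_scaleR by simp
    also have "\<dots> \<le> c"
      using h_ge(1)[of y] pos by (simp add: h_def pos_divide_le_eq)
    finally show ?thesis .
  qed
  ultimately show ?thesis using near by blast
qed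

text \<open>Near \<open>x\<close> there are points of slope almost \<open>c\<close>, and near these
  Frechet subgradients of norm almost \<open>c\<close>. Compactness of balls yields a limit, so the
  bound is attained and not merely approached.\<close>

lemma limiting_subgradient_of_limiting_slope:
  fixes f :: "'a::euclidean_space \<Rightarrow> ereal"
  assumes lsc: "lower_semicontinuous f" and fin: "\<bar>f x\<bar> \<noteq> \<infinity>" and c: "limiting_slope f x \<le> ereal c"
  shows "\<exists>v\<in>limiting_subdifferential f x. norm v \<le> c"
proof -
  have "\<exists>y w. graph_near f x (1 / real (Suc i)) y \<and> w \<in> frechet_subdifferential f y \<and> norm w \<le> c + 1 / real (Suc i)" for i
  proof -
    define e where "e = 1 / (2 * real (Suc i))"
    have e: "0 < e" "2 * e = 1 / real (Suc i)" by (auto simp: e_def field_simps)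
    have "\<not> ereal (c + 2 * e) \<le> limiting_slope f x" using order_trans[OF _ c, of "ereal (c + 2 * e)"] e(1) by auto
    then have "\<not> eventually (\<lambda>y. ereal (c + 2 * e) \<le> slope f y) (filtercomap (\<lambda>y. (y, f y)) (nhds (x, f x)))"
      unfolding limiting_slope_def using Liminf_bounded by blast
    then obtain y where y: "graph_near f x e y" "slope f y < ereal (c + 2 * e)"
      unfolding eventually_graph_filter[where f=f, OF fin] using e(1) by (meson not_le)
    then have "\<bar>f y\<bar> \<noteq> \<infinity>" by (simp add: graph_near_def)
    from frechet_subgradient_near[OF lsc this y(2) e(1)]
    obtain z w where z: "graph_near f y e z" "w \<in> frechet_subdifferential f z" "norm w \<le> c + 2 * e" by blast
    have "norm (z - x) \<le> norm (z - y) + norm (y - x)" using norm_triangle_ineq[of "z - y" "y - x"] by simp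
    then have "graph_near f x (2 * e) z" using y(1) z(1) unfolding graph_near_def by linarith
    then show ?thesis using z e(2) by metis
  qed
  then obtain Y W where YW: "\<And>i. graph_near f x (1 / real (Suc i)) (Y i)" "\<And>i. W i \<in> frechet_subdifferential f (Y i)"
    "\<And>i. norm (W i) \<le> c + 1 / real (Suc i)" by metis
  have "W i \<in> cball 0 (c + 1)" for i
  proof -
    have "1 / real (Suc i) \<le> 1" by (simp add: divide_le_eq_1)
    then have "norm (W i) \<le> c + 1" using YW(3)[of i] by linarith
    then show ?thesis by simp
  qed
  then obtain v \<sigma> where v: "strict_mono (\<sigma> :: nat \<Rightarrow> nat)" "(W \<circ> \<sigma>) \<longlonglongrightarrow> v"
    using compact_cball[of "0 :: 'a" "c + 1"] unfolding compact_def by metis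
  have ev: "eventually (\<lambda>i. 1 / real (Suc (\<sigma> i)) < e) sequentially" if "0 < e" for e
  proof -
    have "(\<lambda>i. inverse (real (Suc (\<sigma> i)))) \<longlonglongrightarrow> 0"
      using LIMSEQ_subseq_LIMSEQ[OF LIMSEQ_inverse_real_of_nat v(1)] by (simp add: o_def)
    from order_tendstoD(2)[OF this that] show ?thesis by (simp add: inverse_eq_divide)
  qed
  have "v \<in> limiting_subdifferential f x"
    unfolding limiting_subdifferential_iff[where f=f, OF fin]
  proof (intro allI impI)
    fix e :: real assume e: "0 < e"
    have "eventually (\<lambda>i. norm (W (\<sigma> i) - v) < e \<and> 1 / real (Suc (\<sigma> i)) < e) sequentially"
      using tendstoD[OF v(2) e] ev[OF e] by (auto simp: dist_norm intro: eventually_conj)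
    then obtain i where "norm (W (\<sigma> i) - v) < e" "1 / real (Suc (\<sigma> i)) < e"
      by (auto simp: eventually_sequentially)
    then show "\<exists>y. graph_near f x e y \<and> (\<exists>w\<in>frechet_subdifferential f y. norm (w - v) < e)"
      using YW graph_near_mono[OF YW(1)[of "\<sigma> i"]] by (meson less_imp_le)
  qed
  moreover have "norm v \<le> c"
  proof (rule field_le_epsilon)
    fix e :: real assume e: "0 < e"
    have "eventually (\<lambda>i. norm ((W \<circ> \<sigma>) i) \<le> c + e) sequentially"
      using ev[OF e]
    proof eventually_elim
      case (elim i)
      then show ?case using YW(3)[of "\<sigma> i"] by simp
    qed
    then show "norm v \<le> c + e"
      by (intro tendsto_upperbound[OF tendsto_norm[OF v(2)]]) auto
  qed
  ultimately show ?thesis by blast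
qed

lemma limiting_slope_eq_dist_zero:
  fixes f :: "'a::euclidean_space \<Rightarrow> ereal"
  assumes lsc: "lower_semicontinuous f" and fin: "\<bar>f x\<bar> \<noteq> \<infinity>"
  shows "limiting_slope f x = dist_zero (limiting_subdifferential f x)"
proof (rule antisym)
  show "limiting_slope f x \<le> dist_zero (limiting_subdifferential f x)"
    unfolding dist_zero_def by (intro INF_greatest limiting_slope_le_norm)
  show "dist_zero (limiting_subdifferential f x) \<le> limiting_slope f x"
  proof (cases "limiting_slope f x")
    case (real c)
    then obtain v where "v \<in> limiting_subdifferential f x" "norm v \<le> c"
      using limiting_subgradient_of_limiting_slope[OF lsc fin, of c] by auto
    then show ?thesis unfolding dist_zero_def real by (intro INF_lower2) auto
  next
    case MInf
    then show ?thesis using limiting_slope_nonneg[of f x] by simp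
  qed simp
qed

section \<open>Subgradients as normals to the epigraph\<close>

lemma frechet_normal_proximal_limit:
  fixes E :: "'a::euclidean_space set"
  assumes E: "closed E" and p: "p \<in> E"
    and normal: "\<And>\<epsilon>. 0 < \<epsilon> \<Longrightarrow> \<exists>\<rho>>0. \<forall>q\<in>E. norm (q - p) < \<rho> \<longrightarrow> u \<bullet> (q - p) \<le> \<epsilon> * norm (q - p)"
  shows "u \<in> proximal_limits E p"
  unfolding proximal_limits_def
proof (intro CollectI allI impI)
  fix e :: real assume e: "0 < e"
  obtain \<rho> where \<rho>: "0 < \<rho>" "\<And>q. q \<in> E \<Longrightarrow> norm (q - p) < \<rho> \<Longrightarrow> u \<bullet> (q - p) \<le> e / 3 * norm (q - p)"
    using normal[of "e / 3"] e by auto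
  define k where "k = 2 * norm u + 1"
  \<comment> \<open>Small enough that a nearest point to \<open>p + s *\<^sub>R u\<close> lies
    within both \<open>\<rho>\<close> and \<open>e\<close> of \<open>p\<close>, so that the Frechet
    inequality may be used there.\<close>
  define s where "s = min \<rho> e / 2 / k"
  have n: "0 < k" by (simp add: k_def add_nonneg_pos)
  have s: "0 < s" using \<rho> e n by (simp add: s_def)
  have su: "2 * s * norm u < min \<rho> e"
  proof -
    have "2 * s * norm u \<le> s * k" using s by (simp add: k_def algebra_simps)
    also have "\<dots> = min \<rho> e / 2" using n by (simp add: s_def)
    also have "\<dots> < min \<rho> e" using \<rho>(1) e by (auto simp: min_def)
    finally show ?thesis .
  qed
  \<comment> \<open>The residual of this projection, divided by \<open>s\<close>, is the proximal
    normal \<open>u'\<close> at \<open>y\<close>, with constant \<open>1 / (2 * s)\<close>. The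
    Frechet inequality makes the displacement \<open>d\<close> at most
    \<open>2 * s * (e / 3)\<close>, which keeps \<open>u'\<close> within \<open>e\<close> of
    \<open>u\<close>.\<close>
  obtain y where y: "y \<in> E" "\<And>q. q \<in> E \<Longrightarrow> dist (p + s *\<^sub>R u) y \<le> dist (p + s *\<^sub>R u) q"
    using distance_attains_inf[OF E, of "p + s *\<^sub>R u"] p by blast
  define d where "d = y - p"
  have sq: "(norm (s *\<^sub>R u - (y - p)))\<^sup>2 \<le> (norm (s *\<^sub>R u - (q - p)))\<^sup>2" if "q \<in> E" for q
    using y(2)[OF that] by (intro power_mono) (auto simp: dist_norm algebra_simps)
  have expand: "(norm (s *\<^sub>R u - a))\<^sup>2 = (norm (s *\<^sub>R u))\<^sup>2 - 2 * s * (u \<bullet> a) + (norm a)\<^sup>2" for a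
    by (simp add: power2_norm_eq_inner inner_diff_left inner_diff_right inner_commute algebra_simps)
      (simp add: power2_eq_square)
  have d2: "(norm d)\<^sup>2 \<le> 2 * s * (u \<bullet> d)"
    using sq[OF p] unfolding expand d_def by simp
  have d_small: "norm d \<le> 2 * s * norm u"
  proof (cases "d = 0")
    case False
    have "(norm d)\<^sup>2 \<le> 2 * s * (norm u * norm d)"
      using d2 norm_cauchy_schwarz[of u d] s by (meson mult_left_mono order_trans less_imp_le zero_le_mult_iff zero_le_numeral)
    then show ?thesis using False by (simp add: power2_eq_square)
  qed (use s in simp)
  have "u \<bullet> d \<le> e / 3 * norm d" using \<rho>(2)[OF y(1)] d_small su by (simp add: d_def)
  then have "2 * s * (u \<bullet> d) \<le> 2 * s * (e / 3 * norm d)" using s by (intro mult_left_mono) auto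
  then have "norm d * norm d \<le> 2 * s * (e / 3 * norm d)" using d2 unfolding power2_eq_square by linarith
  then have "norm d * norm d \<le> (2 * s * (e / 3)) * norm d" by (simp only: mult.assoc)
  then have ds: "norm d \<le> 2 * s * (e / 3)"
    using s e by (cases "d = 0") auto
  define u' where "u' = u - (1 / s) *\<^sub>R d"
  have "norm (u' - u) = norm d / s" using s by (simp add: u'_def)
  also have "\<dots> < e"
  proof -
    have "0 < s * e" using s e by simp
    then have "2 * s * (e / 3) < s * e" by (simp add: mult.commute)
    then have "norm d < e * s" using ds by (simp only: mult.commute[of e s])
    then show ?thesis using s by (simp add: pos_divide_less_eq)
  qed
  finally have u': "norm (u' - u) < e" .
  have "u' \<bullet> (q - y) \<le> 1 / (2 * s) * (norm (q - y))\<^sup>2" if q: "q \<in> E" for q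
  proof -
    have su': "s *\<^sub>R u' = s *\<^sub>R u - d" using s by (simp add: u'_def scaleR_diff_right)
    have "(norm (s *\<^sub>R u'))\<^sup>2 \<le> (norm (s *\<^sub>R u' - (q - y)))\<^sup>2"
      using sq[OF q] unfolding su' d_def by (simp add: algebra_simps)
    also have "\<dots> = (norm (s *\<^sub>R u'))\<^sup>2 - 2 * s * (u' \<bullet> (q - y)) + (norm (q - y))\<^sup>2"
      by (simp add: power2_norm_eq_inner inner_diff_left inner_diff_right inner_commute algebra_simps)
      (simp add: power2_eq_square)
    finally have "2 * s * (u' \<bullet> (q - y)) \<le> (norm (q - y))\<^sup>2" by simp
    then show ?thesis using s by (simp add: field_simps)
  qed
  moreover have "norm (y - p) < e" using d_small su by (simp add: d_def)
  ultimately show "\<exists>y u' \<kappa>. y \<in> E \<and> norm (y - p) < e \<and> norm (u' - u) < e \<and>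
     (\<forall>w\<in>E. u' \<bullet> (w - y) \<le> \<kappa> * (norm (w - y))\<^sup>2)"
    using y(1) u' by blast
qed

lemma proximal_limits_closed:
  assumes "\<And>e. 0 < e \<Longrightarrow> \<exists>z' u'. norm (z' - z) < e \<and> norm (u' - u) < e \<and> u' \<in> proximal_limits E z'"
  shows "u \<in> proximal_limits E z"
  unfolding proximal_limits_def
proof (intro CollectI allI impI)
  fix e :: real assume "0 < e"
  then have e: "0 < e / 2" by simp
  obtain z' u' where 1: "norm (z' - z) < e / 2" "norm (u' - u) < e / 2" "u' \<in> proximal_limits E z'"
    using assms[OF e] by blast
  obtain y w \<kappa> where 2: "y \<in> E" "norm (y - z') < e / 2" "norm (w - u') < e / 2"
    "\<forall>q\<in>E. w \<bullet> (q - y) \<le> \<kappa> * (norm (q - y))\<^sup>2"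
    using 1(3) e unfolding proximal_limits_def by blast
  have "norm (y - z) < e" "norm (w - u) < e"
    using 1 2 norm_triangle_ineq[of "y - z'" "z' - z"] norm_triangle_ineq[of "w - u'" "u' - u"] by auto
  then show "\<exists>y u' \<kappa>. y \<in> E \<and> norm (y - z) < e \<and> norm (u' - u) < e \<and>
     (\<forall>w\<in>E. u' \<bullet> (w - y) \<le> \<kappa> * (norm (w - y))\<^sup>2)"
    using 2 by blast
qed

lemma frechet_subgradient_epigraph_normal:
  fixes f :: "'a::euclidean_space \<Rightarrow> ereal"
  assumes lsc: "lower_semicontinuous f" and v: "v \<in> frechet_subdifferential f x"
  shows "(v, - 1) \<in> proximal_limits (epigraph f) (x, real_of_ereal (f x))"
proof (rule frechet_normal_proximal_limit[OF closed_epigraph[OF lsc]])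
  obtain F where F: "f x = ereal F" using frechet_subdifferential_finite[OF v] by auto
  show "(x, real_of_ereal (f x)) \<in> epigraph f" by (simp add: epigraph_def F)
  obtain r where r: "r \<in> o[at x](\<lambda>y. norm (y - x))"
    "eventually (\<lambda>y. f y \<ge> f x + ereal (v \<bullet> (y - x)) + ereal (r y)) (at x)"
    using v unfolding frechet_subdifferential_def by blast
  fix \<epsilon> :: real assume \<epsilon>: "0 < \<epsilon>"
  have "eventually (\<lambda>y. norm (r y) \<le> \<epsilon> * norm (norm (y - x)) \<and> f y \<ge> f x + ereal (v \<bullet> (y - x)) + ereal (r y)) (at x)"
    using landau_o.smallD[OF r(1) \<epsilon>] r(2) by (rule eventually_conj)
  then obtain \<rho> where \<rho>: "0 < \<rho>" "\<And>y. y \<noteq> x \<Longrightarrow> dist y x < \<rho> \<Longrightarrow>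
      \<bar>r y\<bar> \<le> \<epsilon> * norm (y - x) \<and> f y \<ge> ereal (F + v \<bullet> (y - x) + r y)"
    unfolding eventually_at by (auto simp: F)
  show "\<exists>\<rho>>0. \<forall>q\<in>epigraph f. norm (q - (x, real_of_ereal (f x))) < \<rho> \<longrightarrow>
      (v, - 1) \<bullet> (q - (x, real_of_ereal (f x))) \<le> \<epsilon> * norm (q - (x, real_of_ereal (f x)))"
  proof (intro exI[of _ \<rho>] conjI ballI impI \<rho>(1))
    fix q assume q: "q \<in> epigraph f" "norm (q - (x, real_of_ereal (f x))) < \<rho>"
    obtain y s where ys: "q = (y, s)" by (cases q)
    have fy: "f y \<le> ereal s" using q(1) by (simp add: epigraph_def ys)
    have ny: "norm (y - x) \<le> norm (q - (x, real_of_ereal (f x)))"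
      using norm_fst_le[of "y - x" "s - F"] by (simp add: ys F)
    have "v \<bullet> (y - x) - (s - F) \<le> \<epsilon> * norm (y - x)"
    proof (cases "y = x")
      case True
      then show ?thesis using fy by (simp add: F)
    next
      case False
      have *: "\<bar>r y\<bar> \<le> \<epsilon> * norm (y - x)" "ereal (F + v \<bullet> (y - x) + r y) \<le> ereal s"
      proof -
        have "dist y x < \<rho>" using ny q(2) by (simp add: dist_norm)
        from \<rho>(2)[OF False this] show "\<bar>r y\<bar> \<le> \<epsilon> * norm (y - x)" "ereal (F + v \<bullet> (y - x) + r y) \<le> ereal s"
          using fy by (blast, meson order_trans)
      qed
      then show ?thesis by (simp add: abs_le_iff)
    qed
    also have "\<dots> \<le> \<epsilon> * norm (q - (x, real_of_ereal (f x)))" using ny \<epsilon> by (intro mult_left_mono) auto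
    finally show "(v, - 1) \<bullet> (q - (x, real_of_ereal (f x))) \<le> \<epsilon> * norm (q - (x, real_of_ereal (f x)))"
      by (simp add: ys F)
  qed
qed

lemma graph_near_norm:
  assumes "graph_near f x e y"
  shows "norm ((y, real_of_ereal (f y)) - (x, real_of_ereal (f x))) < 2 * e"
  using assms norm_Pair_le[of "y - x" "real_of_ereal (f y) - real_of_ereal (f x)"]
  by (auto simp: graph_near_def)

lemma limiting_subgradient_epigraph_normal:
  fixes f :: "'a::euclidean_space \<Rightarrow> ereal"
  assumes lsc: "lower_semicontinuous f" and v: "v \<in> limiting_subdifferential f x"
  shows "(v, - 1) \<in> proximal_limits (epigraph f) (x, real_of_ereal (f x))"
proof (rule proximal_limits_closed)
  fix e :: real assume e: "0 < e"
  have fin: "\<bar>f x\<bar> \<noteq> \<infinity>" using v by (simp add: limiting_subdifferential_def)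
  obtain y w where y: "graph_near f x (e / 2) y" "w \<in> frechet_subdifferential f y" "norm (w - v) < e / 2"
    using v e unfolding limiting_subdifferential_iff[where f=f, OF fin] by (metis half_gt_zero)
  show "\<exists>z' u'. norm (z' - (x, real_of_ereal (f x))) < e \<and> norm (u' - (v, - 1)) < e \<and>
      u' \<in> proximal_limits (epigraph f) z'"
    using graph_near_norm[OF y(1)] y(3) e frechet_subgradient_epigraph_normal[OF lsc y(2)]
    by (intro exI[of _ "(y, real_of_ereal (f y))"] exI[of _ "(w, - 1)"]) (auto simp: norm_Pair)
qed

text \<open>The normals \<open>(V i, -1)\<close> are rescaled by \<open>\<tau> i\<close>, which
  sends their last coordinate to 0 while the first tends to \<open>v\<close>.\<close>

lemma horizon_subgradient_epigraph_normal:
  fixes f :: "'a::euclidean_space \<Rightarrow> ereal"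
  assumes lsc: "lower_semicontinuous f" and v: "v \<in> horizon_subdifferential f x"
  shows "(v, 0) \<in> proximal_limits (epigraph f) (x, real_of_ereal (f x))"
proof (rule proximal_limits_closed)
  fix e :: real assume "0 < e"
  then have e: "0 < e / 2" by simp
  have fin: "\<bar>f x\<bar> \<noteq> \<infinity>" using v by (simp add: horizon_subdifferential_def)
  obtain \<tau> X V where \<tau>: "\<And>i. \<tau> i > 0" "\<tau> \<longlonglongrightarrow> 0" and V: "\<And>i. V i \<in> frechet_subdifferential f (X i)"
    and lim: "(\<lambda>i::nat. (X i, f (X i), \<tau> i *\<^sub>R V i)) \<longlonglongrightarrow> (x, f x, v)"
    using v unfolding horizon_subdifferential_def by blast
  have "eventually (\<lambda>i. graph_near f x (e / 2) (X i)) sequentially"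
    using lim e unfolding triple_tendsto_iff graph_tendsto_iff[where f=f, OF fin] by blast
  moreover have "eventually (\<lambda>i. norm (\<tau> i *\<^sub>R V i - v) < e / 2) sequentially"
    using tendstoD[of "\<lambda>i. \<tau> i *\<^sub>R V i" v sequentially "e / 2"] lim e unfolding triple_tendsto_iff dist_norm
    by blast
  moreover have "eventually (\<lambda>i. \<tau> i < e / 2) sequentially" using order_tendstoD(2)[OF \<tau>(2) e] .
  ultimately have "eventually (\<lambda>i. graph_near f x (e / 2) (X i) \<and> norm (\<tau> i *\<^sub>R V i - v) < e / 2 \<and> \<tau> i < e / 2) sequentially"
    by (intro eventually_conj)
  then obtain i where i: "graph_near f x (e / 2) (X i)" "norm (\<tau> i *\<^sub>R V i - v) < e / 2" "\<tau> i < e / 2"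
    by (auto simp: eventually_sequentially)
  have "norm (\<tau> i *\<^sub>R (V i, - 1 :: real) - (v, 0)) \<le> norm (\<tau> i *\<^sub>R V i - v) + norm (- \<tau> i)"
    using norm_Pair_le[of "\<tau> i *\<^sub>R V i - v" "- \<tau> i"] by simp
  then have "norm (\<tau> i *\<^sub>R (V i, - 1 :: real) - (v, 0)) < e" using i \<tau>(1)[of i] by simp
  then show "\<exists>z' u'. norm (z' - (x, real_of_ereal (f x))) < e \<and> norm (u' - (v, 0)) < e \<and>
      u' \<in> proximal_limits (epigraph f) z'"
    using graph_near_norm[OF i(1)] proximal_limits_scaleR[OF frechet_subgradient_epigraph_normal[OF lsc V] \<tau>(1)[of i]]
    by (intro exI[of _ "(X i, real_of_ereal (f (X i)))"] exI[of _ "\<tau> i *\<^sub>R (V i, - 1)"]) auto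
qed

text \<open>A sequence of Frechet subgradients converging to \<open>v\<close>, multiplied by
  \<open>1 / (i + 1)\<close>, shows that 0 is a horizon subgradient; so \<open>v + 0\<close> is
  among the sums whose closed convex hull is taken.\<close>

lemma limiting_subset_clarke:
  fixes f :: "'a::euclidean_space \<Rightarrow> ereal"
  shows "limiting_subdifferential f x \<subseteq> clarke_subdifferential f x"
proof
  fix v assume v: "v \<in> limiting_subdifferential f x"
  then have fin: "\<bar>f x\<bar> \<noteq> \<infinity>" by (simp add: limiting_subdifferential_def)
  obtain X V where X: "\<And>i. V i \<in> frechet_subdifferential f (X i)"
    "(\<lambda>i::nat. (X i, f (X i), V i)) \<longlonglongrightarrow> (x, f x, v)"
    using v unfolding limiting_subdifferential_def by blast
  have "(\<lambda>i. inverse (real (Suc i)) *\<^sub>R V i) \<longlonglongrightarrow> 0 *\<^sub>R v"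
    using X(2) unfolding triple_tendsto_iff by (intro tendsto_scaleR LIMSEQ_inverse_real_of_nat) auto
  then have lim: "(\<lambda>i. (X i, f (X i), inverse (real (Suc i)) *\<^sub>R V i)) \<longlonglongrightarrow> (x, f x, 0)"
    using X(2) unfolding triple_tendsto_iff by simp
  have "decseq (\<lambda>i. inverse (real (Suc i)))" by (auto simp: decseq_def intro!: le_imp_inverse_le)
  then have *: "(\<forall>i. 0 < inverse (real (Suc i))) \<and> decseq (\<lambda>i. inverse (real (Suc i))) \<and>
      (\<lambda>i. inverse (real (Suc i))) \<longlonglongrightarrow> 0 \<and> (\<forall>i. V i \<in> frechet_subdifferential f (X i)) \<and>
      (\<lambda>i. (X i, f (X i), inverse (real (Suc i)) *\<^sub>R V i)) \<longlonglongrightarrow> (x, f x, 0)"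
    using X(1) lim LIMSEQ_inverse_real_of_nat by simp
  have "0 \<in> horizon_subdifferential f x"
    unfolding horizon_subdifferential_def using fin
    by (intro CollectI, intro conjI) (assumption, rule exI, rule exI, rule exI, rule *)
  then have "v \<in> {u + w | u w. u \<in> limiting_subdifferential f x \<and> w \<in> horizon_subdifferential f x}"
    using v by force
  then show "v \<in> clarke_subdifferential f x"
    unfolding clarke_subdifferential_def by (intro subsetD[OF closure_subset] hull_inc)
qed

text \<open>The vectors with prescribed inner product with \<open>v\<close> form a closed convex
  set, so the condition passes from the sums to their closed convex hull.\<close>

lemma clarke_inner_const:
  fixes f :: "'a::euclidean_space \<Rightarrow> ereal"
  assumes "\<And>p. p \<in> limiting_subdifferential f x \<Longrightarrow> p \<bullet> v = D"
    and "\<And>w. w \<in> horizon_subdifferential f x \<Longrightarrow> w \<bullet> v = 0"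
    and q: "q \<in> clarke_subdifferential f x"
  shows "q \<bullet> v = D"
proof -
  let ?H = "{q. v \<bullet> q = D}"
  have "{u + w | u w. u \<in> limiting_subdifferential f x \<and> w \<in> horizon_subdifferential f x} \<subseteq> ?H"
    using assms(1,2) by (auto simp: inner_add_right inner_commute)
  then have "convex hull {u + w | u w. u \<in> limiting_subdifferential f x \<and> w \<in> horizon_subdifferential f x} \<subseteq> ?H"
    by (rule hull_minimal) (rule convex_hyperplane)
  then have "clarke_subdifferential f x \<subseteq> ?H"
    unfolding clarke_subdifferential_def by (rule closure_minimal) (rule closed_hyperplane)
  then show ?thesis using q by (auto simp: inner_commute)
qed

section \<open>Curves of near-maximal slope\<close>

text \<open>Uniqueness of \<open>D\<close> is included because a curve of near-maximal slope comes
  with its own, only existentially given, derivative of \<open>f \<circ> x\<close>, which has to be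
  identified with this one.\<close>

definition chain_rule_at ::
    "('a::euclidean_space \<Rightarrow> ereal) \<Rightarrow> (real \<Rightarrow> 'a) \<Rightarrow> real \<Rightarrow> real \<Rightarrow> real \<Rightarrow> bool" where
  "chain_rule_at f x a b t \<longleftrightarrow> \<bar>f (x t)\<bar> \<noteq> \<infinity> \<and>
        (\<exists>D. has_ereal_derivative (f \<circ> x) D t {a..b} \<and>
          (\<forall>D'. has_ereal_derivative (f \<circ> x) D' t {a..b} \<longrightarrow> D' = D) \<and>
          (\<forall>v. (x has_vector_derivative v) (at t within {a..b}) \<longrightarrow>
            (\<forall>p\<in>limiting_subdifferential f (x t). p \<bullet> v = D) \<and>
            (\<forall>w\<in>horizon_subdifferential f (x t). w \<bullet> v = 0)))"

lemma curve_chain_rule_ae: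
  fixes f :: "'a::euclidean_space \<Rightarrow> ereal" and x :: "real \<Rightarrow> 'a"
  assumes lsc: "lower_semicontinuous f" and sf: "semialgebraic_function f"
    and anti: "antimono_on {a..b} (f \<circ> x)"
    and fin: "AE t\<in>{a..b} in lebesgue. \<bar>f (x t)\<bar> \<noteq> \<infinity>"
  shows "AE t\<in>{a..b} in lebesgue. chain_rule_at f x a b t"
proof -
  obtain N0 where N0: "negligible N0" "\<And>t. t \<in> {a..b} \<Longrightarrow> t \<notin> N0 \<Longrightarrow> \<bar>f (x t)\<bar> \<noteq> \<infinity>"
  proof (rule AE_E3[OF fin])
    fix N assume "\<And>t. t \<in> space lebesgue - N \<Longrightarrow> t \<in> {a..b} \<longrightarrow> \<bar>f (x t)\<bar> \<noteq> \<infinity>" "N \<in> null_sets lebesgue"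
    then show thesis by (intro that[of N]) (simp_all add: negligible_iff_null_sets)
  qed
  have dense: "\<exists>s. c < s \<and> s < d \<and> \<bar>f (x s)\<bar> \<noteq> \<infinity>" if cd: "a \<le> c" "c < d" "d \<le> b" for c d
  proof -
    have "\<not> negligible {c<..<d}" using cd(2) by (intro open_not_negligible) auto
    then have "\<not> {c<..<d} \<subseteq> N0" using negligible_subset[OF N0(1)] by blast
    then obtain s where "s \<in> {c<..<d}" "s \<notin> N0" by blast
    then show ?thesis using N0(2)[of s] cd by (intro exI[of _ s]) auto
  qed
  have le: "f (x t) \<le> f (x s)" if "s \<le> t" "a \<le> s" "t \<le> b" for s t
    using monotone_onD[OF anti, of s t] that by simp
  \<comment> \<open>Finiteness almost everywhere becomes finiteness at every interior time, since by
    monotonicity the value lies between finite values attained on either side.\<close>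
  have finite: "\<bar>f (x t)\<bar> \<noteq> \<infinity>" if t: "t \<in> {a<..<b}" for t
  proof -
    obtain s where s: "a < s" "s < t" "\<bar>f (x s)\<bar> \<noteq> \<infinity>" using dense[of a t] t by auto
    obtain u where u: "t < u" "u < b" "\<bar>f (x u)\<bar> \<noteq> \<infinity>" using dense[of t b] t by auto
    have "f (x t) \<le> f (x s)" "f (x u) \<le> f (x t)" using le s u t by auto
    then show ?thesis using s(3) u(3) by auto
  qed
  define g where "g t = real_of_ereal (f (x t))" for t
  have "mono_on {a<..<b} (\<lambda>t. - g t)"
  proof (rule mono_onI)
    fix s t assume st: "s \<in> {a<..<b}" "t \<in> {a<..<b}" "s \<le> t"
    obtain S T where "f (x s) = ereal S" "f (x t) = ereal T" using finite[OF st(1)] finite[OF st(2)] by auto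
    then show "- g s \<le> - g t" using le[of s t] st by (simp add: g_def)
  qed
  define N1 where "N1 = {t \<in> {a<..<b}. \<nexists>D. ((\<lambda>t. - g t) has_real_derivative D) (at t)}"
  have N1: "negligible N1" unfolding N1_def by (rule mono_on_differentiable_ae) fact
  define z where "z t = (x t, g t)" for t
  define N2 where "N2 = {t. \<exists>v u. (z has_vector_derivative v) (at t) \<and> u \<in> proximal_limits (epigraph f) (z t) \<and> u \<bullet> v \<noteq> 0}"
  have N2: "negligible N2"
    unfolding N2_def using sf unfolding semialgebraic_function_def
    by (rule proximal_limits_orthogonal_ae[OF closed_epigraph[OF lsc]])
  \<comment> \<open>The endpoints are discarded along with the null sets: finiteness was shown
    inside only, and only there is \<open>at t within {a..b}\<close> the full filter
    \<open>at t\<close>.\<close>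
  have main: "chain_rule_at f x a b t"
    if t: "t \<in> {a..b}" "t \<notin> {a, b} \<union> N1 \<union> N2" for t
  proof -
    have tab: "t \<in> {a<..<b}" using t by auto
    have at: "at t within {a..b} = at t" using tab by (intro at_within_Icc_at) auto
    obtain D0 where "((\<lambda>t. - g t) has_real_derivative D0) (at t)" using t(2) tab by (auto simp: N1_def)
    from DERIV_minus[OF this] have D: "(g has_real_derivative - D0) (at t)" by simp
    have ev: "eventually (\<lambda>s. \<bar>(f \<circ> x) s\<bar> \<noteq> \<infinity>) (at t within {a..b})"
    proof -
      have "eventually (\<lambda>s. s \<in> {a<..<b}) (at t)" using tab by (intro eventually_at_in_open') auto
      then show ?thesis unfolding at by eventually_elim (use finite in auto)
    qed
    have der: "has_ereal_derivative (f \<circ> x) D' t {a..b} \<longleftrightarrow> (g has_real_derivative D') (at t)" for D'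
      unfolding has_ereal_derivative_def using finite[OF tab] ev by (simp add: at g_def[abs_def])
    have orth: "u \<bullet> v + c * (- D0) = 0"
      if "(x has_vector_derivative v) (at t)" "(u, c) \<in> proximal_limits (epigraph f) (x t, real_of_ereal (f (x t)))" for u v c
    proof -
      have "(z has_vector_derivative (v, - D0)) (at t)"
        using that(1) D unfolding z_def[abs_def] has_real_derivative_iff_has_vector_derivative
        by (rule has_vector_derivative_Pair)
      then have "(u, c) \<bullet> (v, - D0) = 0"
        using t(2) that(2) unfolding N2_def z_def g_def by blast
      then show ?thesis by simp
    qed
    show ?thesis
      unfolding chain_rule_at_def
    proof (intro conjI exI[of _ "- D0"] allI impI ballI)
      show "\<bar>f (x t)\<bar> \<noteq> \<infinity>" by (rule finite[OF tab])
      show "has_ereal_derivative (f \<circ> x) (- D0) t {a..b}" using D by (simp add: der)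
      show "D' = - D0" if "has_ereal_derivative (f \<circ> x) D' t {a..b}" for D'
        using that D unfolding der by (rule DERIV_unique)
    next
      fix v p assume v: "(x has_vector_derivative v) (at t within {a..b})" and "p \<in> limiting_subdifferential f (x t)"
      then show "p \<bullet> v = - D0"
        using orth[OF v[unfolded at] limiting_subgradient_epigraph_normal[OF lsc]] by (force simp: eq_neg_iff_add_eq_0)
    next
      fix v w assume v: "(x has_vector_derivative v) (at t within {a..b})" and "w \<in> horizon_subdifferential f (x t)"
      then show "w \<bullet> v = 0"
        using orth[OF v[unfolded at] horizon_subgradient_epigraph_normal[OF lsc]] by simp
    qed
  qed
  have "negligible ({a, b} \<union> N1 \<union> N2)" using N1 N2 by (intro negligible_Un) auto
  then have "AE t in lebesgue. t \<notin> {a, b} \<union> N1 \<union> N2"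
    unfolding negligible_iff_null_sets by (rule AE_not_in)
  then show ?thesis by eventually_elim (intro impI main)
qed

text \<open>All Clarke subgradients have the inner product \<open>- (norm v)\<^sup>2\<close> with
  \<open>v\<close>, so by Cauchy-Schwarz none is shorter than \<open>- v\<close>. The limiting
  subdifferential lies between, containing \<open>- v\<close> and contained in the Clarke
  subdifferential, and has the same distance from the origin.\<close>

lemma subgradient_conditions:
  fixes f :: "'a::euclidean_space \<Rightarrow> ereal"
  assumes lsc: "lower_semicontinuous f"
    and p: "- v \<in> limiting_subdifferential f x"
    and chain: "\<And>p. p \<in> limiting_subdifferential f x \<Longrightarrow> p \<bullet> v = D"
      "\<And>w. w \<in> horizon_subdifferential f x \<Longrightarrow> w \<bullet> v = 0"
  shows "ereal (norm v) = dist_zero (limiting_subdifferential f x)"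
    and "ereal (norm v) = dist_zero (clarke_subdifferential f x)"
    and "ereal (norm v) = limiting_slope f x"
    and "D = - (norm v)\<^sup>2"
proof -
  show D: "D = - (norm v)\<^sup>2" using chain(1)[OF p] by (simp add: power2_norm_eq_inner)
  have le: "norm v \<le> norm q" if "q \<in> clarke_subdifferential f x" for q
  proof -
    have "q \<bullet> v = - (norm v)\<^sup>2" using clarke_inner_const[OF chain that] D by simp
    then have "(norm v)\<^sup>2 \<le> norm q * norm v" using Cauchy_Schwarz_ineq2[of q v] by simp
    then show ?thesis by (cases "norm v = 0") (auto simp: power2_eq_square)
  qed
  have dist: "ereal (norm v) = dist_zero Q" if Q: "- v \<in> Q" "Q \<subseteq> clarke_subdifferential f x" for Q
    unfolding dist_zero_def
  proof (rule antisym)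
    show "ereal (norm v) \<le> (INF v\<in>Q. ereal (norm v))" using le Q(2) by (intro INF_greatest) auto
    show "(INF v\<in>Q. ereal (norm v)) \<le> ereal (norm v)" using Q(1) by (intro INF_lower2[of "- v"]) auto
  qed
  show 1: "ereal (norm v) = dist_zero (limiting_subdifferential f x)"
    using p limiting_subset_clarke by (rule dist)
  show "ereal (norm v) = dist_zero (clarke_subdifferential f x)"
    using subsetD[OF limiting_subset_clarke p] by (rule dist) simp
  have "\<bar>f x\<bar> \<noteq> \<infinity>" using p by (simp add: limiting_subdifferential_def)
  then show "ereal (norm v) = limiting_slope f x" using limiting_slope_eq_dist_zero[OF lsc] 1 by metis
qed

theorem proposition4p16:
  fixes f :: "real ^ 'n \<Rightarrow> ereal"
    and x :: "real \<Rightarrow> real ^ 'n"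
    and a b :: real
  assumes "lower_semicontinuous f"
    and "semialgebraic_function f"
    and "locally_lipschitz_on_domain f"
    and "a \<le> b"
    and "absolutely_continuous_curve a b x"
  shows "(near_maximal_slope_curve f a b x \<longleftrightarrow>
            antimono_on {a..b} (f \<circ> x) \<and>
            (AE t\<in>{a..b} in lebesgue.
               \<exists>v. (x has_vector_derivative v) (at t within {a..b}) \<and>
                   v \<in> uminus ` limiting_subdifferential f (x t)))
       \<and> (near_maximal_slope_curve f a b x \<longleftrightarrow>
            antimono_on {a..b} (f \<circ> x) \<and>
            (AE t\<in>{a..b} in lebesgue.
               \<exists>v. (x has_vector_derivative v) (at t within {a..b}) \<and>
                   v \<in> uminus ` limiting_subdifferential f (x t) \<and>
                   ereal (norm v) = dist_zero (limiting_subdifferential f (x t)) \<and>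
                   ereal (norm v) = dist_zero (clarke_subdifferential f (x t))))"
    (is "(?A \<longleftrightarrow> ?B) \<and> (?A \<longleftrightarrow> ?C)")
proof -
  note lsc = assms(1)
  let ?a1 = "\<lambda>t. \<bar>f (x t)\<bar> \<noteq> \<infinity> \<and>
      (\<exists>v. (x has_vector_derivative v) (at t within {a..b}) \<and> ereal (norm v) = limiting_slope f (x t))"
  let ?a2 = "\<lambda>t. \<exists>D. has_ereal_derivative (f \<circ> x) D t {a..b} \<and> ereal D \<le> - ((limiting_slope f (x t))\<^sup>2)"
  let ?c = "\<lambda>t. \<exists>v. (x has_vector_derivative v) (at t within {a..b}) \<and>
      v \<in> uminus ` limiting_subdifferential f (x t) \<and>
      ereal (norm v) = dist_zero (limiting_subdifferential f (x t)) \<and>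
      ereal (norm v) = dist_zero (clarke_subdifferential f (x t))"
  have "?A \<Longrightarrow> ?C"
  proof
    assume A: ?A
    then show anti: "antimono_on {a..b} (f \<circ> x)" by (simp add: near_maximal_slope_curve_def)
    have A1: "AE t\<in>{a..b} in lebesgue. ?a1 t" and A2: "AE t\<in>{a..b} in lebesgue. ?a2 t"
      using A unfolding near_maximal_slope_curve_def by blast+
    have "AE t\<in>{a..b} in lebesgue. \<bar>f (x t)\<bar> \<noteq> \<infinity>" using A1 by (rule AE_mp) auto
    from curve_chain_rule_ae[OF lsc assms(2) anti this] A1 A2
    show "AE t\<in>{a..b} in lebesgue. ?c t"
    proof eventually_elim
      case (elim t)
      show ?case
      proof
        assume t: "t \<in> {a..b}"
        from elim(2)[rule_format, OF t] obtain v where fin: "\<bar>f (x t)\<bar> \<noteq> \<infinity>"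
          and v: "(x has_vector_derivative v) (at t within {a..b})" "ereal (norm v) = limiting_slope f (x t)"
          by (elim conjE exE)
        from elim(1)[unfolded chain_rule_at_def] t v(1) obtain D where D: "\<And>D'. has_ereal_derivative (f \<circ> x) D' t {a..b} \<Longrightarrow> D' = D"
          and chain: "\<And>p. p \<in> limiting_subdifferential f (x t) \<Longrightarrow> p \<bullet> v = D"
            "\<And>w. w \<in> horizon_subdifferential f (x t) \<Longrightarrow> w \<bullet> v = 0" by blast
        from elim(3) t D have "ereal D \<le> - ((limiting_slope f (x t))\<^sup>2)" by blast
        then have Dle: "D \<le> - (norm v)\<^sup>2" by (simp add: v(2)[symmetric])
        obtain p where p: "p \<in> limiting_subdifferential f (x t)" "norm p \<le> norm v"
          using limiting_subgradient_of_limiting_slope[OF lsc fin] v(2) by (metis order_refl)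
        \<comment> \<open>The equality case of Cauchy-Schwarz: the chain rule gives
          \<open>p \<bullet> v \<le> - (norm v)\<^sup>2\<close>, and together with
          \<open>norm p \<le> norm v\<close> this leaves only \<open>p = - v\<close>.\<close>
        have "(norm (p + v))\<^sup>2 = (norm p)\<^sup>2 + 2 * (p \<bullet> v) + (norm v)\<^sup>2"
          by (simp add: power2_norm_eq_inner inner_add_left inner_add_right inner_commute)
        also have "\<dots> \<le> 0"
        proof -
          have "(norm p)\<^sup>2 \<le> (norm v)\<^sup>2" using p(2) by (intro power_mono) auto
          then show ?thesis using chain(1)[OF p(1)] Dle by linarith
        qed
        finally have "p = - v" by (simp add: eq_neg_iff_add_eq_0)
        then have "- v \<in> limiting_subdifferential f (x t)" using p(1) by simp
        then show "?c t"
          using subgradient_conditions(1,2)[OF lsc _ chain] v(1)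
          by (intro exI[of _ v]) (auto simp: image_iff intro: bexI[of _ "- v"])
      qed
    qed
  qed
  moreover have "?C \<Longrightarrow> ?B"
    by (elim conjE, intro conjI, assumption, erule AE_mp) auto
  moreover have "?B \<Longrightarrow> ?A"
  proof -
    assume B: ?B
    then have anti: "antimono_on {a..b} (f \<circ> x)"
      and B1: "AE t\<in>{a..b} in lebesgue. \<exists>v. (x has_vector_derivative v) (at t within {a..b}) \<and>
          v \<in> uminus ` limiting_subdifferential f (x t)"
      by blast+
    \<comment> \<open>Finiteness is contained in the inclusion: the limiting subdifferential is
      empty where \<open>f\<close> is infinite.\<close>
    have "AE t\<in>{a..b} in lebesgue. \<bar>f (x t)\<bar> \<noteq> \<infinity>"
      using B1 by (rule AE_mp) (auto simp: limiting_subdifferential_def)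
    note chain = curve_chain_rule_ae[OF lsc assms(2) anti this]
    have "AE t\<in>{a..b} in lebesgue. ?a1 t \<and> ?a2 t"
      using chain B1
    proof eventually_elim
      case (elim t)
      show ?case
      proof
        assume t: "t \<in> {a..b}"
        from elim(2) t obtain v where v: "(x has_vector_derivative v) (at t within {a..b})"
          "- v \<in> limiting_subdifferential f (x t)" by auto
        from elim(1)[unfolded chain_rule_at_def, rule_format, OF t] obtain D where fin: "\<bar>f (x t)\<bar> \<noteq> \<infinity>"
          and D: "has_ereal_derivative (f \<circ> x) D t {a..b}"
          and "\<forall>v. (x has_vector_derivative v) (at t within {a..b}) \<longrightarrow>
            (\<forall>p\<in>limiting_subdifferential f (x t). p \<bullet> v = D) \<and>
            (\<forall>w\<in>horizon_subdifferential f (x t). w \<bullet> v = 0)"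
          by (elim conjE exE)
        then have chain: "\<And>p. p \<in> limiting_subdifferential f (x t) \<Longrightarrow> p \<bullet> v = D"
            "\<And>w. w \<in> horizon_subdifferential f (x t) \<Longrightarrow> w \<bullet> v = 0" using v(1) by blast+
        note * = subgradient_conditions(3,4)[OF lsc v(2) chain]
        have "ereal D \<le> - ((limiting_slope f (x t))\<^sup>2)" using *(2) by (simp add: *(1)[symmetric])
        then show "?a1 t \<and> ?a2 t"
          using fin v(1) *(1) D by blast
      qed
    qed
    then show ?A
      unfolding near_maximal_slope_curve_def using assms(5) anti
      by (intro conjI) (assumption, erule AE_mp, force, assumption, erule AE_mp, force)
  qed
  ultimately show ?thesis by blast
qed

end
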